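(* Let $\mathbb{K}=\mathbb{R}$ or $\mathbb{C}$, let $n\ge2$ and $m\ge1$ be integers, let $G=GL(n,\mathbb{K})$, let $P$ be its maximal parabolic subgroup such that $G/P\cong\mathbb{P}^{n-1}\mathbb{K}$, let $\mathcal{P}=\mathcal{P}_{n,m}$, and let $\pi\colon\mathrm{diag}(G)\backslash G^m/P^m\twoheadrightarrow\mathcal{P}$ be the surjection sending $\mathrm{diag}(G)\cdot F$ to the unique $p\in\mathcal{P}$ such that $F$ is $p$-constructible. For each element $p=(\{I_a\}_{a=1}^{A},\{J_b\}_{b=1}^{B},\{(K_c,r_c)\}_{c=1}^{C})\in\mathcal{P}$, one can define a map $$\iota_p\colon\prod_{c=1}^C(\mathbb{P}^{r_c-1}\mathbb{K})^{\#K_c-r_c-1}\to\pi^{-1}(p),\qquad q\mapsto\mathrm{diag}(G)\cdot F(p,q).$$ It is an open dense embedding (i.e. a homeomorphism onto an open dense subset of $\pi^{-1}(p)$), and if $C=0$ (in other words, the third family of $p$ is empty), then $\pi^{-1}(p)$ is a singleton and $\iota_p$ is a bijection between singletons.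
   Context: Notation: $\mathbb{N}=\{0,1,2,\ldots\}$; all vector spaces are over $\mathbb{K}$ and finite-dimensional. $\mathrm{diag}(G)\subset G^m$ is the diagonal subgroup. Projective spaces have their usual (Hausdorff) topology, orbit spaces the quotient topology, and fibres the subspace topology. Multiple flags. Let $\mathbf{d}=(r;d^{(1)},\ldots,d^{(m)})$ be non-negative integers with $d^{(i)}\le r$. For an $r$-dimensional vector space $V$, $Fl_{\mathbf{d}}(V)=\prod_{i=1}^m\mathrm{Gr}_{d^{(i)}}(V)$, with elements written $(V;V^{(1)},\ldots,V^{(m)})$, $V^{(i)}\subset V$ of dimension $d^{(i)}$. Such an element is called an $m$-tuple flag of dimension $\mathbf{d}$ (written $\dim D=\mathbf{d}$). Direct sum: $(V;V^{(i)})_i\oplus(W;W^{(i)})_i=(V\oplus W;V^{(i)}\oplus W^{(i)})_i$. Two $m$-tuple flags $(V;V^{(i)})_i$, $(W;W^{(i)})_i$ are isomorphic if there is a linear isomorphism $f\colon V\to W$ with $f(V^{(i)})=W^{(i)}$ for all $i$. An $m$-tuple flag is indecomposable if it is not isomorphic to a direct sum of two non-trivial ones (trivial means dimension $(0;0,\ldots,0)$). $G^m/P^m$ is identified with $Fl_{(n;1,\ldots,1)}(\mathbb{K}^n)=(\mathbb{P}^{n-1}\mathbb{K})^m$, with $G$ acting diagonally; two elements are in the same $\mathrm{diag}(G)$-orbit iff they are isomorphic, so any $m$-tuple flag of dimension $(n;1,\ldots,1)$ determines a $\mathrm{diag}(G)$-orbit after identifying its whole space with $\mathbb{K}^n$ by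 a linear isomorphism. For $K\subset\{1,\ldots,m\}$ and $r\in\mathbb{N}$ put $\mathbf{d}(K,r)=(r;\delta_{1,K},\ldots,\delta_{m,K})$, where $\delta_{i,K}=1$ if $i\in K$ and $0$ otherwise. The set $\mathcal{P}_{n,m}$: all tuples $p=(\{I_a\}_{a=1}^{A},\{J_b\}_{b=1}^{B},\{(K_c,r_c)\}_{c=1}^{C})$ (unordered families, each possibly empty) such that $\{1,\ldots,m\}$ is the disjoint union of all the $I_a$, $J_b$, $K_c$; $\#I_a\ge1$, $\#J_b\ge 3$, $r_c\in\mathbb{N}$, $4\le r_c+2\le \#K_c$ for all $a,b,c$; and $0\le r(p)\le n$, where $r(p):=A+\sum_{b=1}^B(\#J_b-1)+\sum_{c=1}^C r_c$. $p$-constructible: for $p=(\{I_a\}_{a=1}^{A},\{J_b\}_{b=1}^{B},\{(K_c,r_c)\}_{c=1}^{C})\in\mathcal{P}_{n,m}$, an $m$-tuple flag $F$ is $p$-constructible if $F$ is isomorphic to $\bigoplus_{k=1}^{n-r(p)}F_{\emptyset,k}\oplus\bigoplus_{a=1}^A F_a\oplus\bigoplus_{b=1}^B D_b\oplus\bigoplus_{c=1}^C E_c$ with all summands indecomposable $m$-tuple flags and $\dim F_{\emptyset,k}=\mathbf{d}(\emptyset,1)$, $\dim F_a=\mathbf{d}(I_a,1)$, $\dim D_b=\mathbf{d}(J_b,\#J_b-1)$, $\dim E_c=\mathbf{d}(K_c,r_c)$. Every $F\in G^m/P^m$ is $p$-constructible for exactly one $p\in\mathcal{P}_{n,m}$,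 and the resulting map $\pi$ is surjective. Representatives. Let $e_1,\ldots,e_r$ be the standard basis of $\mathbb{K}^r$. - For $I\subset\{1,\ldots,m\}$: $F(I)=(\mathbb{K};V^{(i)})_i$ with $V^{(i)}=\mathbb{K}$ if $i\in I$, $0$ otherwise. - For $J=\{j_1<\cdots<j_{r+1}\}\subset\{1,\ldots,m\}$ with $r\ge2$: $D(J)=(\mathbb{K}^r;V^{(i)})_i$ with $V^{(j_h)}=\mathbb{K}e_h$ for $1\le h\le r$, $V^{(j_{r+1})}=\mathbb{K}\sum_{h=1}^r e_h$, and $V^{(i)}=0$ for $i\notin J$. - For $K=\{k_1<\cdots<k_{\#K}\}\subset\{1,\ldots,m\}$, an integer $r$ with $4\le r+2\le\#K$, and $q=(q^{(r+2)},\ldots,q^{(\#K)})\in(\mathbb{P}^{r-1}\mathbb{K})^{\#K-r-1}$: $E(K,r,q)=(\mathbb{K}^r;V^{(i)})_i$ with $V^{(k_h)}=\mathbb{K}e_h$ for $1\le h\le r$, $V^{(k_{r+1})}=\mathbb{K}\sum_{h=1}^re_h$, $V^{(k_h)}=q^{(h)}$ for $r+2\le h\le\#K$, and $V^{(i)}=0$ for $i\notin K$. - For $p=(\{I_a\}_{a=1}^{A},\{J_b\}_{b=1}^{B},\{(K_c,r_c)\}_{c=1}^{C})\in\mathcal{P}_{n,m}$ and $q=(q_1,\ldots,q_C)\in\prod_{c=1}^C(\mathbb{P}^{r_c-1}\mathbb{K})^{\#K_c-r_c-1}$: $F(p,q)=F(\emptyset)^{\oplus(n-r(p))}\oplus\bigoplus_{a=1}^AF(I_a)\oplus\bigoplus_{b=1}^BD(J_b)\oplus\bigoplus_{c=1}^CE(K_c,r_c,q_c)$,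 which has dimension $(n;1,\ldots,1)$. *)

theory Defs
  imports "HOL-Analysis.Analysis" "HOL-Library.Function_Algebras"
begin

section \<open>Coordinate vector spaces\<close>

text \<open>
  All vector spaces live inside function spaces \<open>'i \<Rightarrow> 'k\<close> with pointwise operations, where the
  type \<open>'i\<close> of coordinates is arbitrary.
\<close>

definition fscale :: "'k::field \<Rightarrow> ('i \<Rightarrow> 'k) \<Rightarrow> ('i \<Rightarrow> 'k)" where
  "fscale c v = (\<lambda>i. c * v i)"

global_interpretation fv: vector_space "fscale :: 'k::field \<Rightarrow> ('i \<Rightarrow> 'k) \<Rightarrow> ('i \<Rightarrow> 'k)"
  by unfold_locales (auto simp: fscale_def fun_eq_iff algebra_simps)

text \<open>\<open>Kvec r\<close> is \<open>K\<^sup>r\<close>: its coordinates are numbered \<open>1, \<dots>, r\<close>, all others vanish.\<close>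

definition Kvec :: "nat \<Rightarrow> (nat \<Rightarrow> 'k::field) set" where
  "Kvec r = {v. \<forall>i. i \<notin> {1..r} \<longrightarrow> v i = 0}"

definition unit_vec :: "nat \<Rightarrow> nat \<Rightarrow> 'k::field" where
  "unit_vec h = (\<lambda>i. if i = h then 1 else 0)"

definition lin_iso :: "(('i \<Rightarrow> 'k::field) \<Rightarrow> ('j \<Rightarrow> 'k)) \<Rightarrow> ('i \<Rightarrow> 'k) set \<Rightarrow> ('j \<Rightarrow> 'k) set \<Rightarrow> bool" where
  "lin_iso f V W \<longleftrightarrow> bij_betw f V W \<and>
     (\<forall>u\<in>V. \<forall>v\<in>V. f (u + v) = f u + f v) \<and>
     (\<forall>c. \<forall>v\<in>V. f (fscale c v) = fscale c (f v))"

definition GL :: "nat \<Rightarrow> ((nat \<Rightarrow> 'k::field) \<Rightarrow> (nat \<Rightarrow> 'k)) set" where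
  "GL n = {g. lin_iso g (Kvec n) (Kvec n)}"


section \<open>Multiple flags\<close>

text \<open>
  \<open>(V, F)\<close> stands for \<open>(V; F 1, \<dots>, F m)\<close>; the values of \<open>F\<close> outside \<open>{1..m}\<close> are ignored.
  Finite-dimensionality is required explicitly because \<open>fv.dim\<close> is 0 on
  infinite-dimensional spaces.
\<close>

type_synonym ('i, 'k) mflag = "('i \<Rightarrow> 'k) set \<times> (nat \<Rightarrow> ('i \<Rightarrow> 'k) set)"

definition is_flag :: "nat \<Rightarrow> ('i, 'k::field) mflag \<Rightarrow> bool" where
  "is_flag m D \<longleftrightarrow> (\<exists>B. finite B \<and> fst D = fv.span B) \<and>
     (\<forall>i\<in>{1..m}. fv.subspace (snd D i) \<and> snd D i \<subseteq> fst D)"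

definition has_dim :: "nat \<Rightarrow> ('i, 'k::field) mflag \<Rightarrow> nat \<Rightarrow> (nat \<Rightarrow> nat) \<Rightarrow> bool" where
  "has_dim m D r d \<longleftrightarrow> is_flag m D \<and> fv.dim (fst D) = r \<and> (\<forall>i\<in>{1..m}. fv.dim (snd D i) = d i)"

definition flag_iso :: "nat \<Rightarrow> ('i, 'k::field) mflag \<Rightarrow> ('j, 'k) mflag \<Rightarrow> bool" where
  "flag_iso m D D' \<longleftrightarrow>
     (\<exists>f. lin_iso f (fst D) (fst D') \<and> (\<forall>i\<in>{1..m}. f ` snd D i = snd D' i))"

definition vsum2 :: "('i \<Rightarrow> 'k::field) set \<Rightarrow> ('j \<Rightarrow> 'k) set \<Rightarrow> ('i + 'j \<Rightarrow> 'k) set" where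
  "vsum2 V W = {v. v \<circ> Inl \<in> V \<and> v \<circ> Inr \<in> W}"

definition dsum2 :: "('i, 'k::field) mflag \<Rightarrow> ('j, 'k) mflag \<Rightarrow> ('i + 'j, 'k) mflag" where
  "dsum2 D E = (vsum2 (fst D) (fst E), \<lambda>i. vsum2 (snd D i) (snd E i))"

text \<open>External direct sums of families indexed by a finite set \<open>S\<close>.\<close>

definition vsum :: "'s set \<Rightarrow> ('s \<Rightarrow> ('i \<Rightarrow> 'k::field) set) \<Rightarrow> ('s \<times> 'i \<Rightarrow> 'k) set" where
  "vsum S V = {v. (\<forall>s\<in>S. (\<lambda>j. v (s, j)) \<in> V s) \<and> (\<forall>s j. s \<notin> S \<longrightarrow> v (s, j) = 0)}"

definition dsum :: "'s set \<Rightarrow> ('s \<Rightarrow> ('i, 'k::field) mflag) \<Rightarrow> ('s \<times> 'i, 'k) mflag" where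
  "dsum S D = (vsum S (\<lambda>s. fst (D s)), \<lambda>i. vsum S (\<lambda>s. snd (D s) i))"

text \<open>
  Every finite-dimensional space embeds into \<open>nat \<Rightarrow> 'k\<close>, so letting the two summands range over
  flags in \<open>nat \<Rightarrow> 'k\<close> covers all flags up to isomorphism.
\<close>

definition indecomposable :: "nat \<Rightarrow> ('i, 'k::field) mflag \<Rightarrow> bool" where
  "indecomposable m D \<longleftrightarrow>
     \<not> (\<exists>(D1 :: (nat, 'k) mflag) (D2 :: (nat, 'k) mflag).
          is_flag m D1 \<and> \<not> has_dim m D1 0 (\<lambda>_. 0) \<and>
          is_flag m D2 \<and> \<not> has_dim m D2 0 (\<lambda>_. 0) \<and>
          flag_iso m D (dsum2 D1 D2))"


section \<open>The index set\<close>

text \<open>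
  A triple \<open>(Is, Js, Ks)\<close> with \<open>Ks\<close> consisting of pairs \<open>(K, r)\<close>. The members of the
  families are non-empty and pairwise disjoint, so unordered families are just sets.
\<close>

type_synonym pdata = "nat set set \<times> nat set set \<times> (nat set \<times> nat) set"

fun rank_p :: "pdata \<Rightarrow> nat" where
  "rank_p (Is, Js, Ks) = card Is + (\<Sum>J\<in>Js. card J - 1) + (\<Sum>(K, r)\<in>Ks. r)"

definition Pset :: "nat \<Rightarrow> nat \<Rightarrow> pdata set" where
  "Pset n m = {(Is, Js, Ks).
     \<Union>Is \<union> \<Union>Js \<union> \<Union>(fst ` Ks) = {1..m} \<and>
     \<Union>Is \<inter> \<Union>Js = {} \<and> \<Union>Is \<inter> \<Union>(fst ` Ks) = {} \<and> \<Union>Js \<inter> \<Union>(fst ` Ks) = {} \<and>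
     disjoint Is \<and> disjoint Js \<and> disjoint_family_on fst Ks \<and>
     (\<forall>I\<in>Is. 1 \<le> card I) \<and> (\<forall>J\<in>Js. 3 \<le> card J) \<and>
     (\<forall>(K, r)\<in>Ks. 4 \<le> r + 2 \<and> r + 2 \<le> card K) \<and>
     rank_p (Is, Js, Ks) \<le> n}"

text \<open>The index set of the summands of a \<open>p\<close>-constructible flag.\<close>

datatype slot = EmptySlot nat | ISlot "nat set" | JSlot "nat set" | KSlot "nat set" nat

fun slots :: "nat \<Rightarrow> pdata \<Rightarrow> slot set" where
  "slots n (Is, Js, Ks) =
     EmptySlot ` {1..n - rank_p (Is, Js, Ks)} \<union> ISlot ` Is \<union> JSlot ` Js \<union> (\<lambda>(K, r). KSlot K r) ` Ks"

fun slot_support :: "slot \<Rightarrow> nat set" where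
  "slot_support (EmptySlot k) = {}"
| "slot_support (ISlot I) = I"
| "slot_support (JSlot J) = J"
| "slot_support (KSlot K r) = K"

fun slot_rank :: "slot \<Rightarrow> nat" where
  "slot_rank (EmptySlot k) = 1"
| "slot_rank (ISlot I) = 1"
| "slot_rank (JSlot J) = card J - 1"
| "slot_rank (KSlot K r) = r"

definition p_constructible :: "nat \<Rightarrow> nat \<Rightarrow> pdata \<Rightarrow> ('i, 'k::field) mflag \<Rightarrow> bool" where
  "p_constructible n m p F \<longleftrightarrow>
     (\<exists>D :: slot \<Rightarrow> (nat, 'k) mflag.
        (\<forall>s\<in>slots n p. indecomposable m (D s) \<and>
           has_dim m (D s) (slot_rank s) (\<lambda>i. if i \<in> slot_support s then 1 else 0)) \<and>
        flag_iso m F (dsum (slots n p) D))"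


section \<open>Projective spaces, orbit spaces and fibres\<close>

definition quotient_top :: "'a topology \<Rightarrow> ('a \<Rightarrow> 'b) \<Rightarrow> 'b topology" where
  "quotient_top X f =
     topology (\<lambda>U. U \<subseteq> f ` topspace X \<and> openin X {x \<in> topspace X. f x \<in> U})"

lemma openin_quotient_top:
  "openin (quotient_top X f) U \<longleftrightarrow> U \<subseteq> f ` topspace X \<and> openin X {x \<in> topspace X. f x \<in> U}"
proof -
  have "istopology (\<lambda>U. U \<subseteq> f ` topspace X \<and> openin X {x \<in> topspace X. f x \<in> U})"
    unfolding istopology_def
  proof (rule conjI; intro allI impI)
    fix S T
    assume S: "S \<subseteq> f ` topspace X \<and> openin X {x \<in> topspace X. f x \<in> S}"
      and T: "T \<subseteq> f ` topspace X \<and> openin X {x \<in> topspace X. f x \<in> T}"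
    have "{x \<in> topspace X. f x \<in> S \<inter> T} = {x \<in> topspace X. f x \<in> S} \<inter> {x \<in> topspace X. f x \<in> T}"
      by auto
    with S T show "S \<inter> T \<subseteq> f ` topspace X \<and> openin X {x \<in> topspace X. f x \<in> S \<inter> T}"
      by auto
  next
    fix \<U>
    assume U: "\<forall>S\<in>\<U>. S \<subseteq> f ` topspace X \<and> openin X {x \<in> topspace X. f x \<in> S}"
    have "{x \<in> topspace X. f x \<in> \<Union>\<U>} = (\<Union>S\<in>\<U>. {x \<in> topspace X. f x \<in> S})"
      by auto
    with U show "\<Union>\<U> \<subseteq> f ` topspace X \<and> openin X {x \<in> topspace X. f x \<in> \<Union>\<U>}"
      by auto
  qed
  then show ?thesis
    by (simp add: quotient_top_def)
qed

lemma topspace_quotient_top [simp]: "topspace (quotient_top X f) = f ` topspace X"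
proof -
  have "{x \<in> topspace X. f x \<in> f ` topspace X} = topspace X"
    by auto
  then have "openin (quotient_top X f) (f ` topspace X)"
    by (simp add: openin_quotient_top)
  then show ?thesis
    by (metis openin_quotient_top openin_subset openin_topspace subset_antisym)
qed

lemma quotient_map_quotient_top: "quotient_map X (quotient_top X f) f"
  by (simp add: quotient_map_def openin_quotient_top)

text \<open>The space of lines in \<open>K\<^sup>r\<close>, a line being the set of its vectors.\<close>

type_synonym 'k line = "(nat \<Rightarrow> 'k) set"

definition proj_space :: "nat \<Rightarrow> 'k::real_normed_field line topology" where
  "proj_space r = quotient_top (top_of_set (Kvec r - {0})) (\<lambda>v. fv.span {v})"

text \<open>\<open>G\<^sup>m/P\<^sup>m\<close>, identified with the \<open>m\<close>-fold product of the space of lines in \<open>K\<^sup>n\<close>.\<close>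

type_synonym 'k config = "nat \<Rightarrow> 'k line"

definition config_space :: "nat \<Rightarrow> nat \<Rightarrow> 'k::real_normed_field config topology" where
  "config_space n m = product_topology (\<lambda>_. proj_space n) {1..m}"

definition diag_orbit :: "nat \<Rightarrow> nat \<Rightarrow> 'k::field config \<Rightarrow> 'k config set" where
  "diag_orbit n m F = {\<lambda>i\<in>{1..m}. g ` F i | g. g \<in> GL n}"

definition orbit_space :: "nat \<Rightarrow> nat \<Rightarrow> 'k::real_normed_field config set topology" where
  "orbit_space n m = quotient_top (config_space n m) (diag_orbit n m)"

definition pi_map :: "nat \<Rightarrow> nat \<Rightarrow> 'k::field config set \<Rightarrow> pdata" where
  "pi_map n m Orb = (THE p. p \<in> Pset n m \<and> (\<forall>F\<in>Orb. p_constructible n m p (Kvec n, F)))"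

definition fibre :: "nat \<Rightarrow> nat \<Rightarrow> pdata \<Rightarrow> 'k::real_normed_field config set set" where
  "fibre n m p = {Orb \<in> topspace (orbit_space n m). pi_map n m Orb = p}"

definition fibre_space :: "nat \<Rightarrow> nat \<Rightarrow> pdata \<Rightarrow> 'k::real_normed_field config set topology" where
  "fibre_space n m p = subtopology (orbit_space n m) (fibre n m p)"

text \<open>The diagonal orbit determined by a flag of dimension \<open>(n; 1, \<dots>, 1)\<close>.\<close>

definition flag_orbit :: "nat \<Rightarrow> nat \<Rightarrow> ('i, 'k::field) mflag \<Rightarrow> 'k config set" where
  "flag_orbit n m D =
     (THE Orb. \<exists>f. lin_iso f (fst D) (Kvec n) \<and> Orb = diag_orbit n m (\<lambda>i\<in>{1..m}. f ` snd D i))"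


section \<open>Representatives and the maps into the fibres\<close>

text \<open>For \<open>K = {k\<^sub>1 < k\<^sub>2 < \<dots>}\<close> and \<open>i = k\<^sub>h\<close>, \<open>pos K i = h\<close>.\<close>

definition pos :: "nat set \<Rightarrow> nat \<Rightarrow> nat" where
  "pos K i = card {k \<in> K. k \<le> i}"

definition F_rep :: "nat set \<Rightarrow> (nat, 'k::field) mflag" where
  "F_rep I = (Kvec 1, \<lambda>i. if i \<in> I then Kvec 1 else {0})"

definition D_rep :: "nat set \<Rightarrow> (nat, 'k::field) mflag" where
  "D_rep J = (let r = card J - 1 in
     (Kvec r, \<lambda>i. if i \<notin> J then {0}
                  else if pos J i \<le> r then fv.span {unit_vec (pos J i)}
                  else fv.span {\<Sum>h=1..r. unit_vec h}))"

definition E_rep :: "nat set \<Rightarrow> nat \<Rightarrow> (nat \<Rightarrow> 'k line) \<Rightarrow> (nat, 'k::field) mflag" where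
  "E_rep K r q =
     (Kvec r, \<lambda>i. if i \<notin> K then {0}
                  else if pos K i \<le> r then fv.span {unit_vec (pos K i)}
                  else if pos K i = r + 1 then fv.span {\<Sum>h=1..r. unit_vec h}
                  else q (pos K i))"

type_synonym 'k params = "nat set \<times> nat \<Rightarrow> nat \<Rightarrow> 'k line"

fun param_space :: "pdata \<Rightarrow> 'k::real_normed_field params topology" where
  "param_space (Is, Js, Ks) =
     product_topology (\<lambda>(K, r). product_topology (\<lambda>_. proj_space r) {r + 2..card K}) Ks"

fun slot_rep :: "'k::field params \<Rightarrow> slot \<Rightarrow> (nat, 'k) mflag" where
  "slot_rep q (EmptySlot k) = F_rep {}"
| "slot_rep q (ISlot I) = F_rep I"
| "slot_rep q (JSlot J) = D_rep J"
| "slot_rep q (KSlot K r) = E_rep K r (q (K, r))"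

definition Fpq :: "nat \<Rightarrow> pdata \<Rightarrow> 'k::field params \<Rightarrow> (slot \<times> nat, 'k) mflag" where
  "Fpq n p q = dsum (slots n p) (slot_rep q)"

definition iota :: "nat \<Rightarrow> nat \<Rightarrow> pdata \<Rightarrow> 'k::field params \<Rightarrow> 'k config set" where
  "iota n m p q = flag_orbit n m (Fpq n p q)"

definition open_dense_embedding :: "'a topology \<Rightarrow> 'b topology \<Rightarrow> ('a \<Rightarrow> 'b) \<Rightarrow> bool" where
  "open_dense_embedding X Y f \<longleftrightarrow>
     embedding_map X Y f \<and> openin Y (f ` topspace X) \<and> Y closure_of (f ` topspace X) = topspace Y"

end

theory Submission
  imports Defs
begin

text \<open>
  A configuration of lines, spanned by vectors \<open>v 1, \<dots>, v m\<close>, has index \<open>p\<close> iff the blocks of \<open>p\<close>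
  are the connected components of the matroid of \<open>v\<close>, with the ranks prescribed by \<open>p\<close>; components
  are unique because the rank function is submodular. Inside such a stratum consider the
  configurations for which the first \<open>r + 1\<close> vectors of every block \<open>(K, r)\<close> form a circuit. Up to
  \<open>GL\<close> and rescaling the circuit is the standard projective frame, whose stabiliser consists of
  scalars, so the remaining lines of the block, in the coordinates of this frame, are a complete
  invariant of the orbit; these coordinates depend continuously on \<open>v\<close>. Being a circuit is an open
  condition, and it is dense: moving \<open>v\<close> towards a fixed circuit \<open>u\<close> along \<open>v + t u\<close>, independence
  fails only for finitely many \<open>t\<close>, which are eigenvalues of an endomorphism.
\<close>


section \<open>Ranks and independent families of vectors\<close>

text \<open>In general the fibre is not Hausdorff. For four lines in a plane it is a projective line
  with three points doubled, the extra points being the orbits where two of the first three lines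
  coincide; so compactness of the parameter space cannot replace a proof that \<open>iota\<close> is
  open. Openness comes instead from the continuous map
  \<open>v \<mapsto> params_of (frame_coords v)\<close> on generic vectors, whose composition with
  \<open>iota\<close> is the orbit of \<open>v\<close>. For this everything is lifted from lines to
  spanning vectors: \<open>vec_orbit\<close> is open and continuous, being a quotient by the actions
  of \<open>GL n\<close> and of scalings, and it sends relatively open subsets of a stratum to open
  subsets of the fibre. Uniqueness of the decomposition is obtained without a Krull-Schmidt theorem,
  since separators of the matroid correspond to splittings of the flag. Determinants are avoided
  too: openness of independence and continuity of coordinates rest on an estimate with dual
  functionals. Blocks \<open>I\<close> have rank 1 and blocks \<open>J\<close> are circuits
  throughout their stratum, so all moduli and all degenerations sit in the blocks
  \<open>(K, r)\<close>.\<close>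

lemma independent_card_le_dim:
  fixes X B :: "('i \<Rightarrow> 'k::field) set"
  assumes "finite X" "fv.independent B" "B \<subseteq> fv.span X"
  shows "finite B \<and> card B \<le> fv.dim X"
proof -
  obtain C where C: "C \<subseteq> X" "fv.independent C" "X \<subseteq> fv.span C" "card C = fv.dim X"
    using fv.basis_exists by blast
  have "finite C" using C(1) assms(1) finite_subset by blast
  moreover have "B \<subseteq> fv.span C"
    using C(3) assms(3) by (metis fv.span_minimal fv.subspace_span subset_trans)
  ultimately show ?thesis using fv.independent_span_bound[OF _ assms(2)] C(4) by metis
qed

lemma dim_mono_span:
  fixes X Y :: "('i \<Rightarrow> 'k::field) set"
  assumes "finite Y" "X \<subseteq> fv.span Y"
  shows "fv.dim X \<le> fv.dim Y"
proof -
  obtain C where C: "C \<subseteq> X" "fv.independent C" "X \<subseteq> fv.span C" "card C = fv.dim X"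
    using fv.basis_exists by blast
  then show ?thesis using independent_card_le_dim[OF assms(1) C(2)] assms(2) by auto
qed

text \<open>Half of the dimension formula, enough for submodularity. A basis \<open>B0\<close> of
  the intersection is extended to a basis \<open>B\<close> of the span of \<open>X\<close> and then,
  by vectors of \<open>Y\<close> only, to a basis \<open>C\<close> of the whole. So
  \<open>B0\<close> together with \<open>C - B\<close> is independent in the span of
  \<open>Y\<close>.\<close>

lemma dim_union_inter_le:
  fixes X Y :: "('i \<Rightarrow> 'k::field) set"
  assumes "finite X" "finite Y"
  shows "fv.dim (X \<union> Y) + fv.dim (fv.span X \<inter> fv.span Y) \<le> fv.dim X + fv.dim Y"
proof -
  obtain B0 where B0: "B0 \<subseteq> fv.span X \<inter> fv.span Y" "fv.independent B0"
    "card B0 = fv.dim (fv.span X \<inter> fv.span Y)"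
    using fv.basis_exists by metis
  obtain B where B: "B0 \<subseteq> B" "B \<subseteq> fv.span X" "fv.independent B" "fv.span X \<subseteq> fv.span B"
    using fv.maximal_independent_subset_extend[of B0 "fv.span X"] B0 by auto
  obtain C where C: "B \<subseteq> C" "C \<subseteq> B \<union> Y" "fv.independent C" "B \<union> Y \<subseteq> fv.span C"
    using fv.maximal_independent_subset_extend[of B "B \<union> Y"] B by auto
  have finB: "finite B" "card B \<le> fv.dim X"
    using independent_card_le_dim[OF assms(1) B(3,2)] by auto
  have finB0: "finite B0" using finB B finite_subset by blast
  have "C - B \<subseteq> Y" using C by auto
  then have sub: "B0 \<union> (C - B) \<subseteq> fv.span Y" using B0(1) fv.span_superset[of Y] by blast
  have ind: "fv.independent (B0 \<union> (C - B))"
    by (rule fv.independent_mono[OF C(3)]) (use B C in auto)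
  have fin: "finite (B0 \<union> (C - B))" and le: "card (B0 \<union> (C - B)) \<le> fv.dim Y"
    using independent_card_le_dim[OF assms(2) ind sub] by auto
  have finC: "finite (C - B)" using fin by auto
  have "card (B0 \<union> (C - B)) = card B0 + card (C - B)"
    by (rule card_Un_disjoint) (use finB0 finC B in auto)
  moreover have "card C = card B + card (C - B)"
    using C(1) finB(1) finC card_Un_disjoint[of B "C - B"] by (auto simp: Un_absorb1)
  moreover have "fv.dim (X \<union> Y) = card C"
  proof (rule fv.dim_eq_card)
    have "X \<subseteq> fv.span C"
      using B(4) fv.span_superset[of X] fv.span_mono[OF C(1)] by blast
    moreover have "Y \<subseteq> fv.span C" using C(4) by blast
    ultimately have "fv.span (X \<union> Y) \<subseteq> fv.span C" by (intro fv.span_minimal) auto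
    moreover have "C \<subseteq> fv.span (X \<union> Y)"
      using B(2) C(2) fv.span_mono[of X "X \<union> Y"] fv.span_superset[of "X \<union> Y"] by blast
    then have "fv.span C \<subseteq> fv.span (X \<union> Y)" by (intro fv.span_minimal) auto
    ultimately show "fv.span C = fv.span (X \<union> Y)" by blast
  qed (rule C(3))
  ultimately show ?thesis using le finB(2) B0(3) by linarith
qed

lemma dim_union_ge:
  fixes X Y :: "('i \<Rightarrow> 'k::field) set"
  assumes "finite X" "finite Y" "fv.span X \<inter> fv.span Y \<subseteq> {0}"
  shows "fv.dim X + fv.dim Y \<le> fv.dim (X \<union> Y)"
proof -
  obtain B where B: "B \<subseteq> X" "fv.independent B" "X \<subseteq> fv.span B" "card B = fv.dim X"
    using fv.basis_exists by blast
  have finB: "finite B" using B(1) assms(1) finite_subset by blast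
  obtain C where C: "B \<subseteq> C" "C \<subseteq> B \<union> Y" "fv.independent C" "B \<union> Y \<subseteq> fv.span C"
    using fv.maximal_independent_subset_extend[of B "B \<union> Y"] B by auto
  have finC: "finite C" using C(2) finB assms(2) finite_subset by blast
  \<comment> \<open>Write \<open>y\<close> along \<open>B\<close> and \<open>C - B\<close>. The
    \<open>B\<close>-part is a difference of two elements of the span of \<open>Y\<close> and also
    lies in the span of \<open>X\<close>, so it vanishes.\<close>
  have "Y \<subseteq> fv.span (C - B)"
  proof
    fix y assume y: "y \<in> Y"
    have "B \<union> (C - B) = C" using C(1) by auto
    then have "y \<in> fv.span (B \<union> (C - B))" using C y by auto
    then obtain b c where bc: "y = b + c" "b \<in> fv.span B" "c \<in> fv.span (C - B)"
      unfolding fv.span_Un by blast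
    have "c \<in> fv.span Y" using bc(3) C(2) fv.span_mono[of "C - B" Y] by auto
    moreover have "b = y - c" using bc(1) by simp
    ultimately have "b \<in> fv.span Y" using y by (simp add: fv.span_diff fv.span_base)
    moreover have "b \<in> fv.span X" using bc(2) B(1) fv.span_mono by blast
    ultimately have "b = 0" using assms(3) by auto
    then show "y \<in> fv.span (C - B)" using bc by simp
  qed
  then have "fv.dim Y \<le> card (C - B)" using finC by (simp add: fv.dim_le_card)
  moreover have "card C = card B + card (C - B)"
    using C(1) finB finC card_Un_disjoint[of B "C - B"] by (auto simp: Un_absorb1)
  moreover have "card C \<le> fv.dim (X \<union> Y)"
  proof -
    have "C \<subseteq> fv.span (X \<union> Y)" using C(2) B(1) fv.span_superset[of "X \<union> Y"] by blast
    then show ?thesis using independent_card_le_dim[OF _ C(3)] assms by auto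
  qed
  ultimately show ?thesis using B(4) by linarith
qed

lemma span_inter_zero:
  fixes X Y :: "('i \<Rightarrow> 'k::field) set"
  assumes "finite X" "finite Y" "fv.dim X + fv.dim Y \<le> fv.dim (X \<union> Y)"
  shows "fv.span X \<inter> fv.span Y = {0}"
proof -
  have "fv.dim (fv.span X \<inter> fv.span Y) = 0"
    using dim_union_inter_le[OF assms(1,2)] assms(3) by linarith
  then obtain C where C: "C \<subseteq> fv.span X \<inter> fv.span Y" "fv.independent C"
     "fv.span X \<inter> fv.span Y \<subseteq> fv.span C" "card C = 0"
    using fv.basis_exists by metis
  have "finite C" using independent_card_le_dim[OF assms(1) C(2)] C(1) by auto
  then have "C = {}" using C(4) by simp
  then show ?thesis using C(3) fv.span_zero by auto
qed

section \<open>Matroid rank of an indexed configuration of vectors\<close>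

definition rk :: "(nat \<Rightarrow> 'i \<Rightarrow> 'k::field) \<Rightarrow> nat set \<Rightarrow> nat" where
  "rk v A = fv.dim (v ` A)"

lemma rk_mono_span: "finite B \<Longrightarrow> v ` A \<subseteq> fv.span (v ` B) \<Longrightarrow> rk v A \<le> rk v B"
  unfolding rk_def by (rule dim_mono_span) auto

lemma rk_mono: "finite B \<Longrightarrow> A \<subseteq> B \<Longrightarrow> rk v A \<le> rk v B"
  by (rule rk_mono_span) (use fv.span_superset in blast)+

lemma rk_empty [simp]: "rk v {} = 0"
  by (simp add: rk_def fv.dim_eq_card_independent[OF fv.independent_empty])

lemma rk_le_card: "finite A \<Longrightarrow> rk v A \<le> card A"
  unfolding rk_def by (meson card_image_le finite_imageI fv.dim_le_card' order_trans)

text \<open>\<open>rk v (A \<inter> B)\<close> is bounded by the dimension of the intersection of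
  the two spans. That dimension can be larger, since vectors at different indices may have a common
  span; hence only an inequality.\<close>

lemma rk_submodular:
  assumes "finite A" "finite B"
  shows "rk v (A \<union> B) + rk v (A \<inter> B) \<le> rk v A + rk v B"
proof -
  have "rk v (A \<inter> B) \<le> fv.dim (fv.span (v ` A) \<inter> fv.span (v ` B))"
  proof -
    obtain C where C: "C \<subseteq> v ` (A \<inter> B)" "fv.independent C" "card C = rk v (A \<inter> B)"
      using fv.basis_exists unfolding rk_def by metis
    have C': "C \<subseteq> fv.span (v ` A) \<inter> fv.span (v ` B)"
      using C(1) fv.span_base by blast
    then obtain D where D: "C \<subseteq> D" "D \<subseteq> fv.span (v ` A) \<inter> fv.span (v ` B)" "fv.independent D"
       "fv.span (v ` A) \<inter> fv.span (v ` B) \<subseteq> fv.span D"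
      using fv.maximal_independent_subset_extend[OF C' C(2)] by auto
    have "finite D" using independent_card_le_dim[OF _ D(3), of "v ` A"] D(2) assms by auto
    then show ?thesis using fv.basis_card_eq_dim[OF D(2,4,3)] D(1) C(3) card_mono by metis
  qed
  then show ?thesis
    using dim_union_inter_le[of "v ` A" "v ` B"] assms by (simp add: rk_def image_Un)
qed

lemma rk_subadditive: "finite A \<Longrightarrow> finite B \<Longrightarrow> rk v (A \<union> B) \<le> rk v A + rk v B"
  using rk_submodular[of A B v] by linarith

lemma rk_Union_le:
  assumes "finite T" "\<And>s. s \<in> T \<Longrightarrow> finite (S s)"
  shows "rk v (\<Union>s\<in>T. S s) \<le> (\<Sum>s\<in>T. rk v (S s))"
  using assms
proof (induction T)
  case (insert s T)
  then have "rk v (\<Union>s\<in>insert s T. S s) \<le> rk v (S s) + rk v (\<Union>s\<in>T. S s)"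
    using rk_subadditive[of "S s" "\<Union>s\<in>T. S s" v] by simp
  then show ?case using insert by fastforce
qed simp

lemma rk_additive_iff:
  assumes "finite A" "finite B"
  shows "rk v A + rk v B = rk v (A \<union> B) \<longleftrightarrow> fv.span (v ` A) \<inter> fv.span (v ` B) = {0}"
proof
  assume "rk v A + rk v B = rk v (A \<union> B)"
  then show "fv.span (v ` A) \<inter> fv.span (v ` B) = {0}"
    using assms by (intro span_inter_zero) (auto simp: rk_def image_Un)
next
  assume "fv.span (v ` A) \<inter> fv.span (v ` B) = {0}"
  then have "rk v A + rk v B \<le> rk v (A \<union> B)"
    using dim_union_ge[of "v ` A" "v ` B"] assms by (simp add: rk_def image_Un)
  then show "rk v A + rk v B = rk v (A \<union> B)"
    using rk_subadditive[OF assms, of v] by linarith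
qed

text \<open>A separation of \<open>X \<union> Y\<close> cuts every subset additively. Submodularity
  is applied to \<open>S\<close> and \<open>X\<close>, then to \<open>S \<union> X\<close> and
  \<open>Y\<close>; in the sum of the two inequalities the ranks of \<open>X\<close> and
  \<open>Y\<close> cancel by \<open>eq\<close>.\<close>

lemma rk_split:
  assumes fin: "finite X" "finite Y" and S: "S \<subseteq> X \<union> Y"
    and eq: "rk v (X \<union> Y) = rk v X + rk v Y" and disj: "X \<inter> Y = {}"
  shows "rk v S = rk v (S \<inter> X) + rk v (S \<inter> Y)"
proof -
  have finS: "finite S" using fin S finite_subset by blast
  have 1: "rk v (S \<union> X) + rk v (S \<inter> X) \<le> rk v S + rk v X"
    by (rule rk_submodular) (use fin finS in auto)
  have 2: "rk v ((S \<union> X) \<union> Y) + rk v ((S \<union> X) \<inter> Y) \<le> rk v (S \<union> X) + rk v Y"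
    by (rule rk_submodular) (use fin finS in auto)
  have "(S \<union> X) \<union> Y = X \<union> Y" "(S \<union> X) \<inter> Y = S \<inter> Y" using S disj by auto
  moreover have "rk v S \<le> rk v (S \<inter> X) + rk v (S \<inter> Y)"
    using rk_subadditive[of "S \<inter> X" "S \<inter> Y" v] finS S by (simp add: Int_Un_distrib[symmetric] Int_absorb2)
  ultimately show ?thesis using 1 2 eq by simp
qed

text \<open>Independence of an indexed family, in which equal vectors at different indices count as
  dependent. \<open>fv.independent\<close> of the image set would not notice the repetition.\<close>

definition indep_fam :: "('a \<Rightarrow> 'i \<Rightarrow> 'k::field) \<Rightarrow> 'a set \<Rightarrow> bool" where
  "indep_fam v A \<longleftrightarrow> (\<forall>c. (\<Sum>i\<in>A. fscale (c i) (v i)) = 0 \<longrightarrow> (\<forall>i\<in>A. c i = 0))"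

lemma span_fam_iff:
  assumes "finite A"
  shows "x \<in> fv.span (v ` A) \<longleftrightarrow> (\<exists>c. x = (\<Sum>i\<in>A. fscale (c i) (v i)))"
proof
  assume "x \<in> fv.span (v ` A)"
  then show "\<exists>c. x = (\<Sum>i\<in>A. fscale (c i) (v i))"
  proof (induction rule: fv.span_induct_alt)
    case base
    show ?case by (rule exI[of _ "\<lambda>_. 0"]) simp
  next
    case (step c y z)
    then obtain i d where i: "i \<in> A" "y = v i" "z = (\<Sum>i\<in>A. fscale (d i) (v i))" by auto
    have "fscale c y + z = (\<Sum>j\<in>A. fscale (d j + (if j = i then c else 0)) (v j))"
      using assms i
      by (simp add: fv.scale_left_distrib sum.distrib if_distrib[of "\<lambda>c. fscale c _"] cong: if_cong)
    then show ?case by (rule exI[of _ "\<lambda>j. d j + (if j = i then c else 0)"])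
  qed
next
  assume "\<exists>c. x = (\<Sum>i\<in>A. fscale (c i) (v i))"
  then show "x \<in> fv.span (v ` A)"
    by (auto intro: fv.span_sum fv.span_scale fv.span_base)
qed

lemma indep_fam_imp_independent:
  fixes v :: "'a \<Rightarrow> 'i \<Rightarrow> 'k::field"
  assumes "finite A" "indep_fam v A"
  shows "inj_on v A \<and> fv.independent (v ` A)"
proof
  show inj: "inj_on v A"
  proof (rule inj_onI, rule ccontr)
    fix i j assume ij: "i \<in> A" "j \<in> A" "v i = v j" "i \<noteq> j"
    let ?c = "\<lambda>k. if k = i then 1 else if k = j then -1 else (0::'k)"
    have "(\<Sum>k\<in>A. fscale (?c k) (v k)) = (\<Sum>k\<in>{i, j}. fscale (?c k) (v k))"
      by (rule sum.mono_neutral_right) (use assms ij in auto)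
    also have "\<dots> = 0" using ij by simp
    finally have "?c i = 0"
      using assms(2)[unfolded indep_fam_def, THEN spec[of _ ?c]] ij(1) by blast
    then show False by simp
  qed
  show "fv.independent (v ` A)"
  proof (rule fv.independent_if_scalars_zero)
    fix f x assume *: "(\<Sum>x\<in>v ` A. fscale (f x) x) = 0" "x \<in> v ` A"
    then have "(\<Sum>i\<in>A. fscale (f (v i)) (v i)) = 0" by (simp add: sum.reindex[OF inj])
    then show "f x = 0" using assms(2) *(2) unfolding indep_fam_def by auto
  qed (use assms in auto)
qed

lemma independent_imp_indep_fam:
  assumes "finite A" "inj_on v A" "fv.independent (v ` A)"
  shows "indep_fam v A"
  unfolding indep_fam_def
proof (intro allI impI ballI)
  fix c i assume *: "(\<Sum>i\<in>A. fscale (c i) (v i)) = 0" "i \<in> A"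
  have "(\<Sum>x\<in>v ` A. fscale (c (inv_into A v x)) x) = 0"
    using assms(2) *(1) by (simp add: sum.reindex)
  then have "c (inv_into A v (v i)) = 0"
    using fv.independentD[OF assms(3), of "v ` A" "\<lambda>x. c (inv_into A v x)" "v i"] assms(1) *(2)
    by auto
  then show "c i = 0" using assms(2) *(2) by simp
qed

lemma indep_fam_iff_dim:
  assumes "finite A"
  shows "indep_fam v A \<longleftrightarrow> fv.dim (v ` A) = card A"
proof
  assume "indep_fam v A"
  then show "fv.dim (v ` A) = card A"
    using indep_fam_imp_independent[OF assms, of v]
    by (simp add: fv.dim_eq_card_independent card_image)
next
  assume eq: "fv.dim (v ` A) = card A"
  obtain B where B: "B \<subseteq> v ` A" "fv.independent B" "card B = fv.dim (v ` A)"
    using fv.basis_exists by metis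
  have "card (v ` A) \<le> card A" using assms by (rule card_image_le)
  moreover have "card B \<le> card (v ` A)" using B(1) assms by (simp add: card_mono)
  ultimately have c: "card (v ` A) = card A" "card B = card (v ` A)" using eq B(3) by auto
  then have "B = v ` A" using B(1) assms by (simp add: card_subset_eq)
  then show "indep_fam v A"
    using independent_imp_indep_fam[OF assms, of v] B(2) c(1) assms by (simp add: eq_card_imp_inj_on)
qed

lemma indep_fam_iff_rk: "finite A \<Longrightarrow> indep_fam v A \<longleftrightarrow> rk v A = card A"
  by (simp add: rk_def indep_fam_iff_dim)

lemma indep_fam_subset:
  assumes "finite A" "indep_fam v A" "B \<subseteq> A" shows "indep_fam v B"
  using assms indep_fam_imp_independent[OF assms(1,2)]
  by (meson finite_subset fv.independent_mono image_mono independent_imp_indep_fam inj_on_subset)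

lemma indep_fam_nonzero: 
  assumes "finite A" "indep_fam v A" "i \<in> A" shows "v i \<noteq> 0"
  using indep_fam_imp_independent[OF assms(1,2)] assms(3) fv.dependent_zero by (metis imageI)

lemma indep_fam_coeffs_unique:
  assumes "indep_fam v A" "(\<Sum>i\<in>A. fscale (c i) (v i)) = (\<Sum>i\<in>A. fscale (d i) (v i))" "i \<in> A"
  shows "c i = d i"
proof -
  have "(\<Sum>i\<in>A. fscale (c i - d i) (v i)) = 0"
    using assms(2) by (simp add: fv.scale_left_diff_distrib sum_subtractf)
  then show ?thesis using assms(1,3) unfolding indep_fam_def by fastforce
qed

section \<open>Coordinate spaces and linear isomorphisms\<close>

lemma subspace_Kvec [simp]: "fv.subspace (Kvec r)"
  by (auto simp: fv.subspace_def Kvec_def fscale_def)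

lemma unit_vec_in_Kvec [simp]: "h \<in> {1..r} \<Longrightarrow> unit_vec h \<in> Kvec r"
  by (auto simp: Kvec_def unit_vec_def)

lemma sum_fun_apply: "(\<Sum>i\<in>A. f i) x = (\<Sum>i\<in>A. f i x)"
  by (induction A rule: infinite_finite_induct) auto

lemma sum_unit_vec: "finite A \<Longrightarrow> (\<Sum>h\<in>A. fscale (c h) (unit_vec h)) = (\<lambda>i. if i \<in> A then c i else 0)"
proof
  fix i assume "finite A"
  then show "(\<Sum>h\<in>A. fscale (c h) (unit_vec h)) i = (if i \<in> A then c i else 0)"
    by (simp add: sum_fun_apply fscale_def unit_vec_def if_distrib cong: if_cong)
qed

lemma Kvec_expand: "x \<in> Kvec r \<Longrightarrow> (\<Sum>h\<in>{1..r}. fscale (x h) (unit_vec h)) = x"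
  by (auto simp: sum_unit_vec Kvec_def)

lemma span_unit_vec: "fv.span (unit_vec ` {1..r}) = (Kvec r :: (nat \<Rightarrow> 'k::field) set)"
proof
  show "fv.span (unit_vec ` {1..r}) \<subseteq> (Kvec r :: (nat \<Rightarrow> 'k::field) set)"
    by (rule fv.span_minimal) auto
  show "(Kvec r :: (nat \<Rightarrow> 'k::field) set) \<subseteq> fv.span (unit_vec ` {1..r})"
  proof
    fix x :: "nat \<Rightarrow> 'k" assume "x \<in> Kvec r"
    then show "x \<in> fv.span (unit_vec ` {1..r})"
      using Kvec_expand[of x r] by (subst span_fam_iff) (auto intro!: exI[of _ x])
  qed
qed

lemma indep_fam_unit_vec: "indep_fam (unit_vec :: nat \<Rightarrow> nat \<Rightarrow> 'k::field) {1..r}"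
  unfolding indep_fam_def
proof (intro allI impI ballI)
  fix c :: "nat \<Rightarrow> 'k" and i
  assume "(\<Sum>i\<in>{1..r}. fscale (c i) (unit_vec i)) = 0" "i \<in> {1..r}"
  then show "c i = 0" by (auto simp: sum_unit_vec fun_eq_iff dest: spec[of _ i])
qed

lemma dim_Kvec [simp]: "fv.dim (Kvec r :: (nat \<Rightarrow> 'k::field) set) = r"
proof -
  have "fv.dim (unit_vec ` {1..r} :: (nat \<Rightarrow> 'k) set) = card {1..r}"
    using indep_fam_unit_vec by (subst indep_fam_iff_dim[symmetric]) auto
  then show ?thesis by (metis fv.dim_span span_unit_vec card_atLeastAtMost diff_Suc_1)
qed

lemma unit_vec_nonzero [simp]: "unit_vec h \<noteq> (0 :: nat \<Rightarrow> 'k::field)"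
  by (auto simp: unit_vec_def fun_eq_iff)

lemma lin_iso_add: "lin_iso f V W \<Longrightarrow> u \<in> V \<Longrightarrow> v \<in> V \<Longrightarrow> f (u + v) = f u + f v"
  and lin_iso_scale: "lin_iso f V W \<Longrightarrow> v \<in> V \<Longrightarrow> f (fscale c v) = fscale c (f v)"
  and lin_iso_bij: "lin_iso f V W \<Longrightarrow> bij_betw f V W"
  and lin_iso_image: "lin_iso f V W \<Longrightarrow> f ` V = W"
  and lin_iso_inj: "lin_iso f V W \<Longrightarrow> inj_on f V"
  by (auto simp: lin_iso_def bij_betw_def)

lemma lin_iso_zero:
  assumes "lin_iso f V W" "fv.subspace V" shows "f 0 = 0"
  using lin_iso_scale[OF assms(1), of 0 0] fv.subspace_0[OF assms(2)] by simp

lemma lin_iso_sum: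
  assumes "lin_iso f V W" "fv.subspace V" "\<And>i. i \<in> A \<Longrightarrow> x i \<in> V"
  shows "f (\<Sum>i\<in>A. x i) = (\<Sum>i\<in>A. f (x i))"
  using assms(3)
proof (induction A rule: infinite_finite_induct)
  case (insert a A)
  have "sum x A \<in> V" by (rule fv.subspace_sum[OF assms(2)]) (use insert in auto)
  then have "f (x a + sum x A) = f (x a) + f (sum x A)"
    using insert.prems by (intro lin_iso_add[OF assms(1)]) auto
  moreover have "f (sum x A) = (\<Sum>i\<in>A. f (x i))" using insert by blast
  ultimately show ?case by (simp only: sum.insert[OF insert.hyps(1,2)])
qed (auto simp: lin_iso_zero[OF assms(1,2)])

lemma lin_iso_lincomb:
  assumes "lin_iso f V W" "fv.subspace V" "\<And>i. i \<in> A \<Longrightarrow> x i \<in> V"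
  shows "f (\<Sum>i\<in>A. fscale (c i) (x i)) = (\<Sum>i\<in>A. fscale (c i) (f (x i)))"
  using assms by (simp add: lin_iso_sum[OF assms(1,2)] lin_iso_scale[OF assms(1)] fv.subspace_scale)

lemma lin_iso_inv:
  assumes f: "lin_iso f V W" and V: "fv.subspace V"
  shows "lin_iso (inv_into V f) W V"
  unfolding lin_iso_def
proof (intro conjI ballI allI)
  note b = lin_iso_bij[OF f]
  have inv: "inv_into V f w \<in> V" "f (inv_into V f w) = w" if "w \<in> W" for w
    using b that bij_betw_inv_into_right[OF b] bij_betwE[OF bij_betw_inv_into[OF b]] by auto
  have li: "inv_into V f (f v) = v" if "v \<in> V" for v
    using bij_betw_inv_into_left[OF b that] .
  show "bij_betw (inv_into V f) W V" using b by (rule bij_betw_inv_into)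
  fix u v assume "u \<in> W" "v \<in> W"
  then show "inv_into V f (u + v) = inv_into V f u + inv_into V f v"
    using li[of "inv_into V f u + inv_into V f v"] inv lin_iso_add[OF f] fv.subspace_add[OF V] by metis
next
  note b = lin_iso_bij[OF f]
  fix c w assume w: "w \<in> W"
  have inv: "inv_into V f w \<in> V" "f (inv_into V f w) = w"
    using b w bij_betw_inv_into_right[OF b] bij_betwE[OF bij_betw_inv_into[OF b]] by auto
  show "inv_into V f (fscale c w) = fscale c (inv_into V f w)"
    using bij_betw_inv_into_left[OF b, of "fscale c (inv_into V f w)"] inv lin_iso_scale[OF f] fv.subspace_scale[OF V] by metis
qed

lemma lin_iso_comp:
  assumes "lin_iso f U V" "lin_iso g V W"
  shows "lin_iso (g \<circ> f) U W"
proof -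
  have "f u \<in> V" if "u \<in> U" for u using lin_iso_image[OF assms(1)] that by auto
  then show ?thesis using assms unfolding lin_iso_def by (auto intro: bij_betw_trans)
qed

lemma lin_iso_id: "lin_iso id V V" "lin_iso (\<lambda>x. x) V V"
  by (auto simp: lin_iso_def bij_betw_def)

lemma lin_iso_span_image:
  assumes f: "lin_iso f V W" and V: "fv.subspace V" and X: "X \<subseteq> V"
  shows "f ` fv.span X = fv.span (f ` X)"
proof
  have sV: "fv.span X \<subseteq> V" using fv.span_minimal[OF X V] .
  show "f ` fv.span X \<subseteq> fv.span (f ` X)"
  proof safe
    fix x assume "x \<in> fv.span X"
    then have "x \<in> V \<and> f x \<in> fv.span (f ` X)"
    proof (induction rule: fv.span_induct_alt)
      case base
      show ?case unfolding lin_iso_zero[OF f V] by (intro conjI fv.span_zero fv.subspace_0 V)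
    next
      case (step c x y)
      have x: "x \<in> V" using step X by blast
      then have cx: "fscale c x \<in> V" by (rule fv.subspace_scale[OF V])
      have "f (fscale c x + y) = fscale c (f x) + f y"
        using lin_iso_add[OF f cx, of y] lin_iso_scale[OF f x] step by metis
      moreover have "fscale c (f x) + f y \<in> fv.span (f ` X)"
        using step by (intro fv.span_add fv.span_scale) (auto intro: fv.span_base)
      ultimately show ?case using fv.subspace_add[OF V cx] step by metis
    qed
    then show "f x \<in> fv.span (f ` X)" ..
  qed
  show "fv.span (f ` X) \<subseteq> f ` fv.span X"
  proof (rule fv.span_minimal)
    show "f ` X \<subseteq> f ` fv.span X" using fv.span_superset by blast
    show "fv.subspace (f ` fv.span X)"
      unfolding fv.subspace_def
    proof (intro conjI ballI allI)
      show "0 \<in> f ` fv.span X" using lin_iso_zero[OF f V] fv.span_zero by (metis imageI)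
      fix x y assume "x \<in> f ` fv.span X" "y \<in> f ` fv.span X"
      then obtain x' y' where "x = f x'" "y = f y'" "x' \<in> fv.span X" "y' \<in> fv.span X" by blast
      then show "x + y \<in> f ` fv.span X"
        using lin_iso_add[OF f, of x' y'] sV fv.span_add[of x' X y'] by (metis imageI subsetD)
    next
      fix c x assume "x \<in> f ` fv.span X"
      then obtain x' where "x = f x'" "x' \<in> fv.span X" by blast
      then show "fscale c x \<in> f ` fv.span X"
        using lin_iso_scale[OF f, of x' c] sV fv.span_scale[of x' X c] by (metis imageI subsetD)
    qed
  qed
qed

lemma lin_iso_dim_image:
  assumes f: "lin_iso f V W" and V: "fv.subspace V" and X: "X \<subseteq> V"
  shows "fv.dim (f ` X) = fv.dim X"
proof -
  obtain B where B: "B \<subseteq> X" "fv.independent B" "X \<subseteq> fv.span B" "card B = fv.dim X"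
    using fv.basis_exists by blast
  have BV: "B \<subseteq> V" using B X by auto
  have inj: "inj_on f B" using lin_iso_inj[OF f] BV inj_on_subset by blast
  have "fv.independent (f ` B)"
    unfolding fv.dependent_def
  proof (safe)
    fix b assume b: "b \<in> B" "f b \<in> fv.span (f ` B - {f b})"
    have "f ` B - {f b} = f ` (B - {b})" using inj b(1) by (auto dest: inj_onD)
    then have "f b \<in> f ` fv.span (B - {b})"
      using b(2) lin_iso_span_image[OF f V, of "B - {b}"] BV by auto
    then obtain y where y: "y \<in> fv.span (B - {b})" "f b = f y" by auto
    have "y \<in> V" using y(1) fv.span_minimal[of "B - {b}" V] BV V by blast
    then have "b = y" using y(2) lin_iso_inj[OF f] b(1) BV by (meson inj_onD subsetD)
    then show False using y(1) B(2) b(1) unfolding fv.dependent_def by blast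
  qed
  moreover have "f ` X \<subseteq> fv.span (f ` B)"
    using lin_iso_span_image[OF f V BV] B(3) by blast
  ultimately show ?thesis
    using fv.dim_unique[of "f ` B" "f ` X" "card B"] B(1,4) card_image[OF inj] by auto
qed

text \<open>The linear map whose matrix has columns \<open>b 1\<close>, ...,
  \<open>b n\<close>.\<close>

definition lincomb :: "nat \<Rightarrow> (nat \<Rightarrow> 'i \<Rightarrow> 'k::field) \<Rightarrow> (nat \<Rightarrow> 'k) \<Rightarrow> ('i \<Rightarrow> 'k)" where
  "lincomb n b x = (\<Sum>i\<in>{1..n}. fscale (x i) (b i))"

lemma lincomb_unit_vec: "i \<in> {1..n} \<Longrightarrow> lincomb n b (unit_vec i) = b i"
  by (simp add: lincomb_def unit_vec_def if_distrib[of "\<lambda>c. fscale c _"] cong: if_cong)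

lemma lin_iso_lincomb_span:
  fixes b :: "nat \<Rightarrow> 'i \<Rightarrow> 'k::field"
  assumes "indep_fam b {1..n}"
  shows "lin_iso (lincomb n b) (Kvec n) (fv.span (b ` {1..n}))"
  unfolding lin_iso_def
proof (intro conjI ballI allI)
  show "bij_betw (lincomb n b) (Kvec n) (fv.span (b ` {1..n}))"
    unfolding bij_betw_def
  proof
    show "inj_on (lincomb n b) (Kvec n)"
    proof (rule inj_onI)
      fix x y :: "nat \<Rightarrow> 'k" assume xy: "x \<in> Kvec n" "y \<in> Kvec n" "lincomb n b x = lincomb n b y"
      have "x i = y i" if "i \<in> {1..n}" for i
        using indep_fam_coeffs_unique[OF assms, of x y i] xy(3) that by (simp add: lincomb_def)
      then show "x = y" using xy(1,2) unfolding Kvec_def fun_eq_iff mem_Collect_eq by metis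
    qed
    show "lincomb n b ` Kvec n = fv.span (b ` {1..n})"
    proof safe
      fix x assume "x \<in> fv.span (b ` {1..n})"
      then obtain c where c: "x = (\<Sum>i\<in>{1..n}. fscale (c i) (b i))" by (auto simp: span_fam_iff)
      then have "x = lincomb n b (\<lambda>i. if i \<in> {1..n} then c i else 0)" by (simp add: lincomb_def)
      moreover have "(\<lambda>i. if i \<in> {1..n} then c i else 0) \<in> Kvec n" by (auto simp: Kvec_def)
      ultimately show "x \<in> lincomb n b ` Kvec n" by blast
    qed (auto simp: lincomb_def intro: fv.span_sum fv.span_scale fv.span_base)
  qed
next
  fix u v show "lincomb n b (u + v) = lincomb n b u + lincomb n b v"
    by (simp add: lincomb_def fv.scale_left_distrib sum.distrib)
next
  fix c v show "lincomb n b (fscale c v) = fscale c (lincomb n b v)"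
    by (simp add: lincomb_def fv.scale_sum_right fscale_def[of c v])
qed

lemma span_eq_of_dim:
  fixes X Y :: "('i \<Rightarrow> 'k::field) set"
  assumes "finite Y" "X \<subseteq> fv.span Y" "fv.dim X \<ge> fv.dim Y"
  shows "fv.span X = fv.span Y"
proof -
  obtain B where B: "B \<subseteq> X" "fv.independent B" "X \<subseteq> fv.span B" "card B = fv.dim X"
    using fv.basis_exists by blast
  have "B \<subseteq> fv.span Y" using B(1) assms(2) by auto
  then obtain C where C: "B \<subseteq> C" "C \<subseteq> fv.span Y" "fv.independent C" "fv.span Y \<subseteq> fv.span C"
    using fv.maximal_independent_subset_extend B(2) by metis
  have "finite C" "card C \<le> card B"
    using independent_card_le_dim[OF assms(1) C(3,2)] B(4) assms(3) by auto
  then have "B = C" using C(1) by (simp add: card_seteq)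
  then have "fv.span Y \<subseteq> fv.span X" using C(4) fv.span_mono[OF B(1)] by auto
  moreover have "fv.span X \<subseteq> fv.span Y" using fv.span_minimal[OF assms(2)] by auto
  ultimately show ?thesis by auto
qed

text \<open>Spanning is enough: \<open>n\<close> vectors that span an \<open>n\<close>-dimensional
  space are independent.\<close>

lemma lincomb_in_GL:
  assumes "\<And>i. i \<in> {1..n} \<Longrightarrow> b i \<in> Kvec n" "Kvec n \<subseteq> fv.span (b ` {1..n})"
  shows "lincomb n b \<in> GL n"
proof -
  have "fv.span (b ` {1..n}) = Kvec n"
    using assms fv.span_minimal[OF _ subspace_Kvec, of "b ` {1..n}" n] by blast
  moreover have "rk b {1..n} = n"
    using calculation unfolding rk_def by (metis dim_Kvec fv.dim_span)
  then have "indep_fam b {1..n}" by (simp add: indep_fam_iff_rk)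
  ultimately show ?thesis using lin_iso_lincomb_span[of b n] by (simp add: GL_def)
qed


section \<open>Connected components of a configuration of vectors\<close>

text \<open>Connectedness of the matroid of \<open>v\<close> on \<open>S\<close>: there is no
  separator. By \<open>rk_additive_iff\<close> a separator splits the index set into two parts whose
  spans meet in 0.\<close>

definition connected_fam :: "(nat \<Rightarrow> 'i \<Rightarrow> 'k::field) \<Rightarrow> nat set \<Rightarrow> bool" where
  "connected_fam v S \<longleftrightarrow> (\<forall>A. A \<noteq> {} \<longrightarrow> A \<subset> S \<longrightarrow> rk v A + rk v (S - A) \<noteq> rk v S)"

text \<open>The slots that carry lines, without the one-dimensional padding by empty slots.\<close>

fun core_slots :: "pdata \<Rightarrow> slot set" where
  "core_slots (Is, Js, Ks) = ISlot ` Is \<union> JSlot ` Js \<union> (\<lambda>(K, r). KSlot K r) ` Ks"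

text \<open>The block ranks add up to \<open>rank_p p\<close>, so the last clause says that the
  spans of the blocks form a direct sum. Together with connectedness this makes the blocks the
  components of the matroid of \<open>v\<close>.\<close>

definition realizes :: "nat \<Rightarrow> pdata \<Rightarrow> (nat \<Rightarrow> 'i \<Rightarrow> 'k::field) \<Rightarrow> bool" where
  "realizes m p v \<longleftrightarrow>
     (\<forall>s\<in>core_slots p. rk v (slot_support s) = slot_rank s \<and> connected_fam v (slot_support s)) \<and>
     rk v {1..m} = rank_p p"

lemma slots_eq: "slots n p = EmptySlot ` {1..n - rank_p p} \<union> core_slots p"
  by (cases p) auto

lemma inj_KSlot: "inj_on (\<lambda>(K, r). KSlot K r) X"
  by (auto simp: inj_on_def)

lemma sum_core_slots:
  assumes "finite Is" "finite Js" "finite Ks"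
  shows "(\<Sum>s\<in>core_slots (Is, Js, Ks). slot_rank s) = rank_p (Is, Js, Ks)"
proof -
  have "(\<Sum>s\<in>ISlot ` Is \<union> JSlot ` Js. slot_rank s)
      = (\<Sum>s\<in>ISlot ` Is. slot_rank s) + (\<Sum>s\<in>JSlot ` Js. slot_rank s)"
    by (rule sum.union_disjoint) (use assms in auto)
  moreover have "(\<Sum>s\<in>core_slots (Is, Js, Ks). slot_rank s)
      = (\<Sum>s\<in>ISlot ` Is \<union> JSlot ` Js. slot_rank s) + (\<Sum>s\<in>(\<lambda>(K, r). KSlot K r) ` Ks. slot_rank s)"
    unfolding core_slots.simps by (rule sum.union_disjoint) (use assms in auto)
  moreover have "(\<Sum>s\<in>ISlot ` Is. slot_rank s) = card Is"
    by (subst sum.reindex) (auto simp: inj_on_def)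
  moreover have "(\<Sum>s\<in>JSlot ` Js. slot_rank s) = (\<Sum>J\<in>Js. card J - 1)"
    by (subst sum.reindex) (auto simp: inj_on_def)
  moreover have "(\<Sum>s\<in>(\<lambda>(K, r). KSlot K r) ` Ks. slot_rank s) = (\<Sum>(K, r)\<in>Ks. r)"
    by (subst sum.reindex[OF inj_KSlot]) (auto intro!: sum.cong)
  ultimately show ?thesis by simp
qed

section \<open>Combinatorics of the blocks of an index\<close>

locale pdatum =
  fixes n m :: nat and p :: pdata
  assumes p: "p \<in> Pset n m"
begin

abbreviation "Is \<equiv> fst p"
abbreviation "Js \<equiv> fst (snd p)"
abbreviation "Ks \<equiv> snd (snd p)"

lemma core_eq: "core_slots p = ISlot ` Is \<union> JSlot ` Js \<union> (\<lambda>(K, r). KSlot K r) ` Ks"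
  by (cases p) simp

lemma Pset_facts:
  shows Un_blocks: "\<Union>Is \<union> \<Union>Js \<union> \<Union>(fst ` Ks) = {1..m}"
    and IJ_disj: "\<Union>Is \<inter> \<Union>Js = {}" and IK_disj: "\<Union>Is \<inter> \<Union>(fst ` Ks) = {}"
    and JK_disj: "\<Union>Js \<inter> \<Union>(fst ` Ks) = {}"
    and I_disj: "disjoint Is" and J_disj: "disjoint Js" and K_disj: "disjoint_family_on fst Ks"
    and card_I: "I \<in> Is \<Longrightarrow> 1 \<le> card I" and card_J: "J \<in> Js \<Longrightarrow> 3 \<le> card J"
    and card_K: "(K, r) \<in> Ks \<Longrightarrow> 4 \<le> r + 2 \<and> r + 2 \<le> card K"
    and rank_le: "rank_p p \<le> n"
proof -
  obtain A B C where p3: "p = (A, B, C)" by (cases p)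
  have *: "\<Union>Is \<union> \<Union>Js \<union> \<Union>(fst ` Ks) = {1..m} \<and>
     \<Union>Is \<inter> \<Union>Js = {} \<and> \<Union>Is \<inter> \<Union>(fst ` Ks) = {} \<and> \<Union>Js \<inter> \<Union>(fst ` Ks) = {} \<and>
     disjoint Is \<and> disjoint Js \<and> disjoint_family_on fst Ks \<and>
     (\<forall>I\<in>Is. 1 \<le> card I) \<and> (\<forall>J\<in>Js. 3 \<le> card J) \<and>
     (\<forall>(K, r)\<in>Ks. 4 \<le> r + 2 \<and> r + 2 \<le> card K) \<and> rank_p p \<le> n"
    using p unfolding p3 Pset_def mem_Collect_eq prod.case fst_conv snd_conv .
  show "\<Union>Is \<union> \<Union>Js \<union> \<Union>(fst ` Ks) = {1..m}" using * by (elim conjE)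
  show "\<Union>Is \<inter> \<Union>Js = {}" using * by (elim conjE)
  show "\<Union>Is \<inter> \<Union>(fst ` Ks) = {}" using * by (elim conjE)
  show "\<Union>Js \<inter> \<Union>(fst ` Ks) = {}" using * by (elim conjE)
  show "disjoint Is" using * by (elim conjE)
  show "disjoint Js" using * by (elim conjE)
  show "disjoint_family_on fst Ks" using * by (elim conjE)
  show "rank_p p \<le> n" using * by (elim conjE)
  have I: "\<forall>I\<in>Is. 1 \<le> card I" using * by (elim conjE)
  have J: "\<forall>J\<in>Js. 3 \<le> card J" using * by (elim conjE)
  have K: "\<forall>(K, r)\<in>Ks. 4 \<le> r + 2 \<and> r + 2 \<le> card K" using * by (elim conjE)
  show "1 \<le> card I" if "I \<in> Is" using I that by (rule bspec)
  show "3 \<le> card J" if "J \<in> Js" using J that by (rule bspec)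
  show "4 \<le> r + 2 \<and> r + 2 \<le> card K" if "(K, r) \<in> Ks" using bspec[OF K that] by simp
qed

text \<open>Two different pairs with the same first component would have it disjoint from itself,
  hence empty, although \<open>card K\<close> is at least 4.\<close>

lemma inj_fst_Ks: "inj_on fst Ks"
proof (rule inj_onI, rule ccontr)
  fix x y assume xy: "x \<in> Ks" "y \<in> Ks" "fst x = fst y" "x \<noteq> y"
  then have "fst x \<inter> fst y = {}" using K_disj unfolding disjoint_family_on_def by blast
  then have "card (fst x) = 0" using xy by simp
  moreover have "(fst x, snd x) \<in> Ks" using xy(1) by simp
  ultimately show False using card_K[of "fst x" "snd x"] by simp
qed

lemma finite_families: shows finite_Is: "finite Is" and finite_Js: "finite Js" and finite_Ks: "finite Ks"
proof -
  have fin: "finite (Pow {1..m})" by simp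
  have 1: "Is \<subseteq> Pow {1..m}" and 2: "Js \<subseteq> Pow {1..m}" and 3: "fst ` Ks \<subseteq> Pow {1..m}"
    using Un_blocks by blast+
  show "finite Is" "finite Js" using finite_subset[OF 1 fin] finite_subset[OF 2 fin] by auto
  show "finite Ks" using finite_subset[OF 3 fin] inj_fst_Ks by (rule finite_imageD)
qed

lemma finite_core: "finite (core_slots p)"
  unfolding core_eq using finite_families by simp

lemma finite_slots: "finite (slots n p)"
  using finite_core by (simp add: slots_eq)

lemma Union_support: "(\<Union>s\<in>core_slots p. slot_support s) = {1..m}"
  unfolding core_eq Un_blocks[symmetric] by (auto simp: case_prod_unfold)

lemma support_subset: "s \<in> slots n p \<Longrightarrow> slot_support s \<subseteq> {1..m}"
  using Union_support by (auto simp: slots_eq)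

lemma finite_support: "s \<in> slots n p \<Longrightarrow> finite (slot_support s)"
  using support_subset finite_subset by blast

lemma core_subset: "core_slots p \<subseteq> slots n p"
  by (auto simp: slots_eq)

lemma core_slot_cases:
  assumes "s \<in> core_slots p"
  obtains (I) I where "s = ISlot I" "I \<in> Is" "card I \<ge> 1" | (J) J where "s = JSlot J" "J \<in> Js" "card J \<ge> 3"
   | (K) K r where "s = KSlot K r" "(K, r) \<in> Ks" "r \<ge> 2" "r + 2 \<le> card K"
proof -
  have "(\<exists>I\<in>Is. s = ISlot I) \<or> (\<exists>J\<in>Js. s = JSlot J) \<or> (\<exists>K r. (K, r)\<in>Ks \<and> s = KSlot K r)"
    using assms unfolding core_eq by auto
  then show ?thesis using card_I card_J card_K that by (elim disjE bexE exE conjE) auto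
qed

lemma support_nonempty: "s \<in> core_slots p \<Longrightarrow> slot_support s \<noteq> {}"
  by (erule core_slot_cases) auto

lemma support_disjoint:
  assumes "s \<in> slots n p" "t \<in> slots n p" "s \<noteq> t"
  shows "slot_support s \<inter> slot_support t = {}"
proof (cases "s \<in> core_slots p \<and> t \<in> core_slots p")
  case True
  have K: "K \<inter> L = {}" if "(K, r) \<in> Ks" "(L, q) \<in> Ks" "K \<noteq> L \<or> r \<noteq> q" for K L r q
    using bspec[OF bspec[OF K_disj[unfolded disjoint_family_on_def] that(1)] that(2)] that(3) by auto
  have I: "K \<inter> L = {}" if "K \<in> Is" "L \<in> Is" "K \<noteq> L" for K L
    using I_disj that by (auto simp: disjoint_def)
  have J: "K \<inter> L = {}" if "K \<in> Js" "L \<in> Js" "K \<noteq> L" for K L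
    using J_disj that by (auto simp: disjoint_def)
  have IJ: "K \<inter> L = {}" "L \<inter> K = {}" if "K \<in> Is" "L \<in> Js" for K L using IJ_disj that by blast+
  have IK: "K \<inter> L = {}" "L \<inter> K = {}" if "K \<in> Is" "(L, q) \<in> Ks" for K L q using IK_disj that by force+
  have JK: "K \<inter> L = {}" "L \<inter> K = {}" if "K \<in> Js" "(L, q) \<in> Ks" for K L q using JK_disj that by force+
  show ?thesis
    using conjunct1[OF True]
  proof (cases rule: core_slot_cases)
    case s: (I A)
    show ?thesis using conjunct2[OF True]
      by (cases rule: core_slot_cases) (use s assms(3) I IJ IK in auto)
  next
    case s: (J A)
    show ?thesis using conjunct2[OF True]
      by (cases rule: core_slot_cases) (use s assms(3) J IJ JK in auto)
  next
    case s: (K A q)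
    show ?thesis using conjunct2[OF True]
      by (cases rule: core_slot_cases) (use s assms(3) K[of A q] IK JK in auto)
  qed
next
  case False
  then show ?thesis using assms(1,2) by (auto simp: slots_eq)
qed

lemma sum_core: "(\<Sum>s\<in>core_slots p. slot_rank s) = rank_p p"
  using sum_core_slots[OF finite_families] by simp

lemma sum_slots: "(\<Sum>s\<in>slots n p. slot_rank s) = n"
proof -
  have d: "EmptySlot ` {1..n - rank_p p} \<inter> core_slots p = {}"
    by (cases p) auto
  have "(\<Sum>s\<in>slots n p. slot_rank s)
     = (\<Sum>s\<in>EmptySlot ` {1..n - rank_p p}. slot_rank s) + (\<Sum>s\<in>core_slots p. slot_rank s)"
    unfolding slots_eq by (rule sum.union_disjoint) (use finite_core d in auto)
  also have "(\<Sum>s\<in>EmptySlot ` {1..n - rank_p p}. slot_rank s) = n - rank_p p"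
    by (subst sum.reindex) (auto simp: inj_on_def)
  finally show ?thesis using rank_le sum_core by simp
qed

lemma empty_support: "s \<in> slots n p \<Longrightarrow> s \<notin> core_slots p \<Longrightarrow> slot_support s = {} \<and> slot_rank s = 1"
  unfolding slots_eq by auto

text \<open>The type of a block is visible from its rank and size: rank 1 for \<open>I\<close>, one
  less than the size but at least 2 for \<open>J\<close>, between 2 and two less than the size for
  \<open>K\<close>. These cases exclude each other.\<close>

lemma core_eqI:
  assumes "pdatum n' m' p'" "s \<in> core_slots p" "t \<in> core_slots p'" "slot_support s = slot_support t"
    "slot_rank s = slot_rank t"
  shows "s = t"
  using assms(4,5)
  by (cases rule: core_slot_cases[OF assms(2)]; cases rule: pdatum.core_slot_cases[OF assms(1,3)]) auto

lemma ex1_slot: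
  assumes "i \<in> {1..m}"
  shows "\<exists>!s. s \<in> core_slots p \<and> i \<in> slot_support s"
proof -
  have "i \<in> (\<Union>s\<in>core_slots p. slot_support s)" using Union_support assms by simp
  then obtain s where s: "s \<in> core_slots p" "i \<in> slot_support s" by blast
  show ?thesis
  proof (rule ex1I[of _ s])
    fix t assume t: "t \<in> core_slots p \<and> i \<in> slot_support t"
    show "t = s"
      using support_disjoint[of s t] s t core_subset by blast
  qed (use s in auto)
qed

text \<open>The other blocks cover the complement, so its rank is at most the sum of their ranks,
  and the ranks of all blocks add up to the total rank.\<close>

lemma realizes_split:
  assumes "realizes m p v" "s \<in> core_slots p"
  shows "rk v (slot_support s \<union> ({1..m} - slot_support s)) = rk v (slot_support s) + rk v ({1..m} - slot_support s)"
proof -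
  let ?T = "core_slots p - {s}"
  have fs: "finite (slot_support t)" if "t \<in> core_slots p" for t using that core_subset finite_support by blast
  have "{1..m} - slot_support s \<subseteq> (\<Union>t\<in>?T. slot_support t)"
    using Union_support by blast
  then have "rk v ({1..m} - slot_support s) \<le> rk v (\<Union>t\<in>?T. slot_support t)"
    using finite_core fs by (intro rk_mono) auto
  also have "\<dots> \<le> (\<Sum>t\<in>?T. rk v (slot_support t))"
    using finite_core fs by (intro rk_Union_le) auto
  also have "\<dots> = (\<Sum>t\<in>?T. slot_rank t)"
    using assms(1) unfolding realizes_def by (intro sum.cong) auto
  finally have "rk v (slot_support s) + rk v ({1..m} - slot_support s) \<le> slot_rank s + (\<Sum>t\<in>?T. slot_rank t)"
    using assms unfolding realizes_def by auto
  also have "\<dots> = rk v {1..m}"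
    using assms sum_core sum.remove[OF finite_core assms(2), of slot_rank] unfolding realizes_def by simp
  finally have "rk v (slot_support s) + rk v ({1..m} - slot_support s) \<le> rk v {1..m}" .
  moreover have "slot_support s \<union> ({1..m} - slot_support s) = {1..m}"
    using assms(2) core_subset support_subset by blast
  ultimately show ?thesis
    using rk_subadditive[of "slot_support s" "{1..m} - slot_support s" v] fs assms(2) by simp
qed

end

text \<open>Uniqueness of connected components: by \<open>rk_split\<close>, a connected block that
  meets a separator lies inside it. Applied in both directions, blocks of two data that share an
  index have the same support, and their ranks are both read off from \<open>v\<close>.\<close>

lemma realizes_core_subset:
  assumes p: "pdatum n m p" "realizes m p v" and q: "pdatum n m q" "realizes m q v"
  shows "core_slots p \<subseteq> core_slots q"
proof
  have sub: "slot_support s \<subseteq> slot_support t"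
    if pq: "pdatum n m p" "realizes m p v" "pdatum n m q" "realizes m q v"
     and s: "s \<in> core_slots p" and t: "t \<in> core_slots q"
    and i: "i \<in> slot_support s" "i \<in> slot_support t" for s t p q i
  proof (rule ccontr)
    assume ns: "\<not> slot_support s \<subseteq> slot_support t"
    let ?S = "slot_support s" and ?X = "slot_support t" and ?Y = "{1..m} - slot_support t"
    have Sm: "?S \<subseteq> {1..m}" using pdatum.core_subset[OF pq(1)] pdatum.support_subset[OF pq(1)] s by blast
    have fX: "finite ?X"
      using pdatum.core_subset[OF pq(3)] pdatum.finite_support[OF pq(3)] t by blast
    have "rk v ?S = rk v (?S \<inter> ?X) + rk v (?S \<inter> ?Y)"
      by (rule rk_split) (use fX Sm pdatum.realizes_split[OF pq(3,4) t] in auto)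
    moreover have "?S \<inter> ?Y = ?S - (?S \<inter> ?X)" using Sm by blast
    moreover have "?S \<inter> ?X \<noteq> {}" "?S \<inter> ?X \<subset> ?S" using i ns by auto
    ultimately show False using pq(2) s unfolding realizes_def connected_fam_def by metis
  qed
  fix s assume s: "s \<in> core_slots p"
  obtain i where i: "i \<in> slot_support s" using pdatum.support_nonempty[OF p(1) s] by blast
  then have "i \<in> {1..m}" using pdatum.core_subset[OF p(1)] pdatum.support_subset[OF p(1)] s by blast
  then obtain t where t: "t \<in> core_slots q" "i \<in> slot_support t"
    using pdatum.ex1_slot[OF q(1)] by blast
  have "slot_support s = slot_support t"
    using sub[OF p q s t(1) i t(2)] sub[OF q p t(1) s t(2) i] by blast
  moreover have "slot_rank s = slot_rank t"
    using calculation p(2) q(2) s t(1) unfolding realizes_def by metis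
  ultimately show "s \<in> core_slots q" using pdatum.core_eqI[OF p(1) q(1) s t(1)] t(1) by simp
qed

lemma core_slots_inj: "core_slots p = core_slots q \<Longrightarrow> p = q"
proof -
  have "p = ({I. ISlot I \<in> core_slots p}, {J. JSlot J \<in> core_slots p}, {(K, r). KSlot K r \<in> core_slots p})" for p
    by (cases p) auto
  then show "core_slots p = core_slots q \<Longrightarrow> p = q" by metis
qed

lemma realizes_unique:
  assumes "p \<in> Pset n m" "realizes m p v" "q \<in> Pset n m" "realizes m q v"
  shows "p = q"
  using realizes_core_subset[of n m p v q] realizes_core_subset[of n m q v p] assms
  by (intro core_slots_inj) (auto simp: pdatum_def)

text \<open>Among the partitions of \<open>{1..m}\<close> along which the rank is additive, one with
  the most parts is taken. Its blocks are connected, because a separator of a block would refine the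
  partition. Rank and size then decide the type of each block.\<close>

lemma ex_realizes:
  fixes v :: "nat \<Rightarrow> nat \<Rightarrow> 'k::field"
  assumes m: "1 \<le> m" and v: "\<And>i. i \<in> {1..m} \<Longrightarrow> v i \<in> Kvec n" "\<And>i. i \<in> {1..m} \<Longrightarrow> v i \<noteq> 0"
  shows "\<exists>p\<in>Pset n m. realizes m p v"
proof -
  define Q where "Q = {P. partition_on {1..m} P \<and> (\<Sum>B\<in>P. rk v B) = rk v {1..m}}"
  have "Q \<subseteq> Pow (Pow {1..m})" by (auto simp: Q_def partition_on_def)
  then have finQ: "finite Q" by (rule finite_subset) simp
  have "{{1..m}} \<in> Q" using m by (auto simp: Q_def partition_on_def)
  then have "Max (card ` Q) \<in> card ` Q" using finQ by (intro Max_in) auto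
  then obtain P where P1: "P \<in> Q" "Max (card ` Q) = card P" by (auto simp del: Max_in)
  have P: "P \<in> Q" "\<And>P'. P' \<in> Q \<Longrightarrow> card P' \<le> card P"
    using P1 Max_ge[of "card ` Q"] finQ by auto
  have part: "\<Union>P = {1..m}" "disjoint P" "{} \<notin> P" and sumP: "(\<Sum>B\<in>P. rk v B) = rk v {1..m}"
    using P(1) by (auto simp: Q_def partition_on_def)
  have finP: "finite P" by (rule finite_UnionD) (simp add: part(1))
  have BP: "i \<in> {1..m}" if "B \<in> P" "i \<in> B" for B i using part(1) that by blast
  have finB: "finite B" if "B \<in> P" for B by (rule finite_subset[of B "{1..m}"]) (use part(1) that in auto)
  have conn: "connected_fam v B" if B: "B \<in> P" for B
    unfolding connected_fam_def
  proof (intro allI impI notI)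
    fix A assume A: "A \<noteq> {}" "A \<subset> B" and eq: "rk v A + rk v (B - A) = rk v B"
    let ?P = "insert A (insert (B - A) (P - {B}))"
    have dj: "C \<inter> B = {}" if "C \<in> P - {B}" for C
      using part(2) B that by (auto simp: disjoint_def)
    have n1: "A \<notin> insert (B - A) (P - {B})" "B - A \<notin> P - {B}"
      using A dj by blast+
    have "partition_on {1..m} ?P"
      unfolding partition_on_def
    proof (intro conjI)
      show "\<Union>?P = {1..m}" using part(1) A B by auto
      show "{} \<notin> ?P" using A part(3) by auto
      have PP: "C \<inter> D = {}" if "C \<in> P - {B}" "D \<in> P - {B}" "C \<noteq> D" for C D
        using part(2) that by (auto simp: disjoint_def)
      show "disjoint ?P"
        unfolding disjoint_def
      proof (intro ballI impI)
        fix C D assume "C \<in> ?P" "D \<in> ?P" "C \<noteq> D"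
        then show "C \<inter> D = {}" using A(2) dj[of C] dj[of D] PP[of C D] by blast
      qed
    qed
    moreover have "(\<Sum>B\<in>?P. rk v B) = rk v {1..m}"
      using n1 finP eq sumP sum.remove[OF finP B, of "rk v"] by simp
    ultimately have "card ?P \<le> card P" using P(2) by (simp add: Q_def)
    moreover have "card ?P = card P + 1"
      using n1 finP card.remove[OF finP B] by simp
    ultimately show False by simp
  qed
  have single: "rk v {i} = 1" if "i \<in> {1..m}" for i
    using v(2)[OF that] by (simp add: rk_def fv.dim_eq_card_independent)
  have rk1: "1 \<le> rk v B" if "B \<in> P" for B
  proof -
    have "B \<noteq> {}" using part(3) that by blast
    then obtain i where i: "i \<in> B" by blast
    then have "rk v {i} \<le> rk v B" using finB[OF that] by (intro rk_mono) auto
    then show ?thesis using single[OF BP[OF that i]] by simp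
  qed
  \<comment> \<open>A block of full rank is an independent family; if it has at least two elements,
    a single one of them would be a separator.\<close>
  have rkB: "rk v B + 1 \<le> card B" if "B \<in> P" "rk v B \<noteq> 1" for B
  proof (rule ccontr)
    assume "\<not> rk v B + 1 \<le> card B"
    then have eq: "rk v B = card B" using rk_le_card[OF finB[OF that(1)], of v] by simp
    then have "card B \<ge> 2" using rk1[OF that(1)] that(2) by simp
    have "B \<noteq> {}" using part(3) that by blast
    then obtain i where i: "i \<in> B" by blast
    have "indep_fam v B" using eq finB[OF that(1)] by (simp add: indep_fam_iff_rk)
    then have "indep_fam v (B - {i})" using finB[OF that(1)] indep_fam_subset by blast
    then have "rk v (B - {i}) = card B - 1" using finB[OF that(1)] i by (simp add: indep_fam_iff_rk)
    then have "rk v {i} + rk v (B - {i}) = rk v B" using single[OF BP[OF that(1) i]] eq \<open>card B \<ge> 2\<close> by simp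
    moreover have "B \<noteq> {i}" using \<open>card B \<ge> 2\<close> by auto
    then have "{i} \<subset> B" using i by blast
    ultimately show False using conn[OF that(1)] unfolding connected_fam_def by blast
  qed
  \<comment> \<open>Two parallel vectors have rank 1, which is also one less than the size of their
    block. They must form an \<open>I\<close> block, so rank 1 is tested first.\<close>
  define \<sigma> where "\<sigma> B = (if rk v B = 1 then ISlot B else if rk v B + 1 = card B then JSlot B else KSlot B (rk v B))" for B
  define Is where "Is = {B\<in>P. rk v B = 1}"
  define Js where "Js = {B\<in>P. rk v B \<noteq> 1 \<and> rk v B + 1 = card B}"
  define Ks where "Ks = (\<lambda>B. (B, rk v B)) ` {B\<in>P. rk v B \<noteq> 1 \<and> rk v B + 1 \<noteq> card B}"
  have core: "core_slots (Is, Js, Ks) = \<sigma> ` P"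
    unfolding core_slots.simps Is_def Js_def Ks_def \<sigma>_def by (auto simp: image_iff)
  have supp: "slot_support (\<sigma> B) = B" and rank: "B \<in> P \<Longrightarrow> slot_rank (\<sigma> B) = rk v B" for B
    by (auto simp: \<sigma>_def)
  have inj: "inj_on \<sigma> P" using supp by (metis inj_onI)
  have fins: "finite Is" "finite Js" "finite Ks" using finP by (auto simp: Is_def Js_def Ks_def)
  have "rank_p (Is, Js, Ks) = (\<Sum>s\<in>\<sigma> ` P. slot_rank s)"
    using sum_core_slots[OF fins] core by simp
  also have "\<dots> = (\<Sum>B\<in>P. rk v B)" using rank by (simp add: sum.reindex[OF inj])
  finally have rankp: "rank_p (Is, Js, Ks) = rk v {1..m}" using sumP by simp
  have "v ` {1..m} \<subseteq> fv.span (unit_vec ` {1..n})" unfolding span_unit_vec using v(1) by blast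
  then have "rk v {1..m} \<le> rk (unit_vec :: nat \<Rightarrow> nat \<Rightarrow> 'k) {1..n}" unfolding rk_def by (intro dim_mono_span) simp_all
  then have le: "rank_p (Is, Js, Ks) \<le> n"
    using rankp rk_le_card[of "{1..n}" "unit_vec :: nat \<Rightarrow> nat \<Rightarrow> 'k"] by simp
  have fstK: "fst ` Ks = {B\<in>P. rk v B \<noteq> 1 \<and> rk v B + 1 \<noteq> card B}" by (force simp: Ks_def)
  have dj: "B \<inter> C = {}" if "B \<in> P" "C \<in> P" "B \<noteq> C" for B C using part(2) that by (auto simp: disjoint_def)
  have "(Is, Js, Ks) \<in> Pset n m"
    unfolding Pset_def mem_Collect_eq prod.case
  proof (intro conjI)
    show "\<Union>Is \<union> \<Union>Js \<union> \<Union>(fst ` Ks) = {1..m}" unfolding part(1)[symmetric] fstK Is_def Js_def by blast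
    show "\<Union>Is \<inter> \<Union>Js = {}" unfolding Is_def Js_def using dj by blast
    show "\<Union>Is \<inter> \<Union>(fst ` Ks) = {}" unfolding fstK Is_def using dj by blast
    show "\<Union>Js \<inter> \<Union>(fst ` Ks) = {}" unfolding fstK Js_def using dj by blast
    show "disjoint Is" "disjoint Js" using part(2) by (auto simp: disjoint_def Is_def Js_def)
    show "disjoint_family_on fst Ks" unfolding disjoint_family_on_def Ks_def using dj by auto
    show "\<forall>I\<in>Is. 1 \<le> card I"
    proof
      fix I assume "I \<in> Is"
      then have "finite I" "I \<noteq> {}" using finB part(3) by (auto simp: Is_def)
      then show "1 \<le> card I" by (simp add: Suc_leI card_gt_0_iff)
    qed
    show "\<forall>J\<in>Js. 3 \<le> card J" using rk1 by (fastforce simp: Js_def)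
    show "\<forall>(K, r)\<in>Ks. 4 \<le> r + 2 \<and> r + 2 \<le> card K"
    proof safe
      fix K r assume "(K, r) \<in> Ks"
      then have K: "K \<in> P" "r = rk v K" "rk v K \<noteq> 1" "rk v K + 1 \<noteq> card K" by (auto simp: Ks_def)
      then show "4 \<le> r + 2" "r + 2 \<le> card K" using rk1[of K] rkB[of K] by auto
    qed
    show "rank_p (Is, Js, Ks) \<le> n" by (rule le)
  qed
  moreover have "realizes m (Is, Js, Ks) v"
    unfolding realizes_def core using supp rank conn rankp by auto
  ultimately show ?thesis by blast
qed


section \<open>Indecomposable flags\<close>

lemma flag_iso_sym:
  assumes "flag_iso m D E" "fv.subspace (fst D)" "\<And>i. i \<in> {1..m} \<Longrightarrow> snd D i \<subseteq> fst D"
  shows "flag_iso m E D"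
proof -
  obtain f where f: "lin_iso f (fst D) (fst E)" "\<forall>i\<in>{1..m}. f ` snd D i = snd E i"
    using assms(1) unfolding flag_iso_def by blast
  have "inv_into (fst D) f ` snd E i = snd D i" if i: "i \<in> {1..m}" for i
  proof -
    have "inv_into (fst D) f ` (f ` snd D i) = snd D i"
      using lin_iso_inj[OF f(1)] assms(3)[OF i] by (rule inv_into_image_cancel)
    then show ?thesis using f(2) i by simp
  qed
  then show ?thesis
    using lin_iso_inv[OF f(1) assms(2)] unfolding flag_iso_def by blast
qed

lemma flag_iso_trans:
  assumes "flag_iso m D E" "flag_iso m E F"
  shows "flag_iso m D F"
proof -
  obtain f g where f: "lin_iso f (fst D) (fst E)" "\<forall>i\<in>{1..m}. f ` snd D i = snd E i"
    and g: "lin_iso g (fst E) (fst F)" "\<forall>i\<in>{1..m}. g ` snd E i = snd F i"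
    using assms unfolding flag_iso_def by blast
  have "\<forall>i\<in>{1..m}. (g \<circ> f) ` snd D i = snd F i" unfolding image_comp[symmetric] using f(2) g(2) by simp
  then show ?thesis using lin_iso_comp[OF f(1) g(1)] unfolding flag_iso_def by blast
qed

lemma subspace_finite_basis:
  fixes V :: "('i \<Rightarrow> 'k::field) set"
  assumes "fv.subspace V" "V \<subseteq> fv.span B" "finite B"
  obtains C where "finite C" "C \<subseteq> V" "fv.independent C" "V = fv.span C" "card C = fv.dim V"
proof -
  obtain C where C: "C \<subseteq> V" "fv.independent C" "V \<subseteq> fv.span C" "card C = fv.dim V"
    using fv.basis_exists by blast
  have "C \<subseteq> fv.span B" using C(1) assms(2) by blast
  then have "finite C" using independent_card_le_dim[OF assms(3) C(2)] by blast
  moreover have "V = fv.span C" using fv.span_minimal[OF C(1) assms(1)] C(3) by blast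
  ultimately show ?thesis using that C by blast
qed

lemma is_flagD:
  assumes "is_flag m D"
  shows "fv.subspace (fst D)" "i \<in> {1..m} \<Longrightarrow> fv.subspace (snd D i)" "i \<in> {1..m} \<Longrightarrow> snd D i \<subseteq> fst D"
  using assms unfolding is_flag_def by auto

text \<open>The finite spanning set in \<open>is_flag\<close> matters here, since
  \<open>fv.dim\<close> also vanishes on infinite-dimensional spaces.\<close>

lemma dim_zero_flag:
  assumes "is_flag m D" "fv.dim (snd D i) = 0" "i \<in> {1..m}"
  shows "snd D i = {0}"
proof -
  obtain B where B: "finite B" "fst D = fv.span B" using assms(1) unfolding is_flag_def by blast
  obtain C where "finite C" "snd D i = fv.span C" "card C = fv.dim (snd D i)"
    using subspace_finite_basis[of "snd D i" B] is_flagD[OF assms(1)] B assms(3) by metis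
  then show ?thesis using assms(2) by simp
qed

lemma nontrivial_flag_iff:
  assumes "is_flag m D"
  shows "has_dim m D 0 (\<lambda>_. 0) \<longleftrightarrow> fst D = {0}"
proof
  assume d: "has_dim m D 0 (\<lambda>_. 0)"
  obtain B where B: "finite B" "fst D = fv.span B" using assms(1) unfolding is_flag_def by blast
  obtain C where "finite C" "fst D = fv.span C" "card C = fv.dim (fst D)"
    using subspace_finite_basis[of "fst D" B] is_flagD(1)[OF assms(1)] B by (metis order_refl)
  then show "fst D = {0}" using d unfolding has_dim_def by simp
next
  assume z: "fst D = {0}"
  have d0: "fv.dim {0 :: 'a \<Rightarrow> 'b} = 0"
    using fv.dim_span_eq_card_independent[OF fv.independent_empty] by simp
  have "snd D i = {0}" if "i \<in> {1..m}" for i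
    using is_flagD(2,3)[OF assms that] z fv.subspace_0 by blast
  then show "has_dim m D 0 (\<lambda>_. 0)" unfolding has_dim_def using assms z d0 by simp
qed

section \<open>Internal and external direct sums of flags\<close>

lemma zero_comp [simp]: "(0 :: 'i \<Rightarrow> 'k::zero) \<circ> f = 0"
  by (auto simp: fun_eq_iff)

lemma add_comp: "((x :: 'i \<Rightarrow> 'k::field) + y) \<circ> f = (x \<circ> f) + (y \<circ> f)"
  and scale_comp: "fscale c x \<circ> f = fscale c (x \<circ> f)"
  by (auto simp: fun_eq_iff fscale_def)

lemma subspace_vsum2:
  assumes "fv.subspace V" "fv.subspace W" shows "fv.subspace (vsum2 V W)"
  using assms unfolding fv.subspace_def vsum2_def by (auto simp: add_comp scale_comp)

text \<open>Converts an internal splitting, in which every \<open>snd D i\<close> lies in one of the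
  two parts, into the external one that \<open>indecomposable\<close> speaks of.\<close>

lemma not_indecomposableI:
  fixes D :: "(nat, 'k::field) mflag"
  assumes D: "is_flag m D" and fin: "finite X" "finite Y"
    and inter: "fv.span X \<inter> fv.span Y = {0}" and un: "fst D = fv.span (X \<union> Y)"
    and nz: "\<not> X \<subseteq> {0}" "\<not> Y \<subseteq> {0}"
    and lines: "\<And>i. i \<in> {1..m} \<Longrightarrow> snd D i \<subseteq> fv.span X \<or> snd D i \<subseteq> fv.span Y"
  shows "\<not> indecomposable m D"
proof -
  define V where "V = fv.span X"
  define W where "W = fv.span Y"
  have sV: "fv.subspace V" and sW: "fv.subspace W" by (auto simp: V_def W_def)
  \<comment> \<open>Intersecting is correct because each \<open>snd D i\<close> lies in
    \<open>V\<close> or in \<open>W\<close>; its intersection with the other part is then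
    zero.\<close>
  define D1 where "D1 = (V, \<lambda>i. snd D i \<inter> V)"
  define D2 where "D2 = (W, \<lambda>i. snd D i \<inter> W)"
  have f1: "is_flag m D1" and f2: "is_flag m D2"
    unfolding is_flag_def D1_def D2_def using fin is_flagD(2)[OF D] sV sW
    by (auto simp: V_def W_def intro: fv.subspace_inter)
  have "X \<subseteq> V" "Y \<subseteq> W" unfolding V_def W_def by (rule fv.span_superset)+
  then have n: "V \<noteq> {0}" "W \<noteq> {0}" using nz by auto
  have n1: "\<not> has_dim m D1 0 (\<lambda>_. 0)" and n2: "\<not> has_dim m D2 0 (\<lambda>_. 0)"
    using n nontrivial_flag_iff[OF f1] nontrivial_flag_iff[OF f2] by (auto simp: D1_def D2_def)
  \<comment> \<open>Addition of the two components. It is injective on \<open>vsum2 V W\<close>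
    because \<open>V\<close> and \<open>W\<close> meet in 0.\<close>
  define \<psi> :: "(nat + nat \<Rightarrow> 'k) \<Rightarrow> nat \<Rightarrow> 'k" where "\<psi> y = (y \<circ> Inl) + (y \<circ> Inr)" for y
  have \<psi>_case: "\<psi> (case_sum a b) = a + b" for a b by (rule ext) (simp add: \<psi>_def)
  have comp_case: "case_sum a b \<circ> Inl = a" "case_sum a b \<circ> Inr = b" for a b :: "nat \<Rightarrow> 'k" by auto
  have liso: "lin_iso \<psi> (vsum2 V W) (fst D)"
    unfolding lin_iso_def
  proof (intro conjI ballI allI)
    show "bij_betw \<psi> (vsum2 V W) (fst D)"
      unfolding bij_betw_def
    proof
      show "inj_on \<psi> (vsum2 V W)"
      proof (rule inj_onI)
        fix x y assume xy: "x \<in> vsum2 V W" "y \<in> vsum2 V W" "\<psi> x = \<psi> y"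
        have e: "(x \<circ> Inl) - (y \<circ> Inl) = (y \<circ> Inr) - (x \<circ> Inr)"
          using xy(3) unfolding \<psi>_def by (simp add: algebra_simps)
        have "(x \<circ> Inl) - (y \<circ> Inl) \<in> V" "(y \<circ> Inr) - (x \<circ> Inr) \<in> W"
          using xy(1,2) sV sW by (auto simp: vsum2_def intro: fv.subspace_diff)
        moreover from this(2) have "(x \<circ> Inl) - (y \<circ> Inl) \<in> W" unfolding e .
        ultimately have z: "(x \<circ> Inl) - (y \<circ> Inl) = 0"
          using inter unfolding V_def[symmetric] W_def[symmetric] by blast
        note z = z z[unfolded e]
        show "x = y"
        proof
          fix s show "x s = y s"
            using fun_cong[OF z(1)] fun_cong[OF z(2)] by (cases s) auto
        qed
      qed
      show "\<psi> ` vsum2 V W = fst D"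
      proof safe
        fix y assume "y \<in> vsum2 V W"
        then show "\<psi> y \<in> fst D" unfolding un fv.span_Un \<psi>_def vsum2_def V_def W_def by blast
      next
        fix x assume "x \<in> fst D"
        then obtain a b where "x = a + b" "a \<in> V" "b \<in> W" unfolding un fv.span_Un V_def W_def by blast
        then have "x = \<psi> (case_sum a b)" "case_sum a b \<in> vsum2 V W"
          by (auto simp: \<psi>_case vsum2_def comp_case)
        then show "x \<in> \<psi> ` vsum2 V W" by blast
      qed
    qed
  qed (auto simp: \<psi>_def add_comp scale_comp fv.scale_right_distrib algebra_simps)
  have img: "\<psi> ` vsum2 (snd D i \<inter> V) (snd D i \<inter> W) = snd D i" if i: "i \<in> {1..m}" for i
  proof safe
    fix y assume "y \<in> vsum2 (snd D i \<inter> V) (snd D i \<inter> W)"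
    then show "\<psi> y \<in> snd D i"
      unfolding \<psi>_def vsum2_def using fv.subspace_add[OF is_flagD(2)[OF D i]] by auto
  next
    fix x assume x: "x \<in> snd D i"
    have z: "0 \<in> snd D i" "0 \<in> V" "0 \<in> W"
      using fv.subspace_0 is_flagD(2)[OF D i] sV sW by auto
    show "x \<in> \<psi> ` vsum2 (snd D i \<inter> V) (snd D i \<inter> W)"
    proof (cases "snd D i \<subseteq> V")
      case True
      have "x = \<psi> (case_sum x 0)" "case_sum x 0 \<in> vsum2 (snd D i \<inter> V) (snd D i \<inter> W)"
        using x z True by (auto simp: \<psi>_case vsum2_def comp_case)
      then show ?thesis by blast
    next
      case False
      then have "snd D i \<subseteq> W" using lines[OF i] by (auto simp: V_def W_def)
      then have "x = \<psi> (case_sum 0 x)" "case_sum 0 x \<in> vsum2 (snd D i \<inter> V) (snd D i \<inter> W)"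
        using x z by (auto simp: \<psi>_case vsum2_def comp_case)
      then show ?thesis by blast
    qed
  qed
  have "flag_iso m (dsum2 D1 D2) D"
    unfolding flag_iso_def dsum2_def D1_def D2_def fst_conv snd_conv using liso img by blast
  then have "flag_iso m D (dsum2 D1 D2)"
    by (rule flag_iso_sym) (auto simp: dsum2_def D1_def D2_def vsum2_def intro: subspace_vsum2[OF sV sW, unfolded vsum2_def])
  then show ?thesis unfolding indecomposable_def using f1 f2 n1 n2 by blast
qed

text \<open>Two kinds of splitting are excluded: off a complement of the span of the lines, which
  carries no line, and along a separator of the index set.\<close>

lemma indecomposable_imp_connected:
  fixes D :: "(nat, 'k::field) mflag"
  assumes D: "is_flag m D" "indecomposable m D" and S: "finite S" "S \<noteq> {}" "S \<subseteq> {1..m}"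
    and w: "\<And>i. i \<in> S \<Longrightarrow> snd D i = fv.span {w i}" "\<And>i. i \<in> S \<Longrightarrow> w i \<noteq> 0"
    and z: "\<And>i. i \<in> {1..m} - S \<Longrightarrow> snd D i = {0}"
  shows "fv.span (w ` S) = fst D" "connected_fam w S"
proof -
  have wD: "w ` S \<subseteq> fst D"
    using is_flagD(3)[OF D(1)] w(1) S(3) fv.span_base[of "w _" "{w _}"] by blast
  then have sub: "fv.span (w ` S) \<subseteq> fst D" using is_flagD(1)[OF D(1)] by (intro fv.span_minimal)
  obtain i0 where i0: "i0 \<in> S" using S(2) by blast
  show sp: "fv.span (w ` S) = fst D"
  proof (rule ccontr)
    assume ne: "fv.span (w ` S) \<noteq> fst D"
    obtain E where E: "finite E" "fst D = fv.span E" using D(1) unfolding is_flag_def by blast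
    obtain B where B: "finite B" "B \<subseteq> fv.span (w ` S)" "fv.independent B" "fv.span (w ` S) = fv.span B"
      by (rule subspace_finite_basis[OF fv.subspace_span order_refl finite_imageI[OF S(1)]]) (rule that)
    obtain C where C: "B \<subseteq> C" "C \<subseteq> fst D" "fv.independent C" "fst D \<subseteq> fv.span C"
      by (rule fv.maximal_independent_subset_extend[OF order_trans[OF B(2) sub] B(3)])
    have finC: "finite C" using independent_card_le_dim[OF E(1) C(3)] C(2) E(2) by simp
    have spC: "fst D = fv.span C" using C(2,4) fv.span_minimal[OF C(2) is_flagD(1)[OF D(1)]] by blast
    have cards: "fv.dim B = card B" "fv.dim (C - B) = card (C - B)" "fv.dim C = card C"
      using B(3) C(3) fv.independent_mono[OF C(3), of "C - B"] by (auto simp: fv.dim_eq_card_independent)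
    have BC: "B \<union> (C - B) = C" using C(1) by blast
    have "\<not> indecomposable m D"
    proof (rule not_indecomposableI[OF D(1) B(1)])
      show "finite (C - B)" using finC by simp
      show "fv.span B \<inter> fv.span (C - B) = {0}"
        by (rule span_inter_zero) (use B(1) finC C(1) in \<open>simp_all add: cards BC card_Diff_subset card_mono Un_absorb1\<close>)
      show "fst D = fv.span (B \<union> (C - B))" using spC BC by simp
      have "w i0 \<in> fv.span B" unfolding B(4)[symmetric] by (rule fv.span_base) (use i0 in simp)
      then show "\<not> B \<subseteq> {0}" using w(2)[OF i0] fv.span_mono[of B "{0}"] by auto
      show "\<not> C - B \<subseteq> {0}"
      proof
        assume "C - B \<subseteq> {0}"
        then have "C = B" using C(1,3) fv.dependent_zero by auto
        then show False using ne spC B(4) by simp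
      qed
      show "snd D i \<subseteq> fv.span B \<or> snd D i \<subseteq> fv.span (C - B)" if i: "i \<in> {1..m}" for i
      proof (cases "i \<in> S")
        case True
        have "fv.span {w i} \<subseteq> fv.span (w ` S)" using True by (intro fv.span_mono) auto
        then show ?thesis using w(1)[OF True] B(4) by auto
      next
        case False
        then show ?thesis using z[of i] i fv.span_zero by auto
      qed
    qed
    then show False using D(2) by simp
  qed
  show "connected_fam w S"
    unfolding connected_fam_def
  proof (intro allI impI notI)
    fix A assume A: "A \<noteq> {}" "A \<subset> S" and eq: "rk w A + rk w (S - A) = rk w S"
    have fA: "finite A" "finite (S - A)" using A S(1) finite_subset by auto
    have AS: "A \<union> (S - A) = S" using A by blast
    have "\<not> indecomposable m D"
    proof (rule not_indecomposableI[OF D(1), of "w ` A" "w ` (S - A)"])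
      show "fv.span (w ` A) \<inter> fv.span (w ` (S - A)) = {0}"
        using rk_additive_iff[OF fA, of w] eq AS by simp
      show "fst D = fv.span (w ` A \<union> w ` (S - A))" using sp AS by (simp add: image_Un[symmetric])
      show "\<not> w ` A \<subseteq> {0}" "\<not> w ` (S - A) \<subseteq> {0}" using A w(2) by blast+
      show "snd D i \<subseteq> fv.span (w ` A) \<or> snd D i \<subseteq> fv.span (w ` (S - A))" if i: "i \<in> {1..m}" for i
      proof -
        consider "i \<in> A" | "i \<in> S - A" | "i \<in> {1..m} - S" using i by blast
        then show ?thesis
        proof cases
          case 1
          then have "fv.span {w i} \<subseteq> fv.span (w ` A)" by (intro fv.span_mono) auto
          then show ?thesis using 1 w(1) A by blast
        next
          case 2
          then have "fv.span {w i} \<subseteq> fv.span (w ` (S - A))" by (intro fv.span_mono) auto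
          then show ?thesis using 2 w(1) by blast
        next
          case 3
          then show ?thesis using z[OF 3] fv.span_zero by auto
        qed
      qed
    qed (use fA in auto)
    then show False using D(2) by simp
  qed
qed

text \<open>The two summands pull back to subspaces \<open>U1\<close> and \<open>U2\<close> of
  \<open>Kvec r\<close>. Every line lies in one of them, so the indices of the lines in
  \<open>U1\<close> would form a separator unless they are none or all; then the whole space, being
  spanned by the lines, lies in \<open>U1\<close> or in \<open>U2\<close>. The alternative
  \<open>S = {}\<close> covers the empty slots, of dimension 1.\<close>

lemma connected_imp_indecomposable:
  fixes D :: "(nat, 'k::field) mflag"
  assumes V: "fst D = Kvec r" and S: "finite S" "S \<subseteq> {1..m}"
    and w: "\<And>i. i \<in> S \<Longrightarrow> snd D i = fv.span {w i}"
    and c: "S = {} \<and> r = 1 \<or> fv.span (w ` S) = Kvec r \<and> connected_fam w S"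
  shows "indecomposable m D"
  unfolding indecomposable_def
proof (intro notI, elim exE conjE)
  fix D1 D2 :: "(nat, 'k) mflag"
  assume D1: "is_flag m D1" "\<not> has_dim m D1 0 (\<lambda>_. 0)" and D2: "is_flag m D2" "\<not> has_dim m D2 0 (\<lambda>_. 0)"
    and iso: "flag_iso m D (dsum2 D1 D2)"
  obtain \<phi> where \<phi>: "lin_iso \<phi> (Kvec r) (vsum2 (fst D1) (fst D2))"
    and \<phi>i: "\<And>i. i \<in> {1..m} \<Longrightarrow> \<phi> ` snd D i = vsum2 (snd D1 i) (snd D2 i)"
    using iso unfolding flag_iso_def dsum2_def fst_conv snd_conv V by blast
  have "0 \<in> fst D1" "0 \<in> fst D2" using D1 D2 is_flagD(1) fv.subspace_0 by blast+
  \<comment> \<open>Nonzero vectors of the two summands give \<open>x\<close> and \<open>y\<close>,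
    which witness that neither \<open>U1\<close> nor \<open>U2\<close> is the whole space.\<close>
  moreover obtain a where a: "a \<in> fst D1" "a \<noteq> 0"
    using D1 nontrivial_flag_iff[OF D1(1)] calculation by blast
  moreover obtain b where b: "b \<in> fst D2" "b \<noteq> 0"
    using D2 nontrivial_flag_iff[OF D2(1)] calculation by blast
  have comp_case: "case_sum a b \<circ> Inl = a" "case_sum a b \<circ> Inr = b" for a b :: "nat \<Rightarrow> 'k" by auto
  have "case_sum a 0 \<in> vsum2 (fst D1) (fst D2)" "case_sum 0 b \<in> vsum2 (fst D1) (fst D2)"
    using a b calculation by (auto simp: vsum2_def comp_case)
  then obtain x y where x: "x \<in> Kvec r" "\<phi> x = case_sum a 0" and y: "y \<in> Kvec r" "\<phi> y = case_sum 0 b"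
    using lin_iso_image[OF \<phi>] by (metis imageE)
  have lin: "\<phi> (fscale c u) = fscale c (\<phi> u)" if "u \<in> Kvec r" for c u
    using lin_iso_scale[OF \<phi> that] .
  define U1 where "U1 = {u \<in> Kvec r. \<phi> u \<circ> Inr = 0}"
  define U2 where "U2 = {u \<in> Kvec r. \<phi> u \<circ> Inl = 0}"
  have \<phi>0: "\<phi> 0 = 0" by (rule lin_iso_zero[OF \<phi>]) simp
  have sU: "fv.subspace U1" "fv.subspace U2"
    unfolding fv.subspace_def U1_def U2_def
    by (auto simp: \<phi>0 lin lin_iso_add[OF \<phi>] add_comp scale_comp
        fv.subspace_0[OF subspace_Kvec] fv.subspace_add[OF subspace_Kvec] fv.subspace_scale[OF subspace_Kvec])
  have U12: "U1 \<inter> U2 \<subseteq> {0}"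
  proof
    fix u assume u: "u \<in> U1 \<inter> U2"
    have "\<phi> u = 0"
    proof
      have z: "\<phi> u \<circ> Inl = 0" "\<phi> u \<circ> Inr = 0" using u by (auto simp: U1_def U2_def)
      have "\<phi> u (Inl t) = 0" "\<phi> u (Inr t) = 0" for t
        using fun_cong[OF z(1), of t] fun_cong[OF z(2), of t] by (simp_all only: o_apply zero_fun_apply)
      then show "\<phi> u s = 0 s" for s by (cases s) simp_all
    qed
    moreover have "u \<in> Kvec r" "0 \<in> Kvec r" using u fv.subspace_0[OF subspace_Kvec] by (auto simp: U1_def)
    ultimately show "u \<in> {0}" using lin_iso_inj[OF \<phi>] \<phi>0 by (metis inj_onD singletonI)
  qed
  have xU: "x \<in> U1" "x \<notin> U2" and yU: "y \<in> U2" "y \<notin> U1"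
    using x y a b by (auto simp: U1_def U2_def comp_case)
  show False
    using c
  proof
    assume "S = {} \<and> r = 1"
    then have e: "u = fscale (u 1) (unit_vec 1)" if "u \<in> Kvec r" for u :: "nat \<Rightarrow> 'k"
      using Kvec_expand[OF that] by simp
    have "x \<noteq> 0" using xU sU(2) fv.subspace_0 by metis
    then have "x 1 \<noteq> 0" using e[OF x(1)] by (metis fv.scale_zero_left)
    have "y = fscale (y 1 / x 1) x"
      using e[OF y(1)] e[OF x(1)] \<open>x 1 \<noteq> 0\<close> by (metis (no_types) fv.scale_scale nonzero_eq_divide_eq)
    then have "y \<in> U1" using fv.subspace_scale[OF sU(1) xU(1)] by metis
    then show False using yU by simp
  next
    assume c: "fv.span (w ` S) = Kvec r \<and> connected_fam w S"
    define A where "A = {i\<in>S. w i \<in> U1}"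
    have wK: "w i \<in> Kvec r" if "i \<in> S" for i
      using c that fv.span_base[of "w i" "w ` S"] by simp
    have A2: "w i \<in> U2" if i: "i \<in> S - A" for i
    proof -
      have iS: "i \<in> S" "i \<in> {1..m}" using i S by auto
      have mem: "\<phi> (w i) \<in> vsum2 (snd D1 i) (snd D2 i)"
        using \<phi>i[OF iS(2)] w[OF iS(1)] fv.span_base[of "w i" "{w i}"] by blast
      \<comment> \<open>With a vector, a direct sum contains its truncation to the first component.
        On a line this truncation is a multiple of the generator; comparing second components shows
        that the factor is 0.\<close>
      then have "case_sum (\<phi> (w i) \<circ> Inl) 0 \<in> vsum2 (snd D1 i) (snd D2 i)"
        using fv.subspace_0[OF is_flagD(2)[OF D2(1) iS(2)]] by (auto simp: vsum2_def comp_case)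
      then have "case_sum (\<phi> (w i) \<circ> Inl) 0 \<in> \<phi> ` fv.span {w i}" using \<phi>i[OF iS(2)] w[OF iS(1)] by simp
      then obtain c where "case_sum (\<phi> (w i) \<circ> Inl) 0 = \<phi> (fscale c (w i))"
        unfolding fv.span_singleton by blast
      then have c: "case_sum (\<phi> (w i) \<circ> Inl) 0 = fscale c (\<phi> (w i))"
        unfolding lin[OF wK[OF iS(1)]] .
      have "\<phi> (w i) \<circ> Inr \<noteq> 0" using i wK by (auto simp: A_def U1_def)
      moreover have "fscale c (\<phi> (w i) \<circ> Inr) = 0" using c comp_case(2) by (metis scale_comp)
      ultimately have "c = 0" by simp
      then have "\<phi> (w i) \<circ> Inl = 0" using c comp_case(1)[of "\<phi> (w i) \<circ> Inl" 0] by simp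
      then show ?thesis using wK iS by (simp add: U2_def)
    qed
    have s1: "fv.span (w ` A) \<subseteq> U1" by (rule fv.span_minimal[OF _ sU(1)]) (auto simp: A_def)
    have s2: "fv.span (w ` (S - A)) \<subseteq> U2" by (rule fv.span_minimal[OF _ sU(2)]) (use A2 in auto)
    have "A \<subseteq> S" by (auto simp: A_def)
    then have fA: "finite A" "finite (S - A)" and AS: "A \<union> (S - A) = S" using S finite_subset by auto
    have "fv.span (w ` A) \<inter> fv.span (w ` (S - A)) = {0}"
      by (rule subset_antisym[OF subset_trans[OF Int_mono[OF s1 s2] U12]]) (simp add: fv.span_zero)
    then have "rk w A + rk w (S - A) = rk w S" using rk_additive_iff[OF fA, of w] AS by simp
    then have "A = {} \<or> A = S" using c \<open>A \<subseteq> S\<close> unfolding connected_fam_def by blast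
    then show False
    proof
      assume "A = {}"
      then show False using s2 c x(1) xU by auto
    next
      assume "A = S"
      then show False using s1 c y(1) yU by auto
    qed
  qed
qed


section \<open>Gluing the summands\<close>

lemma ex_basis_fam:
  fixes X :: "('i \<Rightarrow> 'k::field) set"
  assumes "finite X" "fv.dim X = r"
  obtains b :: "nat \<Rightarrow> 'i \<Rightarrow> 'k" where "indep_fam b {1..r}" "fv.span (b ` {1..r}) = fv.span X" "b ` {1..r} \<subseteq> X"
proof -
  obtain B where B: "B \<subseteq> X" "fv.independent B" "X \<subseteq> fv.span B" "card B = fv.dim X"
    using fv.basis_exists by blast
  have "finite B" using B(1) assms(1) finite_subset by blast
  then obtain h where h: "bij_betw h {1..card B} B" using ex_bij_betw_nat_finite_1 by blast
  have hB: "h ` {1..r} = B" "inj_on h {1..r}" using h B(4) assms(2) by (auto simp: bij_betw_def)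
  have "fv.span B = fv.span X"
    using fv.span_mono[OF B(1)] fv.span_minimal[OF B(3) fv.subspace_span] by blast
  moreover have "indep_fam h {1..r}"
    by (rule independent_imp_indep_fam) (use hB B(2) in auto)
  ultimately show ?thesis using that[of h] hB B(1) by simp
qed

lemma Kvec_outside: "x \<in> Kvec r \<Longrightarrow> i \<notin> {1..r} \<Longrightarrow> x i = 0"
  unfolding Kvec_def by blast

lemma lin_iso_GL_span:
  assumes "g \<in> GL n" "x \<in> Kvec n"
  shows "g ` fv.span {x} = fv.span {g x}"
  using lin_iso_span_image[of g "Kvec n" "Kvec n" "{x}"] assms by (simp add: GL_def)

section \<open>Coordinates on the direct sum of the slots\<close>

context pdatum
begin

text \<open>An arbitrary numbering of the coordinates of all summands by \<open>{1..n}\<close>.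
  Another numbering changes the glued flag by an element of \<open>GL n\<close>, so orbits do not
  depend on it.\<close>

definition coord :: "slot \<times> nat \<Rightarrow> nat" where
  "coord = (SOME f. bij_betw f (SIGMA s:slots n p. {1..slot_rank s}) {1..n})"

lemma coord_bij: "bij_betw coord (SIGMA s:slots n p. {1..slot_rank s}) {1..n}"
proof -
  have "card (SIGMA s:slots n p. {1..slot_rank s}) = n"
    using finite_slots sum_slots by simp
  then have "\<exists>f. bij_betw f (SIGMA s:slots n p. {1..slot_rank s}) {1..n}"
    using finite_slots by (intro finite_same_card_bij) auto
  then show ?thesis unfolding coord_def by (rule someI_ex)
qed

lemma coord_in: "s \<in> slots n p \<Longrightarrow> j \<in> {1..slot_rank s} \<Longrightarrow> coord (s, j) \<in> {1..n}"
  by (rule bspec[OF bij_betwE[OF coord_bij]]) blast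

lemma coord_inj:
  "s \<in> slots n p \<Longrightarrow> j \<in> {1..slot_rank s} \<Longrightarrow> t \<in> slots n p \<Longrightarrow> l \<in> {1..slot_rank t} \<Longrightarrow>
   coord (s, j) = coord (t, l) \<longleftrightarrow> s = t \<and> j = l"
  using inj_on_eq_iff[OF bij_betw_imp_inj_on[OF coord_bij], of "(s, j)" "(t, l)"] by blast

lemma coord_cases:
  assumes "i \<in> {1..n}"
  obtains s j where "s \<in> slots n p" "j \<in> {1..slot_rank s}" "i = coord (s, j)"
proof -
  have "i \<in> coord ` (SIGMA s:slots n p. {1..slot_rank s})"
    using bij_betw_imp_surj_on[OF coord_bij] assms by simp
  then show ?thesis by (elim imageE SigmaE) (rule that; blast)
qed

definition uncoord :: "nat \<Rightarrow> slot \<times> nat" where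
  "uncoord = inv_into (SIGMA s:slots n p. {1..slot_rank s}) coord"

lemma uncoord_coord: "s \<in> slots n p \<Longrightarrow> j \<in> {1..slot_rank s} \<Longrightarrow> uncoord (coord (s, j)) = (s, j)"
  unfolding uncoord_def by (rule bij_betw_inv_into_left[OF coord_bij]) auto

definition glue :: "(slot \<times> nat \<Rightarrow> 'k::field) \<Rightarrow> nat \<Rightarrow> 'k" where
  "glue y = (\<lambda>i. if i \<in> {1..n} then y (uncoord i) else 0)"

text \<open>The inclusion of the summand \<open>s\<close> into the direct sum, followed by
  \<open>glue\<close>.\<close>

definition slot_emb :: "slot \<Rightarrow> (nat \<Rightarrow> 'k::field) \<Rightarrow> nat \<Rightarrow> 'k" where
  "slot_emb s x = glue (\<lambda>(t, j). if t = s then x j else 0)"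

lemma glue_coord: "s \<in> slots n p \<Longrightarrow> j \<in> {1..slot_rank s} \<Longrightarrow> glue y (coord (s, j)) = y (s, j)"
  using coord_in by (simp add: glue_def uncoord_coord)

lemma lin_iso_glue: "lin_iso glue (vsum (slots n p) (\<lambda>s. Kvec (slot_rank s))) (Kvec n)"
  unfolding lin_iso_def
proof (intro conjI ballI allI)
  let ?W = "vsum (slots n p) (\<lambda>s. Kvec (slot_rank s)) :: (slot \<times> nat \<Rightarrow> 'a::field) set"
  define h :: "(nat \<Rightarrow> 'a) \<Rightarrow> slot \<times> nat \<Rightarrow> 'a" where
    "h x = (\<lambda>(s, j). if s \<in> slots n p \<and> j \<in> {1..slot_rank s} then x (coord (s, j)) else 0)" for x
  show "bij_betw glue ?W (Kvec n)"
  proof (rule bij_betw_byWitness[where f' = h])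
    show "\<forall>y\<in>?W. h (glue y) = y"
    proof
      fix y :: "slot \<times> nat \<Rightarrow> 'a" assume y: "y \<in> ?W"
      show "h (glue y) = y"
      proof
        fix d :: "slot \<times> nat"
        obtain s j where d: "d = (s, j)" by (cases d)
        show "h (glue y) d = y d"
        proof (cases "s \<in> slots n p \<and> j \<in> {1..slot_rank s}")
          case True
          then show ?thesis unfolding d h_def prod.case using glue_coord[of s j y] by simp
        next
          case False
          then have "y (s, j) = 0"
            using y unfolding vsum_def Kvec_def by blast
          then show ?thesis using False unfolding d h_def prod.case by (simp only: if_False)
        qed
      qed
    qed
    show "\<forall>x\<in>Kvec n. glue (h x) = x"
    proof
      fix x :: "nat \<Rightarrow> 'a" assume x: "x \<in> Kvec n"
      show "glue (h x) = x"
      proof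
        fix i show "glue (h x) i = x i"
        proof (cases "i \<in> {1..n}")
          case True
          then obtain s j where "s \<in> slots n p" "j \<in> {1..slot_rank s}" "i = coord (s, j)" by (rule coord_cases)
          then show ?thesis using glue_coord[of s j "h x"] by (simp add: h_def)
        next
          case False
          then show ?thesis unfolding Kvec_outside[OF x False] glue_def by (simp only: if_False)
        qed
      qed
    qed
    show "glue ` ?W \<subseteq> Kvec n" unfolding glue_def Kvec_def by auto
    show "h ` Kvec n \<subseteq> ?W" unfolding h_def vsum_def Kvec_def by auto
  qed
qed (auto simp: glue_def fscale_def fun_eq_iff)

lemma emb_add: "slot_emb s (x + y) = slot_emb s x + slot_emb s y"
  and emb_scale: "slot_emb s (fscale c x) = fscale c (slot_emb s x)"
  by (auto simp: slot_emb_def glue_def fscale_def fun_eq_iff split: prod.split)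

lemma emb_zero: "slot_emb s 0 = 0"
  by (auto simp: slot_emb_def glue_def fun_eq_iff split: prod.split)

lemma emb_in_Kvec: "slot_emb s x \<in> Kvec n"
  by (auto simp: slot_emb_def glue_def Kvec_def)

lemma emb_coord: "s \<in> slots n p \<Longrightarrow> j \<in> {1..slot_rank s} \<Longrightarrow> t \<in> slots n p \<Longrightarrow>
    slot_emb t x (coord (s, j)) = (if t = s then x j else 0)"
  by (simp add: slot_emb_def glue_coord)

lemma emb_inj: "s \<in> slots n p \<Longrightarrow> x \<in> Kvec (slot_rank s) \<Longrightarrow> y \<in> Kvec (slot_rank s) \<Longrightarrow>
   slot_emb s x = slot_emb s y \<Longrightarrow> x = y"
proof
  fix j assume s: "s \<in> slots n p" "x \<in> Kvec (slot_rank s)" "y \<in> Kvec (slot_rank s)" and e: "slot_emb s x = slot_emb s y"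
  show "x j = y j"
  proof (cases "j \<in> {1..slot_rank s}")
    case True
    then show ?thesis using fun_cong[OF e, of "coord (s, j)"] s(1) by (simp add: emb_coord)
  next
    case False
    then show ?thesis using Kvec_outside[OF s(2)] Kvec_outside[OF s(3)] by simp
  qed
qed

lemma emb_unit_vec: "s \<in> slots n p \<Longrightarrow> j \<in> {1..slot_rank s} \<Longrightarrow> slot_emb s (unit_vec j) = unit_vec (coord (s, j))"
proof
  fix i assume s: "s \<in> slots n p" "j \<in> {1..slot_rank s}"
  show "slot_emb s (unit_vec j) i = unit_vec (coord (s, j)) i"
  proof (cases "i \<in> {1..n}")
    case True
    then obtain t l where t: "t \<in> slots n p" "l \<in> {1..slot_rank t}" "i = coord (t, l)" by (rule coord_cases)
    show ?thesis
      unfolding t(3) emb_coord[OF t(1,2) s(1)] unit_vec_def coord_inj[OF t(1,2) s] by auto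
  next
    case False
    then show ?thesis using coord_in[OF s] by (auto simp: slot_emb_def glue_def unit_vec_def)
  qed
qed

lemma emb_expand: "s \<in> slots n p \<Longrightarrow> x \<in> Kvec (slot_rank s) \<Longrightarrow>
   slot_emb s x = (\<Sum>j\<in>{1..slot_rank s}. fscale (x j) (unit_vec (coord (s, j))))"
proof -
  assume s: "s \<in> slots n p" and x: "x \<in> Kvec (slot_rank s)"
  have sm: "slot_emb s (\<Sum>j\<in>A. f j) = (\<Sum>j\<in>A. slot_emb s (f j))" for A and f :: "nat \<Rightarrow> nat \<Rightarrow> 'a"
    by (induction A rule: infinite_finite_induct) (simp_all only: sum.infinite sum.empty emb_zero sum.insert emb_add not_False_eq_True)
  have "slot_emb s x = slot_emb s (\<Sum>j\<in>{1..slot_rank s}. fscale (x j) (unit_vec j))" using Kvec_expand[OF x] by simp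
  also have "\<dots> = (\<Sum>j\<in>{1..slot_rank s}. fscale (x j) (slot_emb s (unit_vec j)))"
    unfolding sm emb_scale ..
  also have "\<dots> = (\<Sum>j\<in>{1..slot_rank s}. fscale (x j) (unit_vec (coord (s, j))))"
    by (rule sum.cong) (use s emb_unit_vec in auto)
  finally show ?thesis .
qed

text \<open>An index lies in the support of at most one slot, so in position \<open>i\<close> the
  direct sum of the subspaces has a single nonzero term.\<close>

lemma glue_flag:
  fixes D :: "slot \<Rightarrow> (nat, 'k::field) mflag"
  assumes D: "\<And>s. s \<in> slots n p \<Longrightarrow> fst (D s) = Kvec (slot_rank s)"
    "\<And>s i. s \<in> slots n p \<Longrightarrow> i \<in> slot_support s \<Longrightarrow> snd (D s) i = fv.span {w i}"
    "\<And>s i. s \<in> slots n p \<Longrightarrow> i \<in> {1..m} - slot_support s \<Longrightarrow> snd (D s) i = {0}"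
  shows "lin_iso glue (fst (dsum (slots n p) D)) (Kvec n)"
    "s \<in> slots n p \<Longrightarrow> i \<in> slot_support s \<Longrightarrow> glue ` snd (dsum (slots n p) D) i = fv.span {slot_emb s (w i)}"
proof -
  have "vsum (slots n p) (\<lambda>s. fst (D s)) = vsum (slots n p) (\<lambda>s. Kvec (slot_rank s))"
    unfolding vsum_def using D(1) by auto
  then show "lin_iso glue (fst (dsum (slots n p) D)) (Kvec n)"
    using lin_iso_glue by (simp add: dsum_def)
  assume s: "s \<in> slots n p" and i: "i \<in> slot_support s"
  have im: "i \<in> {1..m}" using support_subset s i by blast
  have other: "snd (D t) i = {0}" if "t \<in> slots n p" "t \<noteq> s" for t
    using D(3)[OF that(1)] support_disjoint[OF that(1) s that(2)] i im by blast
  have sub: "vsum (slots n p) (\<lambda>t. snd (D t) i)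
     = (\<lambda>c (t, j). if t = s then c * w i j else 0) ` UNIV"
  proof safe
    fix y assume y: "y \<in> vsum (slots n p) (\<lambda>t. snd (D t) i)"
    have "(\<lambda>j. y (s, j)) \<in> fv.span {w i}" using y s D(2)[OF s i] by (auto simp: vsum_def)
    then obtain c where c: "(\<lambda>j. y (s, j)) = fscale c (w i)" unfolding fv.span_singleton by blast
    have "y (t, j) = (if t = s then c * w i j else 0)" for t j
    proof (cases "t = s")
      case True then show ?thesis using fun_cong[OF c, of j] by (simp add: fscale_def)
    next
      case False
      have "y (t, j) = 0"
      proof (cases "t \<in> slots n p")
        case True
        then have "(\<lambda>j. y (t, j)) \<in> {0}" using y other[OF True False] by (auto simp: vsum_def)
        then have "(\<lambda>j. y (t, j)) = 0" by simp
        then show ?thesis using fun_cong[of "\<lambda>j. y (t, j)" 0 j] by simp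
      next
        case False
        then show ?thesis using y by (simp add: vsum_def)
      qed
      then show ?thesis using False by simp
    qed
    then have "y = (\<lambda>(t, j). if t = s then c * w i j else 0)" by auto
    then show "y \<in> (\<lambda>c (t, j). if t = s then c * w i j else 0) ` UNIV" by blast
  next
    fix c
    have "(\<lambda>j. (case (t, j) of (t, j) \<Rightarrow> if t = s then c * w i j else 0)) \<in> snd (D t) i" if t: "t \<in> slots n p" for t
    proof (cases "t = s")
      case True
      have "fscale c (w i) \<in> fv.span {w i}" by (intro fv.span_scale fv.span_base) simp
      then show ?thesis using True D(2)[OF s i] by (simp add: fscale_def)
    next
      case False
      then show ?thesis using other[OF t False] by (simp add: fun_eq_iff)
    qed
    then show "(\<lambda>(t, j). if t = s then c * w i j else 0) \<in> vsum (slots n p) (\<lambda>t. snd (D t) i)"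
      using s unfolding vsum_def by auto
  qed
  have "glue (\<lambda>(t, j). if t = s then c * w i j else 0) = fscale c (slot_emb s (w i))" for c
    unfolding emb_scale[symmetric] by (simp add: slot_emb_def fscale_def)
  then show "glue ` snd (dsum (slots n p) D) i = fv.span {slot_emb s (w i)}"
    unfolding dsum_def snd_conv sub fv.span_singleton image_image by simp
qed

text \<open>Spanning vectors of the blocks, completed by a complement of the sum of the block spans,
  form a basis of K^n adapted to \<open>p\<close>; the complement is indexed by the empty slots.
  \<open>H\<close> sends the standard coordinate vectors of each core slot to the given vectors
  \<open>b s j\<close>.\<close>

lemma adapted_iso:
  fixes v :: "nat \<Rightarrow> nat \<Rightarrow> 'k::field"
  assumes v: "realizes m p v" "\<And>i. i \<in> {1..m} \<Longrightarrow> v i \<in> Kvec n"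
    and b: "\<And>s. s \<in> core_slots p \<Longrightarrow> fv.span (b s ` {1..slot_rank s}) = fv.span (v ` slot_support s)"
  shows "\<exists>H\<in>GL n. \<forall>s\<in>core_slots p. \<forall>x\<in>Kvec (slot_rank s). H (slot_emb s x) = lincomb (slot_rank s) (b s) x"
proof -
  let ?X = "v ` {1..m}"
  have XK: "fv.span ?X \<subseteq> Kvec n" by (rule fv.span_minimal) (use v(2) in auto)
  obtain B where B: "finite B" "B \<subseteq> fv.span ?X" "fv.independent B" "fv.span ?X = fv.span B" "card B = fv.dim (fv.span ?X)"
    by (rule subspace_finite_basis[OF fv.subspace_span order_refl, of ?X]) (simp, rule that)
  obtain C where C: "B \<subseteq> C" "C \<subseteq> Kvec n" "fv.independent C" "Kvec n \<subseteq> fv.span C"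
    by (rule fv.maximal_independent_subset_extend[OF order_trans[OF B(2) XK] B(3)])
  have fC: "finite C"
    using independent_card_le_dim[OF _ C(3), of "unit_vec ` {1..n}"] C(2) unfolding span_unit_vec by simp
  have "card C = n" using fv.dim_unique[OF C(2,4,3) refl] by simp
  moreover have "card B = rank_p p" using B(5) v(1) by (simp add: realizes_def rk_def)
  ultimately have "card (C - B) = n - rank_p p" using card_Diff_subset[OF B(1) C(1)] by simp
  \<comment> \<open>The complement has \<open>n - rank_p p\<close> vectors, as many as there are
    empty slots.\<close>
  then obtain c where c: "bij_betw c {1..n - rank_p p} (C - B)"
    using ex_bij_betw_nat_finite_1[of "C - B"] fC by auto
  define \<beta> where "\<beta> i = (case uncoord i of (s, j) \<Rightarrow> (case s of EmptySlot k \<Rightarrow> c k | _ \<Rightarrow> b s j))" for i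
  have \<beta>core: "\<beta> (coord (s, j)) = b s j" if "s \<in> core_slots p" "j \<in> {1..slot_rank s}" for s j
    using that(1) uncoord_coord[of s j] that core_subset by (cases rule: core_slot_cases) (auto simp: \<beta>_def)
  have \<beta>empty: "\<beta> (coord (EmptySlot k, 1)) = c k" if "k \<in> {1..n - rank_p p}" for k
    using uncoord_coord[of "EmptySlot k" 1] that by (simp add: slots_eq \<beta>_def)
  have bK: "b s j \<in> Kvec n" if "s \<in> core_slots p" "j \<in> {1..slot_rank s}" for s j
  proof -
    have "b s j \<in> fv.span (b s ` {1..slot_rank s})" by (rule fv.span_base) (use that in simp)
    then have "b s j \<in> fv.span (v ` slot_support s)" unfolding b[OF that(1)] .
    moreover have "v ` slot_support s \<subseteq> v ` {1..m}" using that(1) core_subset support_subset by blast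
    ultimately show ?thesis using fv.span_mono XK by blast
  qed
  have cK: "c k \<in> Kvec n" if "k \<in> {1..n - rank_p p}" for k
    using bij_betwE[OF c] that C(2) by blast
  have slot_cases: "s \<in> core_slots p \<or> (\<exists>k\<in>{1..n - rank_p p}. s = EmptySlot k)" if "s \<in> slots n p" for s
    using that unfolding slots_eq by blast
  have K: "\<beta> i \<in> Kvec n" if i: "i \<in> {1..n}" for i
  proof -
    obtain s j where s: "s \<in> slots n p" "j \<in> {1..slot_rank s}" "i = coord (s, j)" by (rule coord_cases[OF i])
    show ?thesis
      using slot_cases[OF s(1)]
    proof
      assume "s \<in> core_slots p" then show ?thesis using s \<beta>core bK by simp
    next
      assume "\<exists>k\<in>{1..n - rank_p p}. s = EmptySlot k"
      then obtain k where k: "k \<in> {1..n - rank_p p}" "s = EmptySlot k" by blast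
      then have "j = 1" using s(2) by simp
      then show ?thesis using k s(3) \<beta>empty[OF k(1)] cK[OF k(1)] by simp
    qed
  qed
  \<comment> \<open>It suffices that the \<open>n\<close> vectors \<open>\<beta> i\<close> span K^n;
    their independence follows by counting in \<open>lincomb_in_GL\<close>.\<close>
  let ?S = "fv.span (\<beta> ` {1..n})"
  have "?X \<subseteq> ?S"
  proof safe
    fix i assume "i \<in> {1..m}"
    then obtain s where s: "s \<in> core_slots p" "i \<in> slot_support s" using ex1_slot by blast
    have "b s ` {1..slot_rank s} \<subseteq> ?S"
    proof safe
      fix j assume j: "j \<in> {1..slot_rank s}"
      have "\<beta> (coord (s, j)) \<in> ?S"
        by (rule fv.span_base) (use j s(1) core_subset coord_in in blast)
      then show "b s j \<in> ?S" using \<beta>core[OF s(1) j] by simp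
    qed
    then have "fv.span (b s ` {1..slot_rank s}) \<subseteq> ?S" by (rule fv.span_minimal) simp
    moreover have "v i \<in> fv.span (v ` slot_support s)" by (rule fv.span_base) (use s in simp)
    ultimately show "v i \<in> ?S" unfolding b[OF s(1)] by blast
  qed
  then have "fv.span ?X \<subseteq> ?S" by (rule fv.span_minimal) simp
  then have "B \<subseteq> ?S" using B(2) by (rule order_trans[rotated])
  moreover have "C - B \<subseteq> ?S"
  proof
    fix x assume "x \<in> C - B"
    then obtain k where k: "k \<in> {1..n - rank_p p}" "x = c k"
      using bij_betw_imp_surj_on[OF c] by blast
    have "EmptySlot k \<in> slots n p" using k by (simp add: slots_eq)
    then have "coord (EmptySlot k, 1) \<in> {1..n}" by (rule coord_in) simp
    then have "\<beta> (coord (EmptySlot k, 1)) \<in> ?S" by (intro fv.span_base imageI)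
    then show "x \<in> ?S" using \<beta>empty[OF k(1)] k(2) by simp
  qed
  ultimately have "C \<subseteq> ?S" by blast
  then have "fv.span C \<subseteq> ?S" by (rule fv.span_minimal) simp
  then have "Kvec n \<subseteq> ?S" using C(4) by blast
  then have GL: "lincomb n \<beta> \<in> GL n" using K by (intro lincomb_in_GL)
  moreover have "lincomb n \<beta> (slot_emb s x) = lincomb (slot_rank s) (b s) x"
    if s: "s \<in> core_slots p" and x: "x \<in> Kvec (slot_rank s)" for s x
  proof -
    have sl: "s \<in> slots n p" using s core_subset by blast
    have "lincomb n \<beta> (slot_emb s x) = (\<Sum>j\<in>{1..slot_rank s}. fscale (x j) (lincomb n \<beta> (unit_vec (coord (s, j)))))"
      unfolding emb_expand[OF sl x]
      using GL sl coord_in by (intro lin_iso_lincomb[of _ "Kvec n" "Kvec n"]) (auto simp: GL_def)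
    also have "\<dots> = (\<Sum>j\<in>{1..slot_rank s}. fscale (x j) (b s j))"
      using \<beta>core[OF s] coord_in[OF sl] by (intro sum.cong) (simp_all add: lincomb_unit_vec)
    finally show ?thesis by (simp add: lincomb_def)
  qed
  ultimately show ?thesis by blast
qed

end


section \<open>The index of a configuration of lines\<close>

lemma dim_one_span:
  fixes V :: "('i \<Rightarrow> 'k::field) set"
  assumes "fv.subspace V" "V \<subseteq> fv.span B" "finite B" "fv.dim V = 1"
  obtains u where "V = fv.span {u}"
proof -
  obtain C where C: "V = fv.span C" "card C = fv.dim V"
    by (rule subspace_finite_basis[OF assms(1-3)]) (rule that)
  then obtain u where "C = {u}" using assms(4) card_1_singletonE by metis
  then show ?thesis using C that by blast
qed

lemma dim_singleton: "v \<noteq> 0 \<Longrightarrow> fv.dim {v :: 'i \<Rightarrow> 'k::field} = 1"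
  by (simp add: fv.dim_eq_card_independent)

lemma rk_lin_iso:
  assumes "lin_iso f V W" "fv.subspace V" "v ` A \<subseteq> V"
  shows "rk (f \<circ> v) A = rk v A"
  using lin_iso_dim_image[OF assms] by (simp add: rk_def image_comp)

lemma rk_cong: "(\<And>i. i \<in> A \<Longrightarrow> v i = w i) \<Longrightarrow> rk v A = rk w A"
  by (simp add: rk_def cong: image_cong)

lemma connected_fam_cong_rk:
  assumes "\<And>A. A \<subseteq> S \<Longrightarrow> rk v A = rk w A" "connected_fam v S"
  shows "connected_fam w S"
  using assms(2) unfolding connected_fam_def
  by (simp add: assms(1)[symmetric] psubset_imp_subset)

text \<open>Inclusion into the external direct sum; \<open>glue\<close> after it is
  \<open>slot_emb\<close>.\<close>

definition slot_incl :: "slot \<Rightarrow> (nat \<Rightarrow> 'k::field) \<Rightarrow> slot \<times> nat \<Rightarrow> 'k" where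
  "slot_incl s x = (\<lambda>(t, j). if t = s then x j else 0)"

lemma injs_inj: "slot_incl s x = slot_incl s y \<Longrightarrow> x = y"
proof
  fix j assume "slot_incl s x = slot_incl s y"
  from fun_cong[OF this, of "(s, j)"] show "x j = y j" by (simp add: slot_incl_def)
qed

lemma lin_iso_injs: "lin_iso (slot_incl s) UNIV (range (slot_incl s))"
  unfolding lin_iso_def
proof (intro conjI ballI allI)
  show "bij_betw (slot_incl s) UNIV (range (slot_incl s))"
    by (simp add: bij_betw_def inj_def) (use injs_inj in blast)
qed (auto simp: slot_incl_def fscale_def fun_eq_iff)

context pdatum
begin

lemma glue_flag_iso:
  fixes D :: "slot \<Rightarrow> (nat, 'k::field) mflag"
  assumes D: "\<And>s. s \<in> slots n p \<Longrightarrow> fst (D s) = Kvec (slot_rank s)"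
    "\<And>s i. s \<in> slots n p \<Longrightarrow> i \<in> slot_support s \<Longrightarrow> snd (D s) i = fv.span {w i}"
    "\<And>s i. s \<in> slots n p \<Longrightarrow> i \<in> {1..m} - slot_support s \<Longrightarrow> snd (D s) i = {0}"
    and H: "H \<in> GL n"
    and L: "\<And>s i. s \<in> core_slots p \<Longrightarrow> i \<in> slot_support s \<Longrightarrow> L i = fv.span {H (slot_emb s (w i))}"
  shows "lin_iso (H \<circ> glue) (fst (dsum (slots n p) D)) (Kvec n)"
    "i \<in> {1..m} \<Longrightarrow> (H \<circ> glue) ` snd (dsum (slots n p) D) i = L i"
proof -
  show "lin_iso (H \<circ> glue) (fst (dsum (slots n p) D)) (Kvec n)"
    using lin_iso_comp[OF glue_flag(1)[OF D]] H by (simp add: GL_def)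
  assume "i \<in> {1..m}"
  then obtain s where s: "s \<in> core_slots p" "i \<in> slot_support s" using ex1_slot by blast
  have "glue ` snd (dsum (slots n p) D) i = fv.span {slot_emb s (w i)}"
    using s core_subset by (intro glue_flag(2)[OF D]) auto
  then show "(H \<circ> glue) ` snd (dsum (slots n p) D) i = L i"
    unfolding image_comp[symmetric] using lin_iso_GL_span[OF H emb_in_Kvec] L[OF s] by simp
qed

text \<open>Each summand records the vectors of a block in a basis of the span of that block. The
  coordinate maps preserve ranks, so connectedness passes to the summands and makes them
  indecomposable.\<close>

lemma realizes_imp_constructible:
  fixes v :: "nat \<Rightarrow> nat \<Rightarrow> 'k::field"
  assumes v: "realizes m p v" "\<And>i. i \<in> {1..m} \<Longrightarrow> v i \<in> Kvec n" "\<And>i. i \<in> {1..m} \<Longrightarrow> v i \<noteq> 0"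
    and F: "\<And>i. i \<in> {1..m} \<Longrightarrow> F i = fv.span {v i}"
  shows "p_constructible n m p (Kvec n, F)"
proof -
  have "\<exists>b :: nat \<Rightarrow> nat \<Rightarrow> 'k. indep_fam b {1..slot_rank s} \<and> fv.span (b ` {1..slot_rank s}) = fv.span (v ` slot_support s)"
    if s: "s \<in> core_slots p" for s
  proof -
    have "fv.dim (v ` slot_support s) = slot_rank s" using v(1) s by (simp add: realizes_def rk_def)
    moreover have "finite (v ` slot_support s)" using finite_support s core_subset by blast
    ultimately show ?thesis using ex_basis_fam by metis
  qed
  then obtain b :: "slot \<Rightarrow> nat \<Rightarrow> nat \<Rightarrow> 'k" where
    b: "\<And>s. s \<in> core_slots p \<Longrightarrow> indep_fam (b s) {1..slot_rank s}"
       "\<And>s. s \<in> core_slots p \<Longrightarrow> fv.span (b s ` {1..slot_rank s}) = fv.span (v ` slot_support s)"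
    by metis
  obtain H where H: "H \<in> GL n"
    "\<And>s x. s \<in> core_slots p \<Longrightarrow> x \<in> Kvec (slot_rank s) \<Longrightarrow> H (slot_emb s x) = lincomb (slot_rank s) (b s) x"
    using adapted_iso[OF v(1,2) b(2)] by blast
  have L: "lin_iso (lincomb (slot_rank s) (b s)) (Kvec (slot_rank s)) (fv.span (v ` slot_support s))"
    if s: "s \<in> core_slots p" for s
    using lin_iso_lincomb_span[OF b(1)[OF s]] b(2)[OF s] by simp
  \<comment> \<open>The slot of \<open>i\<close> is unique, which allows one vector \<open>x\<close>
    to be chosen before \<open>s\<close>.\<close>
  have "\<exists>x. \<forall>s. s \<in> core_slots p \<longrightarrow> i \<in> slot_support s \<longrightarrow> x \<in> Kvec (slot_rank s) \<and> lincomb (slot_rank s) (b s) x = v i"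
    if i: "i \<in> {1..m}" for i
  proof -
    obtain s where s: "s \<in> core_slots p" "i \<in> slot_support s" and u: "\<And>t. t \<in> core_slots p \<Longrightarrow> i \<in> slot_support t \<Longrightarrow> t = s"
      using ex1_slot[OF i] by blast
    have "v i \<in> fv.span (v ` slot_support s)" by (rule fv.span_base) (use s in simp)
    then obtain x where "x \<in> Kvec (slot_rank s)" "lincomb (slot_rank s) (b s) x = v i"
      using lin_iso_image[OF L[OF s(1)]] by (metis imageE)
    then show ?thesis using u by blast
  qed
  then obtain w where w: "\<And>i s. i \<in> {1..m} \<Longrightarrow> s \<in> core_slots p \<Longrightarrow> i \<in> slot_support s \<Longrightarrow>
      w i \<in> Kvec (slot_rank s) \<and> lincomb (slot_rank s) (b s) (w i) = v i"
    by metis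
  have im: "i \<in> {1..m}" "s \<in> core_slots p" if "s \<in> slots n p" "i \<in> slot_support s" for s i
    using that support_subset empty_support by blast+
  define D where "D s = (Kvec (slot_rank s) :: (nat \<Rightarrow> 'k) set,
      \<lambda>i. if i \<in> slot_support s then fv.span {w i} else {0})" for s
  have wK: "w i \<in> Kvec (slot_rank s)" and slot_vec: "lincomb (slot_rank s) (b s) (w i) = v i" and w0: "w i \<noteq> 0"
    if "s \<in> slots n p" "i \<in> slot_support s" for s i
  proof -
    show 1: "w i \<in> Kvec (slot_rank s)" and 2: "lincomb (slot_rank s) (b s) (w i) = v i"
      using w im that by blast+
    show "w i \<noteq> 0" using 2 v(3)[OF im(1)[OF that]] by (auto simp: lincomb_def)
  qed
  have "lin_iso (H \<circ> glue) (fst (dsum (slots n p) D)) (Kvec n) \<and>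
     (\<forall>i\<in>{1..m}. (H \<circ> glue) ` snd (dsum (slots n p) D) i = F i)"
  proof (intro conjI ballI)
    have L': "F i = fv.span {H (slot_emb s (w i))}" if "s \<in> core_slots p" "i \<in> slot_support s" for s i
      using that core_subset wK slot_vec F im H(2) by (metis subsetD)
    show "lin_iso (H \<circ> glue) (fst (dsum (slots n p) D)) (Kvec n)"
      by (rule glue_flag_iso(1)[OF _ _ _ H(1) L']) (auto simp: D_def)
    show "(H \<circ> glue) ` snd (dsum (slots n p) D) i = F i" if "i \<in> {1..m}" for i
      by (rule glue_flag_iso(2)[OF _ _ _ H(1) L' that]) (auto simp: D_def)
  qed
  then have "flag_iso m (dsum (slots n p) D) (Kvec n, F)"
    unfolding flag_iso_def fst_conv snd_conv by blast
  then have "flag_iso m (Kvec n, F) (dsum (slots n p) D)"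
  proof (rule flag_iso_sym)
    have D1: "fv.subspace (snd (D s) i)" "snd (D s) i \<subseteq> fst (D s)" if "s \<in> slots n p" "i \<in> {1..m}" for s i
      using wK[OF that(1), of i] fv.span_minimal[of "{w i}" "Kvec (slot_rank s)"] fv.subspace_0[OF subspace_Kvec]
      by (auto simp: D_def)
    show "fv.subspace (fst (dsum (slots n p) D))"
      unfolding fv.subspace_def dsum_def vsum_def fst_conv D_def
      by (auto simp: Kvec_def fscale_def)
    show "snd (dsum (slots n p) D) i \<subseteq> fst (dsum (slots n p) D)" if "i \<in> {1..m}" for i
      using D1(2)[OF _ that] unfolding dsum_def vsum_def by auto
  qed
  moreover have "indecomposable m (D s) \<and> has_dim m (D s) (slot_rank s) (\<lambda>i. if i \<in> slot_support s then 1 else 0)"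
    if s: "s \<in> slots n p" for s
  proof
    have z: "fv.dim {0 :: nat \<Rightarrow> 'k} = 0"
      using fv.dim_span_eq_card_independent[OF fv.independent_empty] by simp
    have fl: "is_flag m (D s)"
      unfolding is_flag_def D_def fst_conv snd_conv
    proof (intro conjI ballI)
      show "\<exists>B. finite B \<and> (Kvec (slot_rank s) :: (nat \<Rightarrow> 'k) set) = fv.span B"
        by (rule exI[of _ "unit_vec ` {1..slot_rank s}"]) (simp add: span_unit_vec[unfolded One_nat_def])
      fix i
      show "fv.subspace (if i \<in> slot_support s then fv.span {w i} else {0})" by simp
      show "(if i \<in> slot_support s then fv.span {w i} else {0}) \<subseteq> Kvec (slot_rank s)"
        using wK[OF s, of i] fv.span_minimal[of "{w i}" "Kvec (slot_rank s)"] fv.subspace_0[OF subspace_Kvec]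
        by auto
    qed
    show "has_dim m (D s) (slot_rank s) (\<lambda>i. if i \<in> slot_support s then 1 else 0)"
      unfolding has_dim_def using fl w0[OF s] z by (simp add: D_def dim_singleton)
    show "indecomposable m (D s)"
    proof (rule connected_imp_indecomposable[where S = "slot_support s" and w = w and r = "slot_rank s"])
      show "slot_support s = {} \<and> slot_rank s = 1 \<or>
        fv.span (w ` slot_support s) = Kvec (slot_rank s) \<and> connected_fam w (slot_support s)"
      proof (cases "s \<in> core_slots p")
        case False then show ?thesis using empty_support[OF s] by blast
      next
        case True
        have wS: "w ` slot_support s \<subseteq> Kvec (slot_rank s)" using wK[OF s] by blast
        have rk: "rk v A = rk w A" if A: "A \<subseteq> slot_support s" for A
        proof -
          have "rk (lincomb (slot_rank s) (b s) \<circ> w) A = rk w A"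
            by (rule rk_lin_iso[OF L[OF True]]) (use A wS in auto)
          moreover have "rk (lincomb (slot_rank s) (b s) \<circ> w) A = rk v A"
            by (rule rk_cong) (use slot_vec[OF s] A in auto)
          ultimately show ?thesis by simp
        qed
        have c: "connected_fam w (slot_support s)"
          by (rule connected_fam_cong_rk[OF rk]) (use v(1) True in \<open>auto simp: realizes_def\<close>)
        have "rk w (slot_support s) = slot_rank s"
          using rk[OF order_refl] v(1) True by (simp add: realizes_def)
        moreover have "fv.dim (unit_vec ` {1..slot_rank s} :: (nat \<Rightarrow> 'k) set) = slot_rank s"
          using fv.dim_span[of "unit_vec ` {1..slot_rank s} :: (nat \<Rightarrow> 'k) set"]
          unfolding span_unit_vec dim_Kvec by simp
        moreover have "w ` slot_support s \<subseteq> fv.span (unit_vec ` {1..slot_rank s})"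
          unfolding span_unit_vec by (rule wS)
        ultimately have "fv.span (w ` slot_support s) = fv.span (unit_vec ` {1..slot_rank s})"
          by (intro span_eq_of_dim) (simp_all only: rk_def finite_imageI finite_atLeastAtMost order_refl)
        then show ?thesis using c unfolding span_unit_vec by blast
      qed
    qed (use s finite_support support_subset in \<open>auto simp: D_def\<close>)
  qed
  ultimately show ?thesis unfolding p_constructible_def by blast
qed

text \<open>The isomorphism carries \<open>v i\<close> into the single summand whose support
  contains \<open>i\<close>, so ranks within a block can be computed in its summand. The rank of all
  lines together is found by counting dimensions.\<close>

lemma constructible_imp_realizes:
  fixes v :: "nat \<Rightarrow> nat \<Rightarrow> 'k::field"
  assumes v: "\<And>i. i \<in> {1..m} \<Longrightarrow> v i \<in> Kvec n" "\<And>i. i \<in> {1..m} \<Longrightarrow> v i \<noteq> 0"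
    and F: "\<And>i. i \<in> {1..m} \<Longrightarrow> F i = fv.span {v i}"
    and pc: "p_constructible n m p (Kvec n, F)"
  shows "realizes m p v"
proof -
  obtain D :: "slot \<Rightarrow> (nat, 'k) mflag" where
    D: "\<And>s. s \<in> slots n p \<Longrightarrow> indecomposable m (D s)"
      "\<And>s. s \<in> slots n p \<Longrightarrow> has_dim m (D s) (slot_rank s) (\<lambda>i. if i \<in> slot_support s then 1 else 0)"
    and iso: "flag_iso m (Kvec n, F) (dsum (slots n p) D)"
    using pc unfolding p_constructible_def by blast
  obtain f where f: "lin_iso f (Kvec n) (vsum (slots n p) (\<lambda>s. fst (D s)))"
    and fF: "\<And>i. i \<in> {1..m} \<Longrightarrow> f ` F i = vsum (slots n p) (\<lambda>s. snd (D s) i)"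
    using iso unfolding flag_iso_def dsum_def fst_conv snd_conv by blast
  have fl: "is_flag m (D s)" and dimD: "fv.dim (fst (D s)) = slot_rank s"
    and dimi: "\<And>i. i \<in> {1..m} \<Longrightarrow> fv.dim (snd (D s) i) = (if i \<in> slot_support s then 1 else 0)"
    if "s \<in> slots n p" for s
    using D(2)[OF that] unfolding has_dim_def by auto
  have zero: "snd (D s) i = {0}" if "s \<in> slots n p" "i \<in> {1..m} - slot_support s" for s i
    using dim_zero_flag[OF fl[OF that(1)], of i] dimi[OF that(1), of i] that(2) by simp
  define comp where "comp s x = (\<lambda>j. f x (s, j))" for s x
  have comp_in: "comp s x \<in> fst (D s)" if "x \<in> Kvec n" "s \<in> slots n p" for s x
    using lin_iso_image[OF f] that unfolding comp_def vsum_def by blast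
  have outside: "f x (s, j) = 0" if "x \<in> Kvec n" "s \<notin> slots n p" for x s j
    using lin_iso_image[OF f] that unfolding vsum_def by blast
  define w where "w i = comp (THE s. s \<in> core_slots p \<and> i \<in> slot_support s) (v i)" for i
  have w_eq: "w i = comp s (v i)" if "s \<in> core_slots p" "i \<in> slot_support s" for s i
  proof -
    have "i \<in> {1..m}" using that core_subset support_subset by blast
    from the1_equality[OF ex1_slot[OF this], of s] that show ?thesis unfolding w_def by simp
  qed
  have im: "i \<in> {1..m}" "s \<in> core_slots p" if "s \<in> slots n p" "i \<in> slot_support s" for s i
    using that support_subset empty_support by blast+
  have fv_vsum: "f (v i) \<in> vsum (slots n p) (\<lambda>s. snd (D s) i)" if "i \<in> {1..m}" for i
    using fF[OF that] F[OF that] fv.span_base[of "v i" "{v i}"] by blast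
  have fv_inj: "f (v i) = slot_incl s (w i)" if s: "s \<in> slots n p" and i: "i \<in> slot_support s" for s i
  proof
    fix d :: "slot \<times> nat"
    obtain t j where d: "d = (t, j)" by (cases d)
    have iM: "i \<in> {1..m}" using im[OF s i] by blast
    show "f (v i) d = slot_incl s (w i) d"
    proof (cases "t = s")
      case True
      then show ?thesis using w_eq[OF im(2)[OF s i] i] by (simp add: d slot_incl_def comp_def)
    next
      case False
      have "f (v i) (t, j) = 0"
      proof (cases "t \<in> slots n p")
        case True
        have "i \<notin> slot_support t" using support_disjoint[OF s True] False i by blast
        then have "snd (D t) i = {0}" using zero[OF True] iM by blast
        then have "(\<lambda>j. f (v i) (t, j)) = 0" using fv_vsum[OF iM] True unfolding vsum_def by blast
        from fun_cong[OF this, of j] show ?thesis by simp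
      next
        case False
        then show ?thesis using outside v(1)[OF iM] by blast
      qed
      then show ?thesis using False by (simp add: d slot_incl_def)
    qed
  qed
  have f0: "f 0 = 0" by (rule lin_iso_zero[OF f subspace_Kvec])
  have injs0: "slot_incl s 0 = 0" for s :: slot by (auto simp: slot_incl_def fun_eq_iff)
  have w0: "w i \<noteq> 0" if "s \<in> slots n p" "i \<in> slot_support s" for s i
  proof
    assume "w i = 0"
    then have "f (v i) = f 0" using fv_inj[OF that] f0 injs0 by metis
    then have "v i = 0"
      using lin_iso_inj[OF f] v(1)[OF im(1)[OF that]] fv.subspace_0[OF subspace_Kvec] by (meson inj_onD)
    then show False using v(2) im(1)[OF that] by blast
  qed
  have line: "snd (D s) i = fv.span {w i}" if s: "s \<in> slots n p" and i: "i \<in> slot_support s" for s i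
  proof
    have iM: "i \<in> {1..m}" using im[OF s i] by blast
    have wi: "w i \<in> snd (D s) i"
      using fv_vsum[OF iM] s w_eq[OF im(2)[OF s i] i] unfolding vsum_def comp_def by auto
    then show "fv.span {w i} \<subseteq> snd (D s) i"
      using is_flagD(2)[OF fl[OF s] iM] by (intro fv.span_minimal) auto
    show "snd (D s) i \<subseteq> fv.span {w i}"
    proof
      fix y assume y: "y \<in> snd (D s) i"
      have "slot_incl s y \<in> vsum (slots n p) (\<lambda>s. snd (D s) i)"
      proof -
        have "(\<lambda>j. slot_incl s y (t, j)) \<in> snd (D t) i" if t: "t \<in> slots n p" for t
        proof (cases "t = s")
          case True then show ?thesis using y by (simp add: slot_incl_def)
        next
          case False
          then have "(\<lambda>j. slot_incl s y (t, j)) = 0" by (auto simp: slot_incl_def fun_eq_iff)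
          then show ?thesis using fv.subspace_0[OF is_flagD(2)[OF fl[OF t] iM]] by simp
        qed
        moreover have "slot_incl s y (t, j) = 0" if "t \<notin> slots n p" for t j
          using that s by (auto simp: slot_incl_def)
        ultimately show ?thesis unfolding vsum_def by blast
      qed
      then have "slot_incl s y \<in> f ` fv.span {v i}" unfolding fF[OF iM, symmetric] F[OF iM] .
      then obtain c where "slot_incl s y = f (fscale c (v i))" unfolding fv.span_singleton by blast
      also have "\<dots> = fscale c (slot_incl s (w i))"
        using lin_iso_scale[OF f v(1)[OF iM]] fv_inj[OF s i] by simp
      also have "\<dots> = slot_incl s (fscale c (w i))" by (rule lin_iso_scale[OF lin_iso_injs, symmetric]) simp
      finally have "y = fscale c (w i)" by (rule injs_inj)
      then show "y \<in> fv.span {w i}" unfolding fv.span_singleton by blast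
    qed
  qed
  have core: "fv.span (w ` slot_support s) = fst (D s)" "connected_fam w (slot_support s)"
    if s: "s \<in> core_slots p" for s
  proof -
    have sl: "s \<in> slots n p" using s core_subset by blast
    note * = indecomposable_imp_connected[OF fl[OF sl] D(1)[OF sl] finite_support[OF sl] support_nonempty[OF s]
        support_subset[OF sl] line[OF sl] w0[OF sl] zero[OF sl]]
    show "fv.span (w ` slot_support s) = fst (D s)" "connected_fam w (slot_support s)"
      using * by blast+
  qed
  have vsub: "v ` {1..m} \<subseteq> Kvec n" using v(1) by blast
  have rk_vw: "rk w A = rk v A" if s: "s \<in> slots n p" and A: "A \<subseteq> slot_support s" for s A
  proof -
    have "rk (slot_incl s \<circ> w) A = rk w A" by (rule rk_lin_iso[OF lin_iso_injs]) auto
    moreover have "rk (f \<circ> v) A = rk v A"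
      by (rule rk_lin_iso[OF f]) (use v(1) im(1)[OF s] A in auto)
    moreover have "rk (slot_incl s \<circ> w) A = rk (f \<circ> v) A"
      by (rule rk_cong) (use fv_inj[OF s] A in auto)
    ultimately show ?thesis by simp
  qed
  have blocks: "rk v (slot_support s) = slot_rank s" "connected_fam v (slot_support s)"
    if s: "s \<in> core_slots p" for s
  proof -
    have sl: "s \<in> slots n p" using s core_subset by blast
    have "rk w (slot_support s) = slot_rank s"
      using core(1)[OF s] dimD[OF sl] fv.dim_span[of "w ` slot_support s"] by (simp add: rk_def)
    then show "rk v (slot_support s) = slot_rank s" using rk_vw[OF sl order_refl] by simp
    show "connected_fam v (slot_support s)"
      by (rule connected_fam_cong_rk[OF rk_vw[OF sl] core(2)[OF s]])
  qed
  have "\<exists>u. fst (D s) = fv.span {u}" if s: "s \<in> slots n p - core_slots p" for s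
  proof -
    have sl: "s \<in> slots n p" using s by blast
    obtain B where B: "finite B" "fst (D s) = fv.span B" using fl[OF sl] unfolding is_flag_def by blast
    have "fv.dim (fst (D s)) = 1" using dimD[OF sl] empty_support[OF sl] s by simp
    then show ?thesis using dim_one_span[OF is_flagD(1)[OF fl[OF sl]] _ B(1)] B(2) by (metis order_refl)
  qed
  then obtain u where u: "\<And>s. s \<in> slots n p - core_slots p \<Longrightarrow> fst (D s) = fv.span {u s}" by metis
  have "\<exists>z\<in>Kvec n. f z = slot_incl s (u s)" if s: "s \<in> slots n p - core_slots p" for s
  proof -
    have us: "u s \<in> fst (D s)" using u[OF s] fv.span_base[of "u s" "{u s}"] by simp
    have "(\<lambda>j. slot_incl s (u s) (t, j)) \<in> fst (D t)" if t: "t \<in> slots n p" for t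
    proof (cases "t = s")
      case True then show ?thesis using us by (simp add: slot_incl_def)
    next
      case False
      then have "(\<lambda>j. slot_incl s (u s) (t, j)) = 0" by (auto simp: slot_incl_def fun_eq_iff)
      then show ?thesis using fv.subspace_0[OF is_flagD(1)[OF fl[OF t]]] by simp
    qed
    moreover have "slot_incl s (u s) (t, j) = 0" if "t \<notin> slots n p" for t j
      using that s by (auto simp: slot_incl_def)
    ultimately have "slot_incl s (u s) \<in> vsum (slots n p) (\<lambda>s. fst (D s))" unfolding vsum_def by blast
    then show ?thesis using lin_iso_image[OF f] by (metis imageE)
  qed
  \<comment> \<open>\<open>z s\<close> spans the preimage of an empty summand. These vectors supply
    the part of K^n that the lines do not reach.\<close>
  then obtain z where z: "\<And>s. s \<in> slots n p - core_slots p \<Longrightarrow> z s \<in> Kvec n \<and> f (z s) = slot_incl s (u s)" by metis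
  let ?Z = "z ` (slots n p - core_slots p)"
  let ?Y = "v ` {1..m} \<union> ?Z"
  have YK: "?Y \<subseteq> Kvec n" using v(1) z by blast
  have finY: "finite ?Y" using finite_slots by simp
  have "Kvec n \<subseteq> fv.span ?Y"
  proof
    fix x :: "nat \<Rightarrow> 'k" assume x: "x \<in> Kvec n"
    have part: "slot_incl s (comp s x) \<in> fv.span (f ` ?Y)" if s: "s \<in> slots n p" for s
    proof (cases "s \<in> core_slots p")
      case True
      have "comp s x \<in> fv.span (w ` slot_support s)" using comp_in[OF x s] core(1)[OF True] by simp
      then have "slot_incl s (comp s x) \<in> fv.span (slot_incl s ` w ` slot_support s)"
        using lin_iso_span_image[OF lin_iso_injs[of s], of "w ` slot_support s"] by auto
      moreover have "slot_incl s ` w ` slot_support s \<subseteq> f ` ?Y"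
      proof safe
        fix i assume i: "i \<in> slot_support s"
        show "slot_incl s (w i) \<in> f ` ?Y" unfolding fv_inj[OF s i, symmetric] using im(1)[OF s i] by blast
      qed
      ultimately show ?thesis using fv.span_mono by blast
    next
      case False
      then have s': "s \<in> slots n p - core_slots p" using s by blast
      obtain c where c: "comp s x = fscale c (u s)"
        using comp_in[OF x s] u[OF s'] unfolding fv.span_singleton by blast
      have "slot_incl s (comp s x) = fscale c (slot_incl s (u s))"
        unfolding c by (rule lin_iso_scale[OF lin_iso_injs]) simp
      also have "\<dots> = fscale c (f (z s))" using z[OF s'] by simp
      also have "\<dots> \<in> fv.span (f ` ?Y)" using s' by (intro fv.span_scale fv.span_base) blast
      finally show ?thesis .
    qed
    have "f x = (\<Sum>s\<in>slots n p. slot_incl s (comp s x))"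
    proof
      fix d :: "slot \<times> nat"
      obtain t j where d: "d = (t, j)" by (cases d)
      show "f x d = (\<Sum>s\<in>slots n p. slot_incl s (comp s x)) d"
        using outside[OF x, of t j] finite_slots
        by (auto simp: sum_fun_apply d slot_incl_def comp_def)
    qed
    also have "\<dots> \<in> fv.span (f ` ?Y)" by (rule fv.span_sum) (rule part)
    also have "\<dots> = f ` fv.span ?Y" using lin_iso_span_image[OF f subspace_Kvec YK] by simp
    finally obtain y where y: "y \<in> fv.span ?Y" "f x = f y" by blast
    have "y \<in> Kvec n" using y(1) fv.span_minimal[OF YK subspace_Kvec] by blast
    then have "x = y" using y(2) x lin_iso_inj[OF f] by (meson inj_onD)
    then show "x \<in> fv.span ?Y" using y(1) by simp
  qed
  \<comment> \<open>There are at most \<open>n - rank_p p\<close> vectors \<open>z s\<close>, so the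
    lines alone must have rank at least \<open>rank_p p\<close>.\<close>
  then have "n \<le> fv.dim ?Y" using dim_mono_span[OF finY, of "Kvec n"] by simp
  also have "\<dots> \<le> fv.dim (v ` {1..m}) + fv.dim ?Z"
    using dim_union_inter_le[of "v ` {1..m}" ?Z] finite_slots by simp
  also have "fv.dim ?Z \<le> card ?Z" using finite_slots by (intro fv.dim_le_card') simp
  also have "card ?Z \<le> card (slots n p - core_slots p)" using finite_slots by (intro card_image_le) simp
  also have "slots n p - core_slots p \<subseteq> EmptySlot ` {1..n - rank_p p}" unfolding slots_eq by blast
  then have "card (slots n p - core_slots p) \<le> card (EmptySlot ` {1..n - rank_p p})" by (intro card_mono) auto
  also have "\<dots> \<le> n - rank_p p" using card_image_le[of "{1..n - rank_p p}" EmptySlot] by simp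
  finally have "rank_p p \<le> rk v {1..m}" using rank_le by (simp add: rk_def)
  moreover have "rk v {1..m} \<le> rank_p p"
  proof -
    have "rk v {1..m} \<le> (\<Sum>s\<in>core_slots p. rk v (slot_support s))"
      unfolding Union_support[symmetric] using finite_core finite_support core_subset by (intro rk_Union_le) auto
    also have "\<dots> = (\<Sum>s\<in>core_slots p. slot_rank s)" using blocks(1) by (intro sum.cong) auto
    finally show ?thesis using sum_core by simp
  qed
  ultimately show ?thesis unfolding realizes_def using blocks by auto
qed

end

section \<open>The index of an orbit\<close>

lemma p_constructible_GL:
  assumes "g \<in> GL n" "p_constructible n m p (Kvec n, F)" "\<And>i. i \<in> {1..m} \<Longrightarrow> G i = g ` F i" "\<And>i. i \<in> {1..m} \<Longrightarrow> F i \<subseteq> Kvec n"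
  shows "p_constructible n m p (Kvec n, G)"
proof -
  have "flag_iso m (Kvec n, F) (Kvec n, G)"
    unfolding flag_iso_def fst_conv snd_conv using assms(1,3) unfolding GL_def by blast
  then have "flag_iso m (Kvec n, G) (Kvec n, F)"
    by (rule flag_iso_sym) (use assms(4) in auto)
  then show ?thesis using assms(2) flag_iso_trans unfolding p_constructible_def by blast
qed

lemma id_in_GL: "(\<lambda>x. x) \<in> GL n"
  by (simp add: GL_def lin_iso_id)

text \<open>\<open>pi_map\<close> is a definite description; \<open>ex_realizes\<close> and
  \<open>realizes_unique\<close> make it proper. From here on the fibre over \<open>p\<close> is
  described by \<open>realizes\<close> alone.\<close>

lemma pi_map_eq_iff:
  fixes v :: "nat \<Rightarrow> nat \<Rightarrow> 'k::field"
  assumes m: "1 \<le> m" and v: "\<And>i. i \<in> {1..m} \<Longrightarrow> v i \<in> Kvec n" "\<And>i. i \<in> {1..m} \<Longrightarrow> v i \<noteq> 0"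
    and p: "p \<in> Pset n m"
  shows "pi_map n m (diag_orbit n m (\<lambda>i\<in>{1..m}. fv.span {v i})) = p \<longleftrightarrow> realizes m p v"
proof -
  let ?F = "\<lambda>i\<in>{1..m}. fv.span {v i}"
  let ?O = "diag_orbit n m ?F"
  have 1: "p_constructible n m q (Kvec n, ?F) \<longleftrightarrow> realizes m q v" if "q \<in> Pset n m" for q
  proof -
    interpret pdatum n m q by standard fact
    have F: "?F i = fv.span {v i}" if "i \<in> {1..m}" for i using that by simp
    show ?thesis
    proof
      show "realizes m q v" if "p_constructible n m q (Kvec n, ?F)"
        using v F that by (rule constructible_imp_realizes)
      show "p_constructible n m q (Kvec n, ?F)" if "realizes m q v"
        using that v F by (rule realizes_imp_constructible)
    qed
  qed
  have "fv.span {v i} \<subseteq> Kvec n" if "i \<in> {1..m}" for i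
    using v(1)[OF that] by (intro fv.span_minimal) auto
  then have FK: "?F i \<subseteq> Kvec n" if "i \<in> {1..m}" for i using that by simp
  have "?F = (\<lambda>i\<in>{1..m}. (\<lambda>x. x) ` ?F i)" by (simp add: restrict_def fun_eq_iff)
  then have FO: "?F \<in> ?O" unfolding diag_orbit_def using id_in_GL by blast
  have 2: "(\<forall>G\<in>?O. p_constructible n m q (Kvec n, G)) \<longleftrightarrow> realizes m q v" if "q \<in> Pset n m" for q
  proof
    assume "\<forall>G\<in>?O. p_constructible n m q (Kvec n, G)"
    then show "realizes m q v" using FO 1[OF that] by blast
  next
    assume r: "realizes m q v"
    show "\<forall>G\<in>?O. p_constructible n m q (Kvec n, G)"
    proof
      fix G assume "G \<in> ?O"
      then obtain g where g: "g \<in> GL n" "G = (\<lambda>i\<in>{1..m}. g ` ?F i)" unfolding diag_orbit_def by blast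
      show "p_constructible n m q (Kvec n, G)"
        by (rule p_constructible_GL[OF g(1) iffD2[OF 1[OF that] r]]) (use g(2) FK in auto)
    qed
  qed
  have "\<exists>q\<in>Pset n m. realizes m q v" using m v by (rule ex_realizes)
  then obtain q where q: "q \<in> Pset n m" "realizes m q v" by blast
  have "pi_map n m ?O = q"
    unfolding pi_map_def
    by (rule the_equality) (use q 2 realizes_unique in blast)+
  then show ?thesis using q p realizes_unique by blast
qed


section \<open>Spaces of lines and of orbits\<close>

text \<open>Values outside \<open>{1..m}\<close> are unrestricted; \<open>lines\<close> and
  \<open>vec_orbit\<close> do not see them.\<close>

definition vec_configs :: "nat \<Rightarrow> nat \<Rightarrow> (nat \<Rightarrow> nat \<Rightarrow> 'k::field) set" where
  "vec_configs n m = {v. \<forall>i\<in>{1..m}. v i \<in> Kvec n - {0}}"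

definition lines :: "nat \<Rightarrow> (nat \<Rightarrow> nat \<Rightarrow> 'k::field) \<Rightarrow> 'k config" where
  "lines m v = (\<lambda>i\<in>{1..m}. fv.span {v i})"

definition vec_orbit :: "nat \<Rightarrow> nat \<Rightarrow> (nat \<Rightarrow> nat \<Rightarrow> 'k::field) \<Rightarrow> 'k config set" where
  "vec_orbit n m v = diag_orbit n m (lines m v)"

lemma vecsD: "v \<in> vec_configs n m \<Longrightarrow> i \<in> {1..m} \<Longrightarrow> v i \<in> Kvec n" "v \<in> vec_configs n m \<Longrightarrow> i \<in> {1..m} \<Longrightarrow> v i \<noteq> 0"
  unfolding vec_configs_def by blast+

lemma continuous_on_fscale:
  fixes f :: "'a::topological_space \<Rightarrow> 'i \<Rightarrow> 'k::real_normed_field"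
  assumes "continuous_on S c" "continuous_on S f"
  shows "continuous_on S (\<lambda>x. fscale (c x) (f x))"
proof (rule continuous_on_coordinatewise_then_product)
  fix i show "continuous_on S (\<lambda>x. fscale (c x) (f x) i)"
    unfolding fscale_def
    by (rule continuous_on_mult[OF assms(1) continuous_on_product_then_coordinatewise[OF assms(2)]])
qed

lemma continuous_on_lincomb:
  fixes f :: "'a::topological_space \<Rightarrow> 'b \<Rightarrow> 'i \<Rightarrow> 'k::real_normed_field"
  assumes "\<And>j. j \<in> A \<Longrightarrow> continuous_on S (\<lambda>x. c x j)" "\<And>j. j \<in> A \<Longrightarrow> continuous_on S (\<lambda>x. f x j)"
  shows "continuous_on S (\<lambda>x. \<Sum>j\<in>A. fscale (c x j) (f x j))"
proof (rule continuous_on_coordinatewise_then_product)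
  fix i
  have "continuous_on S (\<lambda>x. \<Sum>j\<in>A. fscale (c x j) (f x j) i)"
    by (intro continuous_on_sum continuous_on_product_then_coordinatewise[OF continuous_on_fscale] assms)
  then show "continuous_on S (\<lambda>x. (\<Sum>j\<in>A. fscale (c x j) (f x j)) i)"
    by (simp add: sum_fun_apply)
qed

lemma continuous_on_lin_iso:
  fixes g :: "(nat \<Rightarrow> 'k::real_normed_field) \<Rightarrow> 'i \<Rightarrow> 'k"
  assumes "lin_iso g (Kvec n) W"
  shows "continuous_on (Kvec n) g"
proof -
  have "continuous_on (Kvec n) (\<lambda>x. \<Sum>h\<in>{1..n}. fscale (x h) (g (unit_vec h)))"
    by (intro continuous_on_lincomb continuous_on_const
        continuous_on_subset[OF continuous_on_product_coordinates]) auto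
  moreover have "g x = (\<Sum>h\<in>{1..n}. fscale (x h) (g (unit_vec h)))" if "x \<in> Kvec n" for x
    using lin_iso_lincomb[OF assms subspace_Kvec, of "{1..n}" unit_vec x] Kvec_expand[OF that] by simp
  ultimately show ?thesis by (metis (no_types, lifting) continuous_on_cong)
qed

lemma span_singleton_eq_iff:
  assumes "v \<noteq> 0"
  shows "fv.span {u} = fv.span {v} \<longleftrightarrow> (\<exists>c. c \<noteq> 0 \<and> u = fscale c v)"
proof
  assume e: "fv.span {u} = fv.span {v}"
  have "u \<in> fv.span {v}" unfolding e[symmetric] by (rule fv.span_base) simp
  then obtain c where c: "u = fscale c v" unfolding fv.span_singleton by blast
  have "c \<noteq> 0"
  proof
    assume "c = 0"
    then have "u = 0" using c by simp
    moreover have "v \<in> fv.span {u}" unfolding e by (rule fv.span_base) simp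
    ultimately show False using assms by simp
  qed
  then show "\<exists>c. c \<noteq> 0 \<and> u = fscale c v" using c by blast
next
  assume "\<exists>c. c \<noteq> 0 \<and> u = fscale c v"
  then show "fv.span {u} = fv.span {v}" using fv.span_image_scale[of "{v}" "\<lambda>_. _"] by auto
qed

lemma topspace_proj_space: "topspace (proj_space r :: 'k::real_normed_field line topology) = (\<lambda>v. fv.span {v}) ` (Kvec r - {0})"
  by (simp add: proj_space_def)

lemma quotient_map_proj:
  "quotient_map (top_of_set (Kvec r - {0})) (proj_space r :: 'k::real_normed_field line topology) (\<lambda>v. fv.span {v})"
  unfolding proj_space_def by (rule quotient_map_quotient_top)

text \<open>The saturation of an open set is the union of its preimages under the scalings by
  nonzero scalars, which are continuous.\<close>

lemma open_map_proj:
  "open_map (top_of_set (Kvec r - {0})) (proj_space r :: 'k::real_normed_field line topology) (\<lambda>v. fv.span {v})"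
  unfolding open_map_def
proof (intro allI impI)
  fix U :: "(nat \<Rightarrow> 'k) set" assume U: "openin (top_of_set (Kvec r - {0})) U"
  have sub: "U \<subseteq> Kvec r - {0}" using openin_imp_subset[OF U] .
  have "{x \<in> Kvec r - {0}. fv.span {x} \<in> (\<lambda>v. fv.span {v}) ` U}
      = (\<Union>c\<in>-{0}. (Kvec r - {0}) \<inter> fscale c -` U)"
  proof (intro subset_antisym subsetI)
    fix x assume "x \<in> {x \<in> Kvec r - {0}. fv.span {x} \<in> (\<lambda>v. fv.span {v}) ` U}"
    then obtain u where x: "x \<in> Kvec r" "x \<noteq> 0" and u: "fv.span {x} = fv.span {u}" "u \<in> U" by blast
    obtain c where "c \<noteq> 0" "u = fscale c x" using span_singleton_eq_iff[OF x(2), of u] u(1) by metis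
    then show "x \<in> (\<Union>c\<in>-{0}. (Kvec r - {0}) \<inter> fscale c -` U)" using x u(2) by auto
  next
    fix x assume "x \<in> (\<Union>c\<in>-{0}. (Kvec r - {0}) \<inter> fscale c -` U)"
    then obtain c where c: "c \<noteq> 0" "x \<in> Kvec r" "x \<noteq> 0" "fscale c x \<in> U" by blast
    then have "fv.span {fscale c x} = fv.span {x}" using span_singleton_eq_iff by blast
    then have "fv.span {x} \<in> (\<lambda>v. fv.span {v}) ` U" using c(4) by (metis imageI)
    then show "x \<in> {x \<in> Kvec r - {0}. fv.span {x} \<in> (\<lambda>v. fv.span {v}) ` U}" using c by blast
  qed
  moreover have "openin (top_of_set (Kvec r - {0})) ((Kvec r - {0}) \<inter> fscale c -` U)" if "c \<in> -{0}" for c :: 'k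
  proof (rule continuous_openin_preimage[OF _ _ U])
    show "continuous_on (Kvec r - {0}) (fscale c)"
      by (intro continuous_on_fscale continuous_on_const continuous_on_id)
    show "fscale c \<in> (Kvec r - {0}) \<rightarrow> Kvec r - {0}"
      using that by (auto intro: fv.subspace_scale[OF subspace_Kvec])
  qed
  ultimately have "openin (top_of_set (Kvec r - {0})) {x \<in> Kvec r - {0}. fv.span {x} \<in> (\<lambda>v. fv.span {v}) ` U}"
    by (simp only:) (rule openin_Union, blast)
  then show "openin (proj_space r) ((\<lambda>v. fv.span {v}) ` U)"
    unfolding proj_space_def openin_quotient_top using sub by auto
qed

lemma topspace_config: "topspace (config_space n m :: 'k::real_normed_field config topology) = lines m ` vec_configs n m"
proof
  show "lines m ` vec_configs n m \<subseteq> topspace (config_space n m :: 'k config topology)"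
    by (auto simp: config_space_def topspace_proj_space lines_def vec_configs_def)
  show "topspace (config_space n m :: 'k config topology) \<subseteq> lines m ` vec_configs n m"
  proof
    fix F :: "'k config" assume F: "F \<in> topspace (config_space n m)"
    have "\<exists>x. x \<in> Kvec n - {0} \<and> F i = fv.span {x}" if "i \<in> {1..m}" for i
      using F that unfolding config_space_def topspace_product_topology topspace_proj_space by (force dest: PiE_mem)
    then obtain v where v: "\<And>i. i \<in> {1..m} \<Longrightarrow> v i \<in> Kvec n - {0} \<and> F i = fv.span {v i}" by metis
    have "F = lines m v"
    proof
      fix i show "F i = lines m v i"
      proof (cases "i \<in> {1..m}")
        case True then show ?thesis using v[OF True] by (simp add: lines_def)
      next
        case False
        have "F \<in> PiE {1..m} (\<lambda>_. topspace (proj_space n))" using F unfolding config_space_def topspace_product_topology by simp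
        from PiE_arb[OF this False] show ?thesis using False unfolding lines_def restrict_def by (simp only: if_False)
      qed
    qed
    moreover have "v \<in> vec_configs n m" using v by (simp add: vec_configs_def)
    ultimately show "F \<in> lines m ` vec_configs n m" by blast
  qed
qed

lemma continuous_on_component: "continuous_on S (\<lambda>v :: nat \<Rightarrow> nat \<Rightarrow> 'k::real_normed_field. v i)"
  by (rule continuous_on_product_then_coordinatewise[OF continuous_on_id])

lemma continuous_map_lines:
  "continuous_map (top_of_set (vec_configs n m)) (config_space n m :: 'k::real_normed_field config topology) (lines m)"
  unfolding config_space_def continuous_map_componentwise
proof (intro conjI ballI)
  show "lines m ` topspace (top_of_set (vec_configs n m :: (nat \<Rightarrow> nat \<Rightarrow> 'k) set)) \<subseteq> extensional {1..m}"
    by (auto simp: lines_def)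
  fix i assume i: "i \<in> {1..m}"
  have "continuous_map (top_of_set (vec_configs n m)) (top_of_set (Kvec n - {0})) (\<lambda>v :: nat \<Rightarrow> nat \<Rightarrow> 'k. v i)"
    using continuous_on_component i by (auto simp: vec_configs_def)
  then have "continuous_map (top_of_set (vec_configs n m)) (proj_space n) ((\<lambda>x. fv.span {x}) \<circ> (\<lambda>v :: nat \<Rightarrow> nat \<Rightarrow> 'k. v i))"
    by (rule continuous_map_compose) (rule quotient_imp_continuous_map[OF quotient_map_proj])
  then show "continuous_map (top_of_set (vec_configs n m)) (proj_space n) (\<lambda>v :: nat \<Rightarrow> nat \<Rightarrow> 'k. lines m v i)"
    using i by (simp add: lines_def o_def)
qed

text \<open>Checked on basic boxes, around whose points the image contains a product of images under
  the open projections to lines.\<close>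

lemma open_map_lines:
  "open_map (top_of_set (vec_configs n m)) (config_space n m :: 'k::real_normed_field config topology) (lines m)"
  unfolding open_map_def
proof (intro allI impI)
  fix U :: "(nat \<Rightarrow> nat \<Rightarrow> 'k) set" assume "openin (top_of_set (vec_configs n m)) U"
  then obtain W where W: "open W" "U = vec_configs n m \<inter> W" by (auto simp: openin_open)
  show "openin (config_space n m) (lines m ` U)"
  proof (subst openin_subopen, rule ballI)
    fix F assume "F \<in> lines m ` U"
    then obtain v where v: "v \<in> vec_configs n m" "v \<in> W" "F = lines m v" using W(2) by blast
    have "openin (product_topology (\<lambda>i. euclidean) UNIV) W" using W(1) by (simp add: open_fun_def)
    from product_topology_open_contains_basis[OF this v(2)]
    obtain X where X: "v \<in> PiE UNIV X" "\<And>i. open (X i)" "PiE UNIV X \<subseteq> W" by auto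
    let ?B = "PiE {1..m} (\<lambda>i. (\<lambda>x. fv.span {x}) ` ((Kvec n - {0}) \<inter> X i))"
    have "openin (config_space n m) ?B"
      unfolding config_space_def
    proof (subst openin_PiE_gen, rule disjI2, intro conjI ballI)
      show "finite {i \<in> {1..m}. (\<lambda>x. fv.span {x}) ` ((Kvec n - {0}) \<inter> X i) \<noteq> topspace (proj_space n)}" by simp
      fix i
      have "openin (top_of_set (Kvec n - {0})) ((Kvec n - {0}) \<inter> X i)"
        using X(2) by (rule openin_open_Int)
      then show "openin (proj_space n) ((\<lambda>x. fv.span {x}) ` ((Kvec n - {0}) \<inter> X i))"
        using open_map_proj unfolding open_map_def by blast
    qed
    moreover have "F \<in> ?B"
      unfolding v(3) lines_def using v(1) X(1) by (auto simp: vec_configs_def)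
    moreover have "?B \<subseteq> lines m ` U"
    proof
      fix G assume G: "G \<in> ?B"
      then have "\<exists>x. x \<in> (Kvec n - {0}) \<inter> X i \<and> G i = fv.span {x}" if "i \<in> {1..m}" for i
        using PiE_mem[OF G that] by blast
      then obtain u where u: "\<And>i. i \<in> {1..m} \<Longrightarrow> u i \<in> (Kvec n - {0}) \<inter> X i \<and> G i = fv.span {u i}" by metis
      \<comment> \<open>Outside \<open>{1..m}\<close> the vectors of \<open>v\<close> are kept, so
        that \<open>?u\<close> stays in the box \<open>X\<close>.\<close>
      let ?u = "\<lambda>i. if i \<in> {1..m} then u i else v i"
      have "?u \<in> vec_configs n m" using u by (auto simp: vec_configs_def)
      moreover have "?u \<in> PiE UNIV X" using u X(1) by (auto simp: PiE_iff)
      moreover have "G = lines m ?u"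
      proof
        fix i show "G i = lines m ?u i"
          using u[of i] PiE_arb[OF G, of i] by (cases "i \<in> {1..m}") (auto simp: lines_def)
      qed
      ultimately show "G \<in> lines m ` U" using X(3) W(2) by blast
    qed
    ultimately show "\<exists>T. openin (config_space n m) T \<and> F \<in> T \<and> T \<subseteq> lines m ` U" by blast
  qed
qed

section \<open>The orbit space as an open quotient of vector configurations\<close>

lemma topspace_orbit_space: "topspace (orbit_space n m :: 'k::real_normed_field config set topology) = vec_orbit n m ` vec_configs n m"
  by (simp add: orbit_space_def topspace_config vec_orbit_def image_image)

lemma continuous_map_diag_orbit: "continuous_map (config_space n m) (orbit_space n m) (diag_orbit n m)"
  unfolding orbit_space_def by (rule quotient_imp_continuous_map[OF quotient_map_quotient_top])

lemma continuous_map_orb: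
  "continuous_map (top_of_set (vec_configs n m)) (orbit_space n m :: 'k::real_normed_field config set topology) (vec_orbit n m)"
  using continuous_map_compose[OF continuous_map_lines continuous_map_diag_orbit]
  by (simp add: vec_orbit_def[abs_def] o_def)

lemma diag_orbit_GL:
  assumes g: "g \<in> GL n" and F: "\<And>i. i \<in> {1..m} \<Longrightarrow> F i \<subseteq> Kvec n" "\<And>i. i \<in> {1..m} \<Longrightarrow> G i = g ` F i"
  shows "diag_orbit n m G = diag_orbit n m F"
proof -
  have gi: "lin_iso g (Kvec n) (Kvec n)" using g by (simp add: GL_def)
  have inv: "lin_iso (inv_into (Kvec n) g) (Kvec n) (Kvec n)" by (rule lin_iso_inv[OF gi subspace_Kvec])
  have gcancel: "inv_into (Kvec n) g ` (g ` F i) = F i" if "i \<in> {1..m}" for i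
    using lin_iso_inj[OF gi] F(1)[OF that] by (rule inv_into_image_cancel)
  show ?thesis
  proof
    show "diag_orbit n m G \<subseteq> diag_orbit n m F"
    proof
      fix X assume "X \<in> diag_orbit n m G"
      then obtain h where h: "h \<in> GL n" "X = (\<lambda>i\<in>{1..m}. h ` G i)" unfolding diag_orbit_def by blast
      have "h \<circ> g \<in> GL n" using lin_iso_comp[OF gi] h(1) by (simp add: GL_def)
      moreover have "X = (\<lambda>i\<in>{1..m}. (h \<circ> g) ` F i)"
        unfolding h(2) image_comp[symmetric] using F(2) by (intro restrict_ext) simp
      ultimately show "X \<in> diag_orbit n m F" unfolding diag_orbit_def by blast
    qed
    show "diag_orbit n m F \<subseteq> diag_orbit n m G"
    proof
      fix X assume "X \<in> diag_orbit n m F"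
      then obtain h where h: "h \<in> GL n" "X = (\<lambda>i\<in>{1..m}. h ` F i)" unfolding diag_orbit_def by blast
      have "h \<circ> inv_into (Kvec n) g \<in> GL n" using lin_iso_comp[OF inv] h(1) by (simp add: GL_def)
      moreover have "X = (\<lambda>i\<in>{1..m}. (h \<circ> inv_into (Kvec n) g) ` G i)"
        unfolding h(2) image_comp[symmetric] using F(2) gcancel by (intro restrict_ext) simp
      ultimately show "X \<in> diag_orbit n m G" unfolding diag_orbit_def by blast
    qed
  qed
qed

text \<open>Besides \<open>GL n\<close> the scalars \<open>c i\<close> act, since a line determines
  its spanning vector only up to a nonzero factor.\<close>

lemma orb_eq_iff:
  fixes u v :: "nat \<Rightarrow> nat \<Rightarrow> 'k::field"
  assumes "u \<in> vec_configs n m" "v \<in> vec_configs n m"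
  shows "vec_orbit n m u = vec_orbit n m v \<longleftrightarrow> (\<exists>g\<in>GL n. \<exists>c. \<forall>i\<in>{1..m}. c i \<noteq> 0 \<and> u i = fscale (c i) (g (v i)))"
proof
  assume e: "vec_orbit n m u = vec_orbit n m v"
  have "lines m u = (\<lambda>i\<in>{1..m}. (\<lambda>x. x) ` lines m u i)" by (simp add: lines_def restrict_def fun_eq_iff)
  then have "lines m u \<in> vec_orbit n m u" unfolding vec_orbit_def diag_orbit_def using id_in_GL by blast
  then have "lines m u \<in> vec_orbit n m v" unfolding e .
  then obtain g where g: "g \<in> GL n" "lines m u = (\<lambda>i\<in>{1..m}. g ` lines m v i)"
    unfolding vec_orbit_def diag_orbit_def by blast
  have "\<exists>c. c \<noteq> 0 \<and> u i = fscale c (g (v i))" if i: "i \<in> {1..m}" for i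
  proof -
    have "fv.span {u i} = g ` fv.span {v i}" using fun_cong[OF g(2), of i] i by (simp add: lines_def)
    then have sp: "fv.span {u i} = fv.span {g (v i)}"
      using lin_iso_GL_span[OF g(1) vecsD(1)[OF assms(2) i]] by simp
    have "g (v i) \<noteq> 0"
    proof
      assume "g (v i) = 0"
      moreover have "u i \<in> fv.span {u i}" by (rule fv.span_base) simp
      ultimately show False using sp vecsD(2)[OF assms(1) i] by simp
    qed
    then show ?thesis using span_singleton_eq_iff sp by blast
  qed
  then show "\<exists>g\<in>GL n. \<exists>c. \<forall>i\<in>{1..m}. c i \<noteq> 0 \<and> u i = fscale (c i) (g (v i))" using g(1) by metis
next
  assume "\<exists>g\<in>GL n. \<exists>c. \<forall>i\<in>{1..m}. c i \<noteq> 0 \<and> u i = fscale (c i) (g (v i))"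
  then obtain g c where g: "g \<in> GL n" and c: "\<And>i. i \<in> {1..m} \<Longrightarrow> c i \<noteq> 0 \<and> u i = fscale (c i) (g (v i))" by blast
  show "vec_orbit n m u = vec_orbit n m v"
    unfolding vec_orbit_def
  proof (rule diag_orbit_GL[OF g])
    fix i assume i: "i \<in> {1..m}"
    show "lines m v i \<subseteq> Kvec n"
      using fv.span_minimal[OF _ subspace_Kvec, of "{v i}" n] vecsD(1)[OF assms(2) i] i by (simp add: lines_def)
    have nz: "g (v i) \<noteq> 0" using c[OF i] vecsD(2)[OF assms(1) i] by auto
    have "fv.span {u i} = fv.span {g (v i)}"
      using span_singleton_eq_iff[OF nz, of "u i"] c[OF i] by blast
    then show "lines m u i = g ` lines m v i"
      using lin_iso_GL_span[OF g vecsD(1)[OF assms(2) i]] i by (simp add: lines_def)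
  qed
qed

text \<open>Openness of a set of orbits can be tested on vectors, because \<open>lines\<close> is
  open and maps \<open>vec_configs n m\<close> onto the configurations.\<close>

lemma openin_orbit_spaceI:
  assumes "W \<subseteq> vec_orbit n m ` vec_configs n m" "openin (top_of_set (vec_configs n m)) {v \<in> vec_configs n m. vec_orbit n m v \<in> W}"
  shows "openin (orbit_space n m :: 'k::real_normed_field config set topology) W"
proof -
  have "{F \<in> topspace (config_space n m). diag_orbit n m F \<in> W} = lines m ` {v \<in> vec_configs n m. vec_orbit n m v \<in> W}"
    unfolding topspace_config vec_orbit_def by blast
  moreover have "openin (config_space n m) (lines m ` {v \<in> vec_configs n m. vec_orbit n m v \<in> W})"
    using open_map_lines assms(2) unfolding open_map_def by blast
  moreover have "W \<subseteq> diag_orbit n m ` topspace (config_space n m)"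
    using assms(1) unfolding topspace_config vec_orbit_def image_image .
  ultimately show ?thesis unfolding orbit_space_def openin_quotient_top by simp
qed

text \<open>The argument of \<open>open_map_proj\<close> with a larger group: the saturation of
  \<open>U\<close> is the union of its preimages under the maps \<open>T g c u\<close>, each of
  which is continuous by itself.\<close>

lemma open_map_orb:
  "open_map (top_of_set (vec_configs n m)) (orbit_space n m :: 'k::real_normed_field config set topology) (vec_orbit n m)"
  unfolding open_map_def
proof (intro allI impI)
  fix U :: "(nat \<Rightarrow> nat \<Rightarrow> 'k) set" assume U: "openin (top_of_set (vec_configs n m)) U"
  have sub: "U \<subseteq> vec_configs n m" using openin_imp_subset[OF U] .
  \<comment> \<open>Beyond \<open>{1..m}\<close> orbits ignore the vectors while \<open>U\<close>
    may constrain them; \<open>T\<close> therefore resets these values to those of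
    \<open>u\<close>.\<close>
  define T :: "((nat \<Rightarrow> 'k) \<Rightarrow> nat \<Rightarrow> 'k) \<Rightarrow> (nat \<Rightarrow> 'k) \<Rightarrow> (nat \<Rightarrow> nat \<Rightarrow> 'k) \<Rightarrow> (nat \<Rightarrow> nat \<Rightarrow> 'k) \<Rightarrow> nat \<Rightarrow> nat \<Rightarrow> 'k"
    where "T g c u v = (\<lambda>i. if i \<in> {1..m} then fscale (c i) (g (v i)) else u i)" for g c u v
  define Ix :: "(((nat \<Rightarrow> 'k) \<Rightarrow> nat \<Rightarrow> 'k) \<times> (nat \<Rightarrow> 'k) \<times> (nat \<Rightarrow> nat \<Rightarrow> 'k)) set"
    where "Ix = {(g, c, u). g \<in> GL n \<and> (\<forall>i\<in>{1..m}. c i \<noteq> 0)}"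
  have T_in: "T g c u v \<in> vec_configs n m \<and> vec_orbit n m (T g c u v) = vec_orbit n m v" if "(g, c, u) \<in> Ix" and v: "v \<in> vec_configs n m" for g c u v
  proof -
    have g: "g \<in> GL n" and c: "\<And>i. i \<in> {1..m} \<Longrightarrow> c i \<noteq> 0" using that by (auto simp: Ix_def)
    have gi: "lin_iso g (Kvec n) (Kvec n)" using g by (simp add: GL_def)
    have 1: "T g c u v \<in> vec_configs n m"
      unfolding vec_configs_def mem_Collect_eq
    proof
      fix i assume i: "i \<in> {1..m}"
      have "g (v i) \<in> Kvec n" using lin_iso_image[OF gi] vecsD(1)[OF v i] by blast
      moreover have "g (v i) \<noteq> 0"
      proof
        assume "g (v i) = 0"
        then have "g (v i) = g 0" using lin_iso_zero[OF gi subspace_Kvec] by simp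
        then show False
          using lin_iso_inj[OF gi] vecsD[OF v i] fv.subspace_0[OF subspace_Kvec] by (meson inj_onD)
      qed
      ultimately show "T g c u v i \<in> Kvec n - {0}"
        using c[OF i] i fv.subspace_scale[OF subspace_Kvec] by (simp add: T_def)
    qed
    moreover have "vec_orbit n m (T g c u v) = vec_orbit n m v"
      unfolding orb_eq_iff[OF 1 v]
      by (rule bexI[OF _ g], rule exI[of _ c]) (use c in \<open>simp add: T_def\<close>)
    ultimately show ?thesis by blast
  qed
  have "{v \<in> vec_configs n m. vec_orbit n m v \<in> vec_orbit n m ` U} = (\<Union>(g, c, u)\<in>Ix. vec_configs n m \<inter> T g c u -` U)"
  proof (intro subset_antisym subsetI)
    fix v assume "v \<in> {v \<in> vec_configs n m. vec_orbit n m v \<in> vec_orbit n m ` U}"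
    then obtain u where v: "v \<in> vec_configs n m" and u: "u \<in> U" "vec_orbit n m u = vec_orbit n m v" by auto
    obtain g c where g: "g \<in> GL n" "\<And>i. i \<in> {1..m} \<Longrightarrow> c i \<noteq> 0 \<and> u i = fscale (c i) (g (v i))"
      using u sub orb_eq_iff[of u n m v] v by blast
    have "T g c u v = u" using g(2) by (auto simp: T_def)
    moreover have "(g, c, u) \<in> Ix" using g by (auto simp: Ix_def)
    ultimately show "v \<in> (\<Union>(g, c, u)\<in>Ix. vec_configs n m \<inter> T g c u -` U)" using v u by blast
  next
    fix v assume "v \<in> (\<Union>(g, c, u)\<in>Ix. vec_configs n m \<inter> T g c u -` U)"
    then obtain g c u where "(g, c, u) \<in> Ix" "v \<in> vec_configs n m" "T g c u v \<in> U" by blast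
    then show "v \<in> {v \<in> vec_configs n m. vec_orbit n m v \<in> vec_orbit n m ` U}" using T_in by (metis (mono_tags, lifting) imageI mem_Collect_eq)
  qed
  moreover have "openin (top_of_set (vec_configs n m)) (vec_configs n m \<inter> T g c u -` U)" if i: "(g, c, u) \<in> Ix" for g c u
  proof (rule continuous_openin_preimage[OF _ _ U])
    show "T g c u \<in> vec_configs n m \<rightarrow> vec_configs n m" using T_in[OF i] by blast
    show "continuous_on (vec_configs n m) (T g c u)"
    proof (rule continuous_on_coordinatewise_then_product)
      fix i
      show "continuous_on (vec_configs n m) (\<lambda>v. T g c u v i)"
      proof (cases "i \<in> {1..m}")
        case True
        have "continuous_on (Kvec n) g" using that by (intro continuous_on_lin_iso) (auto simp: Ix_def GL_def)
        then have "continuous_on (vec_configs n m) (\<lambda>v. g (v i))"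
          by (rule continuous_on_compose2[OF _ continuous_on_component]) (use True vecsD in auto)
        then show ?thesis using True by (simp add: T_def continuous_on_fscale)
      next
        case False then show ?thesis by (simp only: T_def if_False continuous_on_const)
      qed
    qed
  qed
  ultimately have "openin (top_of_set (vec_configs n m)) {v \<in> vec_configs n m. vec_orbit n m v \<in> vec_orbit n m ` U}"
    by (simp only:) (rule openin_Union, auto)
  then show "openin (orbit_space n m) (vec_orbit n m ` U)"
    by (rule openin_orbit_spaceI[rotated]) (use sub in blast)
qed


section \<open>Perturbation of independent families\<close>

text \<open>Coefficients with respect to an independent family are controlled near a given family by
  a dual family of functionals, with coordinates \<open>a\<close>.\<close>

lemma ex_dual_family:
  fixes V :: "'b \<Rightarrow> nat \<Rightarrow> 'k::field"
  assumes A: "finite A" "indep_fam V A" and K: "\<And>k. k \<in> A \<Longrightarrow> V k \<in> Kvec n"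
  shows "\<exists>a :: 'b \<Rightarrow> nat \<Rightarrow> 'k. \<forall>i\<in>A. \<forall>k\<in>A. (\<Sum>h\<in>{1..n}. V k h * a i h) = (if i = k then 1 else 0)"
proof -
  interpret P: vector_space_pair "fscale :: 'k \<Rightarrow> (nat \<Rightarrow> 'k) \<Rightarrow> _" "fscale :: 'k \<Rightarrow> ('b \<Rightarrow> 'k) \<Rightarrow> _" ..
  have ind: "inj_on V A" "fv.independent (V ` A)" using indep_fam_imp_independent[OF A] by auto
  define d :: "(nat \<Rightarrow> 'k) \<Rightarrow> 'b \<Rightarrow> 'k" where "d x = (\<lambda>i. if i = inv_into A V x then 1 else 0)" for x
  obtain g where g: "Vector_Spaces.linear fscale fscale g" "\<forall>x\<in>V ` A. g x = d x"
    using P.linear_independent_extend[OF ind(2), of d] by blast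
  have "(\<Sum>h\<in>{1..n}. V k h * g (unit_vec h) i) = (if i = k then 1 else 0)" if "i \<in> A" "k \<in> A" for i k
  proof -
    have "(\<Sum>h\<in>{1..n}. V k h * g (unit_vec h) i) = (\<Sum>h\<in>{1..n}. g (fscale (V k h) (unit_vec h))) i"
      by (simp add: sum_fun_apply P.linear_scale[OF g(1)] fscale_def[of _ "g _"])
    also have "\<dots> = g (\<Sum>h\<in>{1..n}. fscale (V k h) (unit_vec h)) i"
      by (simp add: P.linear_sum[OF g(1)])
    also have "\<dots> = g (V k) i" using Kvec_expand[OF K[OF that(2)]] by simp
    also have "\<dots> = (if i = k then 1 else 0)" using g(2) that(2) ind(1) by (simp add: d_def)
    finally show ?thesis .
  qed
  then show ?thesis by (intro exI[of _ "\<lambda>i h. g (unit_vec h) i"]) blast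
qed

text \<open>Distance from the identity, in the sum norm, of the matrix of values of the functionals
  \<open>a i\<close> on the vectors \<open>V k\<close>. It vanishes exactly when the functionals are
  dual to the family.\<close>

definition gram_error :: "nat \<Rightarrow> 'b set \<Rightarrow> ('b \<Rightarrow> nat \<Rightarrow> 'k) \<Rightarrow> ('b \<Rightarrow> nat \<Rightarrow> 'k::real_normed_field) \<Rightarrow> real" where
  "gram_error n A a V = (\<Sum>i\<in>A. \<Sum>k\<in>A. norm ((\<Sum>h\<in>{1..n}. V k h * a i h) - (if i = k then 1 else 0)))"

text \<open>The functional with coordinates \<open>a i\<close>, applied to \<open>w\<close>, returns
  \<open>c i\<close> up to the error matrix \<open>M\<close> applied to \<open>c\<close>.\<close>

lemma coeff_error_bound:
  fixes V :: "'b \<Rightarrow> nat \<Rightarrow> 'k::real_normed_field"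
  assumes A: "finite A" and w: "w = (\<Sum>k\<in>A. fscale (c k) (V k))"
  shows "(\<Sum>i\<in>A. norm (c i - (\<Sum>h\<in>{1..n}. w h * a i h))) \<le> (\<Sum>k\<in>A. norm (c k)) * gram_error n A a V"
proof -
  define M where "M i k = (\<Sum>h\<in>{1..n}. V k h * a i h) - (if i = k then 1 else 0)" for i k
  have e: "c i - (\<Sum>h\<in>{1..n}. w h * a i h) = - (\<Sum>k\<in>A. c k * M i k)" if i: "i \<in> A" for i
  proof -
    have "(\<Sum>h\<in>{1..n}. w h * a i h) = (\<Sum>h\<in>{1..n}. \<Sum>k\<in>A. c k * (V k h * a i h))"
      unfolding w by (simp add: sum_fun_apply fscale_def sum_distrib_right mult.assoc)
    also have "\<dots> = (\<Sum>k\<in>A. c k * (\<Sum>h\<in>{1..n}. V k h * a i h))"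
      by (subst sum.swap) (simp add: sum_distrib_left)
    also have "\<dots> = (\<Sum>k\<in>A. c k * M i k + (if i = k then c k else 0))"
      by (intro sum.cong) (auto simp: M_def algebra_simps)
    also have "\<dots> = (\<Sum>k\<in>A. c k * M i k) + c i" using A i by (simp add: sum.distrib)
    finally show ?thesis by simp
  qed
  have "(\<Sum>i\<in>A. norm (c i - (\<Sum>h\<in>{1..n}. w h * a i h))) \<le> (\<Sum>i\<in>A. \<Sum>k\<in>A. norm (c k) * norm (M i k))"
  proof (rule sum_mono)
    fix i assume "i \<in> A"
    show "norm (c i - (\<Sum>h\<in>{1..n}. w h * a i h)) \<le> (\<Sum>k\<in>A. norm (c k) * norm (M i k))"
      unfolding e[OF \<open>i \<in> A\<close>] norm_minus_cancel norm_mult[symmetric] by (rule norm_sum)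
  qed
  also have "\<dots> \<le> (\<Sum>i\<in>A. \<Sum>k\<in>A. (\<Sum>k\<in>A. norm (c k)) * norm (M i k))"
    using A by (intro sum_mono mult_right_mono) (auto intro: member_le_sum)
  also have "\<dots> = (\<Sum>k\<in>A. norm (c k)) * gram_error n A a V"
    by (simp add: gram_error_def M_def sum_distrib_left)
  finally show ?thesis .
qed

text \<open>An error of at most 1/2 lets half of the left-hand side be absorbed; hence the factor
  2.\<close>

lemma coeff_norm_bound:
  fixes V :: "'b \<Rightarrow> nat \<Rightarrow> 'k::real_normed_field"
  assumes A: "finite A" and w: "w = (\<Sum>k\<in>A. fscale (c k) (V k))" and e: "gram_error n A a V \<le> 1/2"
  shows "(\<Sum>k\<in>A. norm (c k)) \<le> 2 * (\<Sum>i\<in>A. norm (\<Sum>h\<in>{1..n}. w h * a i h))"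
proof -
  let ?\<omega> = "\<lambda>i. \<Sum>h\<in>{1..n}. w h * a i h"
  have "(\<Sum>k\<in>A. norm (c k)) \<le> (\<Sum>i\<in>A. norm (c i - ?\<omega> i) + norm (?\<omega> i))"
    by (rule sum_mono) (metis diff_add_cancel norm_triangle_ineq)
  also have "\<dots> = (\<Sum>i\<in>A. norm (c i - ?\<omega> i)) + (\<Sum>i\<in>A. norm (?\<omega> i))" by (rule sum.distrib)
  also have "(\<Sum>i\<in>A. norm (c i - ?\<omega> i)) \<le> (\<Sum>k\<in>A. norm (c k)) * gram_error n A a V"
    by (rule coeff_error_bound[OF A w])
  also have "\<dots> \<le> (\<Sum>k\<in>A. norm (c k)) * (1/2)" by (rule mult_left_mono[OF e]) (simp add: sum_nonneg)
  finally show ?thesis by simp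
qed

lemma continuous_on_gram_error:
  fixes V :: "'a::topological_space \<Rightarrow> 'b \<Rightarrow> nat \<Rightarrow> 'k::real_normed_field"
  assumes "\<And>k. k \<in> A \<Longrightarrow> continuous_on S (\<lambda>x. V x k)"
  shows "continuous_on S (\<lambda>x. gram_error n A a (V x))"
  unfolding gram_error_def
  by (intro continuous_on_sum continuous_on_norm continuous_on_diff continuous_on_const continuous_on_mult
      continuous_on_product_then_coordinatewise[OF assms])

text \<open>The dual functionals of \<open>v0\<close> are kept fixed. An error below 1/2 is an open
  condition, and a linear relation is the case \<open>w = 0\<close> of the norm bound, which forces
  its coefficients to vanish.\<close>

lemma indep_fam_open:
  fixes v0 :: "nat \<Rightarrow> nat \<Rightarrow> 'k::real_normed_field"
  assumes A: "finite A" "indep_fam v0 A" "\<And>k. k \<in> A \<Longrightarrow> v0 k \<in> Kvec n"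
  shows "\<exists>T. open T \<and> v0 \<in> T \<and> (\<forall>v\<in>T. indep_fam v A)"
proof -
  obtain a :: "nat \<Rightarrow> nat \<Rightarrow> 'k" where a: "\<forall>i\<in>A. \<forall>k\<in>A. (\<Sum>h\<in>{1..n}. v0 k h * a i h) = (if i = k then 1 else 0)"
    using ex_dual_family[OF A] by blast
  let ?T = "{v. gram_error n A a v < 1/2}"
  have "continuous_on UNIV (\<lambda>v. gram_error n A a v)"
    by (rule continuous_on_gram_error) (rule continuous_on_component)
  then have "open ?T" by (intro open_Collect_less continuous_on_const)
  moreover have "v0 \<in> ?T" using a by (simp add: gram_error_def)
  moreover have "indep_fam v A" if "v \<in> ?T" for v
    unfolding indep_fam_def
  proof (intro allI impI ballI)
    fix c i assume c: "(\<Sum>i\<in>A. fscale (c i) (v i)) = 0" and i: "i \<in> A"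
    have "(\<Sum>k\<in>A. norm (c k)) \<le> 0"
      using coeff_norm_bound[OF A(1) c[symmetric], of n a] that by simp
    moreover have "norm (c i) \<le> (\<Sum>k\<in>A. norm (c k))" by (rule member_le_sum[OF i]) (use A(1) in auto)
    ultimately have "norm (c i) \<le> 0" by linarith
    then show "c i = 0" by simp
  qed
  ultimately show ?thesis by blast
qed

text \<open>Near \<open>x0\<close> the coefficient differs from \<open>\<omega> j\<close>, a
  continuous function built from functionals fixed at \<open>x0\<close>, by at most a bounded factor
  times \<open>E\<close>, which tends to 0. This replaces Cramer's rule.\<close>

lemma continuous_on_coeffs:
  fixes V :: "'a::topological_space \<Rightarrow> 'b \<Rightarrow> nat \<Rightarrow> 'k::real_normed_field"
  assumes A: "finite A" and V: "\<And>k. k \<in> A \<Longrightarrow> continuous_on S (\<lambda>x. V x k)"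
    and K: "\<And>x k. x \<in> S \<Longrightarrow> k \<in> A \<Longrightarrow> V x k \<in> Kvec n" and ind: "\<And>x. x \<in> S \<Longrightarrow> indep_fam (V x) A"
    and W: "continuous_on S W" and c: "\<And>x. x \<in> S \<Longrightarrow> W x = (\<Sum>k\<in>A. fscale (c x k) (V x k))"
    and j: "j \<in> A"
  shows "continuous_on S (\<lambda>x. c x j)"
  unfolding continuous_on_def
proof
  fix x0 assume x0: "x0 \<in> S"
  let ?F = "at x0 within S"
  obtain a :: "'b \<Rightarrow> nat \<Rightarrow> 'k" where a: "\<forall>i\<in>A. \<forall>k\<in>A. (\<Sum>h\<in>{1..n}. V x0 k h * a i h) = (if i = k then 1 else 0)"
    using ex_dual_family[OF A ind[OF x0] K[OF x0]] by blast
  define E where "E x = gram_error n A a (V x)" for x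
  define \<omega> where "\<omega> i x = (\<Sum>h\<in>{1..n}. W x h * a i h)" for i x
  have E0: "E x0 = 0" using a by (simp add: E_def gram_error_def)
  have "continuous_on S E" unfolding E_def by (rule continuous_on_gram_error[OF V])
  then have Elim: "(E \<longlongrightarrow> 0) ?F" using x0 E0 unfolding continuous_on_def by metis
  have "continuous_on S (\<omega> i)" for i
    unfolding \<omega>_def by (intro continuous_on_sum continuous_on_mult continuous_on_const
        continuous_on_product_then_coordinatewise[OF W])
  then have \<omega>lim: "(\<omega> i \<longlongrightarrow> \<omega> i x0) ?F" for i using x0 unfolding continuous_on_def by metis
  have evS: "eventually (\<lambda>x. x \<in> S) ?F" by (simp add: eventually_at_filter)
  have evE: "eventually (\<lambda>x. E x < 1/2) ?F" using order_tendstoD(2)[OF Elim, of "1/2"] by simp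
  have bound: "norm (c x j - \<omega> j x) \<le> 2 * (\<Sum>i\<in>A. norm (\<omega> i x)) * E x" if x: "x \<in> S" "E x < 1/2" for x
  proof -
    have "norm (c x j - \<omega> j x) \<le> (\<Sum>i\<in>A. norm (c x i - \<omega> i x))"
      using member_le_sum[OF j, of "\<lambda>i. norm (c x i - \<omega> i x)"] A by simp
    also have "\<dots> \<le> (\<Sum>k\<in>A. norm (c x k)) * E x"
      unfolding \<omega>_def E_def by (rule coeff_error_bound[OF A c[OF x(1)]])
    also have "\<dots> \<le> 2 * (\<Sum>i\<in>A. norm (\<omega> i x)) * E x"
    proof (rule mult_right_mono)
      show "(\<Sum>k\<in>A. norm (c x k)) \<le> 2 * (\<Sum>i\<in>A. norm (\<omega> i x))"
        unfolding \<omega>_def using x(2) by (intro coeff_norm_bound[OF A c[OF x(1)]]) (simp add: E_def)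
      show "0 \<le> E x" by (simp add: E_def gram_error_def sum_nonneg)
    qed
    finally show ?thesis .
  qed
  have "((\<lambda>x. c x j - \<omega> j x) \<longlongrightarrow> 0) ?F"
  proof (rule Lim_null_comparison)
    show "eventually (\<lambda>x. norm (c x j - \<omega> j x) \<le> 2 * (\<Sum>i\<in>A. norm (\<omega> i x)) * E x) ?F"
      using evS evE by eventually_elim (rule bound)
    have "((\<lambda>x. 2 * (\<Sum>i\<in>A. norm (\<omega> i x)) * E x) \<longlongrightarrow> 2 * (\<Sum>i\<in>A. norm (\<omega> i x0)) * 0) ?F"
      by (intro tendsto_mult tendsto_const tendsto_sum tendsto_norm \<omega>lim Elim)
    then show "((\<lambda>x. 2 * (\<Sum>i\<in>A. norm (\<omega> i x)) * E x) \<longlongrightarrow> 0) ?F" by simp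
  qed
  from tendsto_add[OF this \<omega>lim[of j]] have "((\<lambda>x. c x j) \<longlongrightarrow> \<omega> j x0) ?F" by simp
  \<comment> \<open>\<open>E x0 = 0\<close>, so the limit just found is the value at
    \<open>x0\<close>.\<close>
  moreover have "\<omega> j x0 = c x0 j"
  proof -
    have "norm (c x0 j - \<omega> j x0) \<le> 0" using bound[OF x0] E0 by simp
    then show ?thesis by simp
  qed
  ultimately show "((\<lambda>x. c x j) \<longlongrightarrow> c x0 j) ?F" by simp
qed

text \<open>The eigenvectors are indexed by their eigenvalues, which are thus distinct. Subtracting
  \<open>s\<close> times a relation from its image under the matrix removes the term of
  \<open>s\<close>.\<close>

lemma eigenvectors_indep:
  fixes b :: "nat \<Rightarrow> nat \<Rightarrow> 'k::field" and x :: "'k \<Rightarrow> nat \<Rightarrow> 'k"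
  assumes "finite F" "\<And>t. t \<in> F \<Longrightarrow> x t \<noteq> 0" "\<And>t j. t \<in> F \<Longrightarrow> (\<Sum>i\<in>A. x t i * b i j) = t * x t j"
  shows "indep_fam x F"
  using assms
proof (induction F)
  case (insert s F)
  show ?case
    unfolding indep_fam_def
  proof (intro allI impI)
    fix d assume d: "(\<Sum>t\<in>insert s F. fscale (d t) (x t)) = 0"
    then have d1: "d s * x s j + (\<Sum>t\<in>F. d t * x t j) = 0" for j
    proof -
      have "(\<Sum>t\<in>insert s F. fscale (d t) (x t)) j = 0" unfolding d by simp
      then show ?thesis unfolding sum_fun_apply fscale_def using insert.hyps by simp
    qed
    have d2: "d s * (s * x s j) + (\<Sum>t\<in>F. d t * (t * x t j)) = 0" for j
    proof -
      have "d s * (s * x s j) + (\<Sum>t\<in>F. d t * (t * x t j))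
         = d s * (\<Sum>i\<in>A. x s i * b i j) + (\<Sum>t\<in>F. d t * (\<Sum>i\<in>A. x t i * b i j))"
        using insert.prems(2) by simp
      also have "\<dots> = (\<Sum>i\<in>A. d s * x s i * b i j) + (\<Sum>i\<in>A. \<Sum>t\<in>F. d t * x t i * b i j)"
        by (simp add: sum_distrib_left mult.assoc sum.swap[of _ F A])
      also have "\<dots> = (\<Sum>i\<in>A. (d s * x s i + (\<Sum>t\<in>F. d t * x t i)) * b i j)"
        by (simp add: sum.distrib[symmetric] distrib_right sum_distrib_right)
      also have "\<dots> = 0" unfolding d1 by simp
      finally show ?thesis .
    qed
    have zero: "(\<Sum>t\<in>F. fscale (d t * (t - s)) (x t)) = 0"
    proof
      fix j
      have "(\<Sum>t\<in>F. fscale (d t * (t - s)) (x t)) j = (\<Sum>t\<in>F. d t * (t * x t j)) - s * (\<Sum>t\<in>F. d t * x t j)"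
        by (simp add: sum_fun_apply fscale_def sum_distrib_left sum_subtractf[symmetric] algebra_simps)
      also have "\<dots> = - (d s * (s * x s j)) - s * (- (d s * x s j))"
        using d1[of j] d2[of j] by (simp add: add_eq_0_iff)
      finally show "(\<Sum>t\<in>F. fscale (d t * (t - s)) (x t)) j = 0 j" by simp
    qed
    have "indep_fam x F" using insert by blast
    then have "d t * (t - s) = 0" if "t \<in> F" for t
      using that zero unfolding indep_fam_def by (elim allE[of _ "\<lambda>t. d t * (t - s)"]) blast
    then have dF: "d t = 0" if "t \<in> F" for t using that insert.hyps(2) by fastforce
    then have "d s * x s j = 0" for j using d1[of j] by simp
    moreover obtain j where "x s j \<noteq> 0" using insert.prems(1)[of s] by (auto simp: fun_eq_iff)
    ultimately have "d s = 0" by (metis mult_eq_0_iff)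
    then show "\<forall>t\<in>insert s F. d t = 0" using dF by blast
  qed
qed (simp add: indep_fam_def)

text \<open>Dependence of \<open>v i + t u i\<close> means that \<open>-t\<close> is an eigenvalue of the endomorphism with
  \<open>u i \<mapsto> v i\<close>.\<close>

lemma finite_dependent_shifts:
  fixes u v :: "nat \<Rightarrow> 'i \<Rightarrow> 'k::field"
  assumes A: "finite A" and u: "indep_fam u A" and v: "\<And>i. i \<in> A \<Longrightarrow> v i \<in> fv.span (u ` A)"
  shows "finite {t. \<not> indep_fam (\<lambda>i. v i + fscale t (u i)) A}"
proof (rule ccontr)
  assume inf: "infinite {t. \<not> indep_fam (\<lambda>i. v i + fscale t (u i)) A}"
  define Bad where "Bad = {t. \<not> indep_fam (\<lambda>i. v i + fscale t (u i)) A}"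
  have "\<exists>b. v i = (\<Sum>j\<in>A. fscale (b j) (u j))" if "i \<in> A" for i
    using v[OF that] span_fam_iff[OF A] by metis
  then obtain b where b: "\<And>i. i \<in> A \<Longrightarrow> v i = (\<Sum>j\<in>A. fscale (b i j) (u j))" by metis
  \<comment> \<open>The sign makes \<open>t\<close> itself the eigenvalue; the extension by zero
    makes the eigenvector equation hold in the coordinates outside \<open>A\<close> as well.\<close>
  let ?b = "\<lambda>i j. if j \<in> A then - b i j else 0"
  have "\<exists>x. x \<noteq> 0 \<and> (\<forall>i. i \<notin> A \<longrightarrow> x i = 0) \<and> (\<forall>j. (\<Sum>i\<in>A. x i * ?b i j) = t * x j)" if tB: "t \<in> Bad" for t
  proof -
    obtain c i0 where c: "(\<Sum>i\<in>A. fscale (c i) (v i + fscale t (u i))) = 0" "i0 \<in> A" "c i0 \<noteq> 0"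
      using tB unfolding Bad_def indep_fam_def by blast
    have "(\<Sum>j\<in>A. fscale ((\<Sum>i\<in>A. c i * b i j) + t * c j) (u j))
        = (\<Sum>j\<in>A. \<Sum>i\<in>A. fscale (c i) (fscale (b i j) (u j))) + (\<Sum>j\<in>A. fscale (c j) (fscale t (u j)))"
      by (simp add: fv.scale_left_distrib sum.distrib fv.scale_sum_left mult.commute)
    also have "\<dots> = (\<Sum>i\<in>A. fscale (c i) (v i)) + (\<Sum>j\<in>A. fscale (c j) (fscale t (u j)))"
      by (subst sum.swap) (simp only: b fv.scale_sum_right cong: sum.cong)
    also have "\<dots> = (\<Sum>i\<in>A. fscale (c i) (v i + fscale t (u i)))"
      by (simp only: fv.scale_right_distrib sum.distrib)
    also have "\<dots> = 0" by (rule c(1))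
    finally have zero: "(\<Sum>j\<in>A. fscale ((\<Sum>i\<in>A. c i * b i j) + t * c j) (u j)) = 0" .
    have z: "(\<Sum>i\<in>A. c i * b i j) + t * c j = 0" if "j \<in> A" for j
      using u[unfolded indep_fam_def, rule_format, OF zero that] .
    let ?x = "\<lambda>i. if i \<in> A then c i else 0"
    have "(\<Sum>i\<in>A. ?x i * ?b i j) = t * ?x j" for j
    proof (cases "j \<in> A")
      case True
      then have "(\<Sum>i\<in>A. ?x i * ?b i j) = - (\<Sum>i\<in>A. c i * b i j)" by (simp add: sum_negf[symmetric])
      then show ?thesis using z[OF True] True by (simp add: add_eq_0_iff)
    qed simp
    moreover have "?x \<noteq> 0" using c(2,3) by (auto simp: fun_eq_iff)
    ultimately show ?thesis by (intro exI[of _ ?x]) auto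
  qed
  then have "\<forall>t\<in>Bad. \<exists>x. x \<noteq> 0 \<and> (\<forall>i. i \<notin> A \<longrightarrow> x i = 0) \<and> (\<forall>j. (\<Sum>i\<in>A. x i * ?b i j) = t * x j)" by blast
  from bchoice[OF this] obtain x where
    x': "\<forall>t\<in>Bad. x t \<noteq> 0 \<and> (\<forall>i. i \<notin> A \<longrightarrow> x t i = 0) \<and> (\<forall>j. (\<Sum>i\<in>A. x t i * ?b i j) = t * x t j)" ..
  have x: "x t \<noteq> 0" "i \<notin> A \<Longrightarrow> x t i = 0" "(\<Sum>i\<in>A. x t i * ?b i j) = t * x t j" if "t \<in> Bad" for t i j
    using bspec[OF x' that] by (elim conjE, blast)+
  \<comment> \<open>\<open>card A + 1\<close> eigenvectors would be independent in a space of
    dimension at most \<open>card A\<close>.\<close>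
  obtain F where F: "finite F" "card F = Suc (card A)" "F \<subseteq> Bad"
    using infinite_arbitrarily_large[of Bad "Suc (card A)"] inf unfolding Bad_def by blast
  have "indep_fam x F" 
    by (rule eigenvectors_indep[OF F(1) x(1) x(3)]) (use F(3) in blast)+
  then have "fv.dim (x ` F) = card F" using indep_fam_iff_dim[OF F(1)] by blast
  moreover have "x ` F \<subseteq> fv.span (unit_vec ` A)"
  proof safe
    fix t assume "t \<in> F"
    then have "t \<in> Bad" using F(3) by blast
    then have "x t = (\<Sum>h\<in>A. fscale (x t h) (unit_vec h))"
      using x(2)[of t] by (auto simp: sum_unit_vec[OF A] fun_eq_iff)
    then show "x t \<in> fv.span (unit_vec ` A)" unfolding span_fam_iff[OF A] by blast
  qed
  then have "fv.dim (x ` F) \<le> fv.dim (unit_vec ` A :: (nat \<Rightarrow> 'k) set)" using A by (intro dim_mono_span) auto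
  moreover have "fv.dim (unit_vec ` A :: (nat \<Rightarrow> 'k) set) \<le> card A"
    using fv.dim_le_card'[of "unit_vec ` A"] card_image_le[OF A, of "unit_vec :: nat \<Rightarrow> nat \<Rightarrow> 'k"] A
    by (meson finite_imageI order_trans)
  ultimately show False using F(2) by simp
qed


section \<open>Circuits and projective frames\<close>

lemma pos_bij:
  assumes "finite K"
  shows "bij_betw (pos K) K {1..card K}"
proof -
  have less: "pos K i < pos K j" if "i \<in> K" "j \<in> K" "i < j" for i j
  proof -
    have "{k \<in> K. k \<le> i} \<subseteq> {k \<in> K. k \<le> j}" using that(3) by auto
    moreover have "j \<in> {k \<in> K. k \<le> j}" "j \<notin> {k \<in> K. k \<le> i}" using that by auto
    ultimately have "{k \<in> K. k \<le> i} \<subset> {k \<in> K. k \<le> j}" by blast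
    then show ?thesis unfolding pos_def by (rule psubset_card_mono[rotated]) (simp add: assms)
  qed
  have inj: "inj_on (pos K) K"
  proof (rule inj_onI, rule ccontr)
    fix i j assume ij: "i \<in> K" "j \<in> K" "pos K i = pos K j" "i \<noteq> j"
    then show False using less[of i j] less[of j i] by (cases "i < j") auto
  qed
  have "pos K i \<in> {1..card K}" if "i \<in> K" for i
  proof -
    have "{k \<in> K. k \<le> i} \<noteq> {}" using that by blast
    moreover have "finite {k \<in> K. k \<le> i}" using assms by simp
    ultimately have "card {k \<in> K. k \<le> i} > 0" unfolding card_gt_0_iff by blast
    moreover have "card {k \<in> K. k \<le> i} \<le> card K" by (rule card_mono[OF assms]) auto
    ultimately show ?thesis by (simp add: pos_def)
  qed
  then have "pos K ` K \<subseteq> {1..card K}" by blast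
  moreover have "card (pos K ` K) = card {1..card K}" using card_image[OF inj] by simp
  ultimately have "pos K ` K = {1..card K}" by (intro card_subset_eq) simp_all
  then show ?thesis using inj unfolding bij_betw_def by blast
qed

definition el :: "nat set \<Rightarrow> nat \<Rightarrow> nat" where
  "el K = inv_into K (pos K)"

lemma el_in: "finite K \<Longrightarrow> j \<in> {1..card K} \<Longrightarrow> el K j \<in> K"
  unfolding el_def by (rule bspec[OF bij_betwE[OF bij_betw_inv_into[OF pos_bij]]])

lemma pos_el: "finite K \<Longrightarrow> j \<in> {1..card K} \<Longrightarrow> pos K (el K j) = j"
  unfolding el_def by (rule bij_betw_inv_into_right[OF pos_bij])

lemma el_pos: "finite K \<Longrightarrow> k \<in> K \<Longrightarrow> el K (pos K k) = k"
  unfolding el_def by (rule bij_betw_inv_into_left[OF pos_bij])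

lemma pos_in: "finite K \<Longrightarrow> k \<in> K \<Longrightarrow> pos K k \<in> {1..card K}"
  by (rule bspec[OF bij_betwE[OF pos_bij]])

definition head :: "nat set \<Rightarrow> nat \<Rightarrow> nat set" where
  "head K r = {k \<in> K. pos K k \<le> r + 1}"

text \<open>Together with \<open>rk v K = r\<close> this says that the first \<open>r + 1\<close>
  vectors of \<open>K\<close> form a circuit: any \<open>r\<close> of them are a basis of the span
  of the block.\<close>

definition circuit :: "(nat \<Rightarrow> 'i \<Rightarrow> 'k::field) \<Rightarrow> nat set \<Rightarrow> nat \<Rightarrow> bool" where
  "circuit v K r \<longleftrightarrow> (\<forall>i\<in>head K r. rk v (head K r - {i}) = r)"

lemma head_subset: "head K r \<subseteq> K"
  by (auto simp: head_def)

lemma finite_head: "finite K \<Longrightarrow> finite (head K r)"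
  using head_subset finite_subset by blast

lemma pos_head_minus:
  assumes "finite K" "r + 1 \<le> card K" "i \<in> K"
  shows "pos K ` (head K r - {i}) = {1..r + 1} - {pos K i}"
proof
  show "pos K ` (head K r - {i}) \<subseteq> {1..r + 1} - {pos K i}"
  proof safe
    fix k assume k: "k \<in> head K r" "k \<noteq> i"
    then have kK: "k \<in> K" "pos K k \<le> r + 1" by (auto simp: head_def)
    show "pos K k \<in> {1..r + 1}" using pos_in[OF assms(1) kK(1)] kK(2) by simp
    assume "pos K k = pos K i"
    then show False using el_pos[OF assms(1) kK(1)] el_pos[OF assms(1,3)] k(2) by simp
  qed
  show "{1..r + 1} - {pos K i} \<subseteq> pos K ` (head K r - {i})"
  proof
    fix j assume j: "j \<in> {1..r + 1} - {pos K i}"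
    then have jc: "j \<in> {1..card K}" using assms(2) by auto
    have "el K j \<in> head K r - {i}"
      using el_in[OF assms(1) jc] pos_el[OF assms(1) jc] j by (auto simp: head_def)
    then show "j \<in> pos K ` (head K r - {i})" using pos_el[OF assms(1) jc] by (metis imageI)
  qed
qed

lemma el_image_head:
  assumes "finite K" "r + 1 \<le> card K"
  shows "el K ` {1..r + 1} = head K r"
proof
  show "el K ` {1..r + 1} \<subseteq> head K r"
  proof safe
    fix j assume "j \<in> {1..r + 1}"
    then have "j \<in> {1..card K}" "j \<le> r + 1" using assms(2) by auto
    then show "el K j \<in> head K r" using el_in[OF assms(1)] pos_el[OF assms(1)] by (simp add: head_def)
  qed
  show "head K r \<subseteq> el K ` {1..r + 1}"
  proof
    fix k assume k: "k \<in> head K r"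
    then have "k \<in> K" "pos K k \<le> r + 1" by (auto simp: head_def)
    then have "pos K k \<in> {1..r + 1}" "k = el K (pos K k)"
      using pos_in[OF assms(1)] el_pos[OF assms(1)] by auto
    then show "k \<in> el K ` {1..r + 1}" by blast
  qed
qed

lemma el_inj:
  assumes "finite K" "j \<in> {1..card K}" "l \<in> {1..card K}" "el K j = el K l" shows "j = l"
proof -
  have "pos K (el K j) = pos K (el K l)" unfolding assms(4) ..
  then show ?thesis unfolding pos_el[OF assms(1,2)] pos_el[OF assms(1,3)] .
qed

lemma card_head:
  assumes "finite K" "r + 1 \<le> card K"
  shows "card (head K r) = r + 1"
proof -
  have "inj_on (el K) {1..r + 1}"
    by (rule inj_onI, rule el_inj[OF assms(1)]) (use assms(2) in auto)
  then show ?thesis using card_image el_image_head[OF assms] by fastforce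
qed

text \<open>Let \<open>A\<close> be a separator. If one side contains \<open>H\<close>, it has full
  rank, while the other has rank at least 1 because its vectors are nonzero. Otherwise
  \<open>H\<close> meets both sides in proper, hence independent, subsets, and the ranks add up to
  at least \<open>r + 1\<close>.\<close>

lemma circuit_connected:
  assumes fin: "finite K" and H: "H \<subseteq> K" "card H = r + 1" and c: "\<And>i. i \<in> H \<Longrightarrow> rk v (H - {i}) = r"
    and rk: "rk v K = r" and nz: "\<And>i. i \<in> K \<Longrightarrow> v i \<noteq> 0"
  shows "connected_fam v K"
  unfolding connected_fam_def
proof (intro allI impI notI)
  fix A assume A: "A \<noteq> {}" "A \<subset> K" and eq: "rk v A + rk v (K - A) = rk v K"
  have finH: "finite H" using H(1) fin finite_subset by blast
  have finA: "finite A" using A(2) fin finite_subset by blast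
  have pos1: "rk v B \<ge> 1" if B: "B \<noteq> {}" "B \<subseteq> K" for B
  proof -
    obtain i where i: "i \<in> B" using B(1) by blast
    then have "rk v {i} = 1" using nz B(2) dim_singleton[of "v i"] by (auto simp: rk_def)
    moreover have "rk v {i} \<le> rk v B" using i B(2) fin finite_subset by (intro rk_mono) auto
    ultimately show ?thesis by simp
  qed
  have full: "rk v B = r" if B: "H \<subseteq> B" "B \<subseteq> K" for B
  proof -
    have "H \<noteq> {}" using H(2) by auto
    then obtain i where i: "i \<in> H" by blast
    have fB: "finite B" using B(2) fin finite_subset by blast
    have "r \<le> rk v B" using c[OF i] rk_mono[OF fB, of "H - {i}" v] B(1) by auto
    moreover have "rk v B \<le> r" using rk rk_mono[OF fin B(2), of v] by simp
    ultimately show ?thesis by simp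
  qed
  have proper: "rk v B = card B" if B: "B \<subset> H" for B
  proof -
    obtain i where i: "i \<in> H" "B \<subseteq> H - {i}" using B by blast
    have "card (H - {i}) = r" using H(2) finH i(1) by simp
    then have "indep_fam v (H - {i})" using c[OF i(1)] finH by (simp add: indep_fam_iff_rk)
    then have "indep_fam v B" using indep_fam_subset[OF _ _ i(2)] finH by blast
    moreover have "finite B" using i(2) finH finite_subset by blast
    ultimately show ?thesis by (simp add: indep_fam_iff_rk)
  qed
  consider "H \<subseteq> K - A" | "H \<subseteq> A" | "A \<inter> H \<subset> H" "H - A \<subset> H" using H(1) by blast
  then show False
  proof cases
    case 1
    then show False using full[OF 1] pos1[OF A(1)] A(2) eq rk by auto
  next
    case 2
    moreover have "rk v (K - A) \<ge> 1" by (rule pos1) (use A in auto)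
    ultimately show False using full[of A] A(2) eq rk by auto
  next
    case 3
    have "card (A \<inter> H) + card (H - A) = card H"
    proof -
      have "A \<inter> H \<union> (H - A) = H" "A \<inter> H \<inter> (H - A) = {}" by blast+
      then show ?thesis using card_Un_disjoint[of "A \<inter> H" "H - A"] finH by simp
    qed
    moreover have "rk v (A \<inter> H) \<le> rk v A" using finA by (intro rk_mono) auto
    moreover have "rk v (H - A) \<le> rk v (K - A)" using fin H(1) by (intro rk_mono) auto
    ultimately show False using proper[OF 3(1)] proper[OF 3(2)] eq rk H(2) by simp
  qed
qed

text \<open>If removal of \<open>i\<close> lowered the rank, then \<open>{i}\<close> would be a
  separator.\<close>

lemma connected_circuit:
  assumes fin: "finite J" and card: "card J = r + 1" "r \<ge> 1" and rk: "rk v J = r" and c: "connected_fam v J"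
    and i: "i \<in> J"
  shows "rk v (J - {i}) = r"
proof -
  have le: "rk v (J - {i}) \<le> r" using rk rk_mono[OF fin, of "J - {i}" v] by auto
  have s1: "rk v {i} \<le> 1" using rk_le_card[of "{i}" v] by simp
  have un: "{i} \<union> (J - {i}) = J" using i by blast
  have sub: "rk v J \<le> rk v {i} + rk v (J - {i})"
    using rk_subadditive[of "{i}" "J - {i}" v] fin unfolding un by simp
  have "J \<noteq> {i}" using card by auto
  then have "{i} \<subset> J" using i by blast
  then have ne: "rk v {i} + rk v (J - {i}) \<noteq> rk v J" using c unfolding connected_fam_def by blast
  show ?thesis using le s1 sub ne rk by linarith
qed

lemma circuit_basis:
  assumes fin: "finite K" and r: "r + 1 \<le> card K" and rk: "rk v K = r" and c: "circuit v K r"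
  shows "indep_fam (\<lambda>j. v (el K j)) {1..r}" "fv.span ((\<lambda>j. v (el K j)) ` {1..r}) = fv.span (v ` K)"
    "v (el K (r + 1)) = (\<Sum>j\<in>{1..r}. fscale (a j) (v (el K j))) \<Longrightarrow> j \<in> {1..r} \<Longrightarrow> a j \<noteq> 0"
proof -
  have inc: "{1..r} \<subseteq> {1..card K}" "r + 1 \<in> {1..card K}" using r by auto
  have head_minus: "head K r - {el K j} = el K ` ({1..r + 1} - {j})" if j: "j \<in> {1..r + 1}" for j
  proof -
    have "el K ` ({1..r + 1} - {j}) = el K ` {1..r + 1} - el K ` {j}"
      by (rule inj_on_image_set_diff[of _ "{1..r + 1}"]) (use el_inj[OF fin] r j in \<open>auto simp: inj_on_def\<close>)
    then show ?thesis using el_image_head[OF fin r] by simp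
  qed
  have el_head: "el K j \<in> head K r" if "j \<in> {1..r + 1}" for j using that el_image_head[OF fin r] by blast
  have rkminus: "fv.dim ((\<lambda>j. v (el K j)) ` ({1..r + 1} - {j})) = r" if "j \<in> {1..r + 1}" for j
    using c[unfolded circuit_def, THEN bspec, OF el_head[OF that]] unfolding head_minus[OF that] rk_def image_image .
  have eq: "{1..r + 1} - {r + 1} = {1..r}" by auto
  have d: "fv.dim ((\<lambda>j. v (el K j)) ` {1..r}) = r" using rkminus[of "r + 1"] unfolding eq by simp
  then show "indep_fam (\<lambda>j. v (el K j)) {1..r}" by (simp add: indep_fam_iff_dim)
  show "fv.span ((\<lambda>j. v (el K j)) ` {1..r}) = fv.span (v ` K)"
  proof (rule span_eq_of_dim)
    have "(\<lambda>j. v (el K j)) ` {1..r} \<subseteq> v ` K" using el_in[OF fin] inc by blast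
    then show "(\<lambda>j. v (el K j)) ` {1..r} \<subseteq> fv.span (v ` K)" using fv.span_superset[of "v ` K"] by blast
    show "fv.dim (v ` K) \<le> fv.dim ((\<lambda>j. v (el K j)) ` {1..r})" using d rk by (simp add: rk_def)
  qed (use fin in simp)
  show "a j \<noteq> 0" if a: "v (el K (r + 1)) = (\<Sum>j\<in>{1..r}. fscale (a j) (v (el K j)))" and j: "j \<in> {1..r}"
  proof
    \<comment> \<open>With a zero coefficient the last vector would lie in the span of
      \<open>r - 1\<close> others, and the family without \<open>j\<close> could not have rank
      \<open>r\<close>.\<close>
    assume z: "a j = 0"
    let ?X = "(\<lambda>j. v (el K j)) ` ({1..r} - {j})"
    have "v (el K (r + 1)) = (\<Sum>j\<in>{1..r} - {j}. fscale (a j) (v (el K j)))"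
      unfolding a using sum.remove[of "{1..r}" j "\<lambda>j. fscale (a j) (v (el K j))"] z j by simp
    then have m: "v (el K (r + 1)) \<in> fv.span ?X" unfolding span_fam_iff[OF finite_Diff[OF finite_atLeastAtMost]] by blast
    have "{1..r + 1} - {j} = insert (r + 1) ({1..r} - {j})" using j by auto
    then have "(\<lambda>j. v (el K j)) ` ({1..r + 1} - {j}) \<subseteq> fv.span ?X"
      using m fv.span_superset[of ?X] by (simp only: image_insert insert_subset)
    then have "fv.dim ((\<lambda>j. v (el K j)) ` ({1..r + 1} - {j})) \<le> fv.dim ?X" by (intro dim_mono_span) auto
    also have "\<dots> \<le> card ?X" by (rule fv.dim_le_card') simp
    also have "\<dots> \<le> card ({1..r} - {j})" by (rule card_image_le) simp
    also have "\<dots> < r" using j by simp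
    finally show False using rkminus[of j] j by simp
  qed
qed

section \<open>The standard projective frame\<close>

definition frame :: "nat \<Rightarrow> nat \<Rightarrow> nat \<Rightarrow> 'k::field" where
  "frame r h = (if h \<le> r then unit_vec h else (\<Sum>j=1..r. unit_vec j))"

lemma sum_unit: "(\<Sum>j=1..r. unit_vec j) = (\<lambda>i. if i \<in> {1..r} then 1 else (0::'k::field))"
  using sum_unit_vec[of "{1..r}" "\<lambda>_. 1 :: 'k"] by simp

lemma frame_in: "h \<ge> 1 \<Longrightarrow> frame r h \<in> Kvec r"
  unfolding frame_def by (auto intro!: fv.subspace_sum[OF subspace_Kvec])

lemma frame_nonzero: "r \<ge> 1 \<Longrightarrow> frame r h \<noteq> (0 :: nat \<Rightarrow> 'k::field)"
proof
  assume r: "r \<ge> 1" and z: "frame r h = (0 :: nat \<Rightarrow> 'k)"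
  show False
  proof (cases "h \<le> r")
    case True then show False using z by (simp add: frame_def)
  next
    case False
    then have "(\<Sum>j=1..r. unit_vec j) = (0 :: nat \<Rightarrow> 'k)" using z by (simp only: frame_def if_False)
    from fun_cong[OF this, of 1] show False unfolding sum_unit using r by simp
  qed
qed

lemma rk_frame:
  assumes h: "h \<in> {1..r + 1}"
  shows "rk (frame r :: nat \<Rightarrow> nat \<Rightarrow> 'k::field) ({1..r + 1} - {h}) = r"
proof (rule antisym)
  show "rk (frame r :: nat \<Rightarrow> nat \<Rightarrow> 'k) ({1..r + 1} - {h}) \<le> r"
    using rk_le_card[of "{1..r + 1} - {h}" "frame r :: nat \<Rightarrow> nat \<Rightarrow> 'k"] h by simp
  let ?S = "fv.span ((frame r :: nat \<Rightarrow> nat \<Rightarrow> 'k) ` ({1..r + 1} - {h}))"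
  have base: "unit_vec k \<in> ?S" if "k \<in> {1..r}" "k \<noteq> h" for k
    by (rule fv.span_base, rule image_eqI[of _ _ k]) (use that in \<open>auto simp: frame_def\<close>)
  have "unit_vec k \<in> ?S" if k: "k \<in> {1..r}" for k
  proof (cases "k = h")
    case True
    \<comment> \<open>The missing unit vector is the sum vector minus the remaining unit
      vectors.\<close>
    have "(\<Sum>j=1..r. unit_vec j) \<in> ?S"
      by (rule fv.span_base, rule image_eqI[of _ _ "r + 1"]) (use True k in \<open>auto simp: frame_def\<close>)
    moreover have "(\<Sum>j\<in>{1..r} - {k}. unit_vec j) \<in> ?S" by (rule fv.span_sum) (use base True in auto)
    ultimately have "(\<Sum>j=1..r. unit_vec j) - (\<Sum>j\<in>{1..r} - {k}. unit_vec j) \<in> ?S" by (rule fv.span_diff)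
    moreover have "(\<Sum>j=1..r. unit_vec j) - (\<Sum>j\<in>{1..r} - {k}. unit_vec j) = (unit_vec k :: nat \<Rightarrow> 'k)"
      using sum.remove[of "{1..r}" k "unit_vec :: nat \<Rightarrow> nat \<Rightarrow> 'k"] k by simp
    ultimately show ?thesis by simp
  qed (use base k in blast)
  then have "unit_vec ` {1..r} \<subseteq> ?S" by blast
  then have "fv.dim (unit_vec ` {1..r} :: (nat \<Rightarrow> 'k) set) \<le> rk (frame r :: nat \<Rightarrow> nat \<Rightarrow> 'k) ({1..r + 1} - {h})"
    unfolding rk_def by (intro dim_mono_span) auto
  then show "r \<le> rk (frame r :: nat \<Rightarrow> nat \<Rightarrow> 'k) ({1..r + 1} - {h})"
    using fv.dim_span[of "unit_vec ` {1..r} :: (nat \<Rightarrow> 'k) set"] unfolding span_unit_vec dim_Kvec by simp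
qed

text \<open>Spanning vectors of the lines of \<open>E_rep\<close>, and of \<open>D_rep\<close> when
  \<open>card K = r + 1\<close>.\<close>

definition frame_vec :: "nat \<Rightarrow> (nat \<Rightarrow> nat \<Rightarrow> 'k::field) \<Rightarrow> nat set \<Rightarrow> nat \<Rightarrow> nat \<Rightarrow> 'k" where
  "frame_vec r z K i = (if pos K i \<le> r + 1 then frame r (pos K i) else z (pos K i))"

lemma fw_facts:
  fixes z :: "nat \<Rightarrow> nat \<Rightarrow> 'k::field"
  assumes fin: "finite K" and r: "r \<ge> 1" "r + 1 \<le> card K"
    and z: "\<And>h. h \<in> {r + 2..card K} \<Longrightarrow> z h \<in> Kvec r - {0}"
  shows fw_in: "i \<in> K \<Longrightarrow> frame_vec r z K i \<in> Kvec r" and fw_nonzero: "i \<in> K \<Longrightarrow> frame_vec r z K i \<noteq> 0"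
    and fw_circuit: "circuit (frame_vec r z K) K r" and rk_fw: "rk (frame_vec r z K) K = r"
    and fw_connected: "connected_fam (frame_vec r z K) K"
    and fw_unit: "j \<in> {1..r} \<Longrightarrow> \<exists>i\<in>K. frame_vec r z K i = unit_vec j"
proof -
  have zp: "z (pos K i) \<in> Kvec r - {0}" if "i \<in> K" "\<not> pos K i \<le> r + 1" for i
    using z[of "pos K i"] pos_in[OF fin that(1)] that(2) by simp
  show inK: "frame_vec r z K i \<in> Kvec r" if "i \<in> K" for i
    using zp[OF that] pos_in[OF fin that] frame_in by (auto simp: frame_vec_def)
  show nz: "frame_vec r z K i \<noteq> 0" if "i \<in> K" for i
    using zp[OF that] frame_nonzero[OF r(1)] by (auto simp: frame_vec_def)
  have minus: "rk (frame_vec r z K) (head K r - {i}) = r" if i: "i \<in> head K r" for i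
  proof -
    have iK: "i \<in> K" "pos K i \<in> {1..r + 1}" using i pos_in[OF fin] by (auto simp: head_def)
    have "frame_vec r z K ` (head K r - {i}) = frame r ` (pos K ` (head K r - {i}))"
      unfolding image_image by (rule image_cong) (auto simp: frame_vec_def head_def)
    then show ?thesis unfolding rk_def using rk_frame[OF iK(2)] pos_head_minus[OF fin r(2) iK(1)] by (simp add: rk_def)
  qed
  then show c: "circuit (frame_vec r z K) K r" unfolding circuit_def by blast
  show rkK: "rk (frame_vec r z K) K = r"
  proof (rule antisym)
    have "fv.dim (frame_vec r z K ` K) \<le> fv.dim (unit_vec ` {1..r} :: (nat \<Rightarrow> 'k) set)"
      by (rule dim_mono_span, simp, unfold span_unit_vec) (use inK in blast)
    also have "\<dots> \<le> card (unit_vec ` {1..r} :: (nat \<Rightarrow> 'k) set)" by (rule fv.dim_le_card') simp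
    also have "\<dots> \<le> r" using card_image_le[of "{1..r}" "unit_vec :: nat \<Rightarrow> nat \<Rightarrow> 'k"] by simp
    finally show "rk (frame_vec r z K) K \<le> r" by (simp add: rk_def)
    have "head K r \<noteq> {}" using card_head[OF fin r(2)] by auto
    then obtain i where i: "i \<in> head K r" by blast
    show "r \<le> rk (frame_vec r z K) K"
      using minus[OF i] rk_mono[OF fin, of "head K r - {i}" "frame_vec r z K"] head_subset[of K r] by auto
  qed
  show "connected_fam (frame_vec r z K) K"
    by (rule circuit_connected[OF fin head_subset card_head[OF fin r(2)] minus rkK nz])
  show "\<exists>i\<in>K. frame_vec r z K i = unit_vec j" if j: "j \<in> {1..r}"
  proof -
    have jc: "j \<in> {1..card K}" using j r(2) by auto
    then show ?thesis using el_in[OF fin jc] pos_el[OF fin jc] j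
      by (intro bexI[of _ "el K j"]) (auto simp: frame_vec_def frame_def)
  qed
qed

lemma span_scaled_fam:
  assumes "\<And>j. j \<in> A \<Longrightarrow> a j \<noteq> 0"
  shows "fv.span ((\<lambda>j. fscale (a j) (x j)) ` A) = fv.span (x ` A)"
proof
  show "fv.span ((\<lambda>j. fscale (a j) (x j)) ` A) \<subseteq> fv.span (x ` A)"
    by (rule fv.span_minimal) (auto intro: fv.span_scale fv.span_base)
  have "x j \<in> fv.span ((\<lambda>j. fscale (a j) (x j)) ` A)" if j: "j \<in> A" for j
  proof -
    have "fscale (inverse (a j)) (fscale (a j) (x j)) \<in> fv.span ((\<lambda>j. fscale (a j) (x j)) ` A)"
      using j by (intro fv.span_scale fv.span_base) blast
    then show ?thesis using assms[OF j] by simp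
  qed
  then show "fv.span (x ` A) \<subseteq> fv.span ((\<lambda>j. fscale (a j) (x j)) ` A)"
    by (intro fv.span_minimal) auto
qed

text \<open>Two identifications of \<open>fst D\<close> with K^n differ by an element of
  \<open>GL n\<close>, so the definite description in \<open>flag_orbit\<close> is proper.\<close>

lemma flag_orbit_eq:
  fixes D :: "('i, 'k::field) mflag"
  assumes f: "lin_iso f (fst D) (Kvec n)" and V: "fv.subspace (fst D)" "\<And>i. i \<in> {1..m} \<Longrightarrow> snd D i \<subseteq> fst D"
    and L: "\<And>i. i \<in> {1..m} \<Longrightarrow> f ` snd D i = L i"
  shows "flag_orbit n m D = diag_orbit n m (\<lambda>i\<in>{1..m}. L i)"
proof -
  have L': "(\<lambda>i\<in>{1..m}. f ` snd D i) = (\<lambda>i\<in>{1..m}. L i)" using L by (rule restrict_ext)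
  show ?thesis
    unfolding flag_orbit_def
  proof (rule the_equality)
    show "\<exists>f. lin_iso f (fst D) (Kvec n) \<and> diag_orbit n m (\<lambda>i\<in>{1..m}. L i) = diag_orbit n m (\<lambda>i\<in>{1..m}. f ` snd D i)"
      using f L' by metis
    fix O' assume "\<exists>g. lin_iso g (fst D) (Kvec n) \<and> O' = diag_orbit n m (\<lambda>i\<in>{1..m}. g ` snd D i)"
    then obtain g where g: "lin_iso g (fst D) (Kvec n)" "O' = diag_orbit n m (\<lambda>i\<in>{1..m}. g ` snd D i)" by blast
    let ?h = "g \<circ> inv_into (fst D) f"
    have h: "?h \<in> GL n" unfolding GL_def using lin_iso_comp[OF lin_iso_inv[OF f V(1)] g(1)] by simp
    show "O' = diag_orbit n m (\<lambda>i\<in>{1..m}. L i)"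
      unfolding g(2)
    proof (rule diag_orbit_GL[OF h])
      fix i assume i: "i \<in> {1..m}"
      show "(\<lambda>i\<in>{1..m}. L i) i \<subseteq> Kvec n"
        using i L[OF i, symmetric] V(2)[OF i] lin_iso_image[OF f] by auto
      have "inv_into (fst D) f ` (f ` snd D i) = snd D i"
        using lin_iso_inj[OF f] V(2)[OF i] by (rule inv_into_image_cancel)
      then show "(\<lambda>i\<in>{1..m}. g ` snd D i) i = ?h ` (\<lambda>i\<in>{1..m}. L i) i"
        unfolding image_comp[symmetric] using i L[OF i] by simp
    qed
  qed
qed


section \<open>Orbits of the representatives\<close>

lemma fw_cong: "(pos K i > r + 1 \<Longrightarrow> z (pos K i) = z' (pos K i)) \<Longrightarrow> frame_vec r z K i = frame_vec r z' K i"
  by (simp add: frame_vec_def)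

lemma fw_all:
  fixes z :: "nat \<Rightarrow> nat \<Rightarrow> 'k::field"
  assumes f: "finite K" "r \<ge> 1" "r + 1 \<le> card K" and z: "\<forall>h\<in>{r + 2..card K}. z h \<in> Kvec r - {0}"
  shows "(\<forall>i\<in>K. frame_vec r z K i \<in> Kvec r) \<and> (\<forall>i\<in>K. frame_vec r z K i \<noteq> 0) \<and> circuit (frame_vec r z K) K r \<and>
    rk (frame_vec r z K) K = r \<and> connected_fam (frame_vec r z K) K \<and> (\<forall>j\<in>{1..r}. \<exists>i\<in>K. frame_vec r z K i = unit_vec j)"
proof (intro conjI ballI)
  fix i assume "i \<in> K"
  then show "frame_vec r z K i \<in> Kvec r" by (intro fw_in[OF f] bspec[OF z])
  show "frame_vec r z K i \<noteq> 0" using \<open>i \<in> K\<close> by (intro fw_nonzero[OF f] bspec[OF z])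
next
  show "circuit (frame_vec r z K) K r" by (intro fw_circuit[OF f] bspec[OF z])
  show "rk (frame_vec r z K) K = r" by (intro rk_fw[OF f] bspec[OF z])
  show "connected_fam (frame_vec r z K) K" by (intro fw_connected[OF f] bspec[OF z])
  show "\<exists>i\<in>K. frame_vec r z K i = unit_vec j" if "j \<in> {1..r}" for j
    using that by (intro fw_unit[OF f] bspec[OF z])
qed

text \<open>Spanning vectors for the lines of \<open>slot_rep\<close>. A block \<open>J\<close> has
  no position beyond its rank plus one, so the zero family is a mere placeholder.\<close>

fun slot_vec :: "(nat set \<times> nat \<Rightarrow> nat \<Rightarrow> nat \<Rightarrow> 'k::field) \<Rightarrow> slot \<Rightarrow> nat \<Rightarrow> nat \<Rightarrow> 'k" where
  "slot_vec y (EmptySlot k) i = 0"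
| "slot_vec y (ISlot I) i = unit_vec 1"
| "slot_vec y (JSlot J) i = frame_vec (card J - 1) (\<lambda>_. 0) J i"
| "slot_vec y (KSlot K r) i = frame_vec r (y (K, r)) K i"

text \<open>The coefficients are unique whenever the first \<open>r\<close> vectors of
  \<open>K\<close> form a basis of the span of the block.\<close>

definition block_coeff :: "(nat \<Rightarrow> nat \<Rightarrow> 'k::field) \<Rightarrow> nat set \<Rightarrow> nat \<Rightarrow> nat \<Rightarrow> nat \<Rightarrow> 'k" where
  "block_coeff v K r k = (SOME c. v k = (\<Sum>j\<in>{1..r}. fscale (c j) (v (el K j))))"

text \<open>Dividing by the coefficients of the vector in position \<open>r + 1\<close> amounts to
  rescaling the basis so that this vector becomes the sum of the basis vectors. The result is the
  coordinate vector in the projective frame given by the first \<open>r + 1\<close> vectors.\<close>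

definition frame_coords :: "(nat \<Rightarrow> nat \<Rightarrow> 'k::field) \<Rightarrow> nat set \<times> nat \<Rightarrow> nat \<Rightarrow> nat \<Rightarrow> 'k" where
  "frame_coords v = (\<lambda>(K, r) h j. if j \<in> {1..r} then block_coeff v K r (el K h) j / block_coeff v K r (el K (r + 1)) j else 0)"

definition scaled_basis :: "(nat \<Rightarrow> nat \<Rightarrow> 'k::field) \<Rightarrow> nat set \<Rightarrow> nat \<Rightarrow> nat \<Rightarrow> nat \<Rightarrow> 'k" where
  "scaled_basis v K r j = fscale (block_coeff v K r (el K (r + 1)) j) (v (el K j))"

lemma cf_eq:
  assumes "finite K" "r + 1 \<le> card K" "rk v K = r" "circuit v K r" "k \<in> K"
  shows "v k = (\<Sum>j\<in>{1..r}. fscale (block_coeff v K r k j) (v (el K j)))"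
proof -
  have "v k \<in> fv.span ((\<lambda>j. v (el K j)) ` {1..r})"
    unfolding circuit_basis(2)[OF assms(1-4)] by (rule fv.span_base) (use assms(5) in blast)
  then have "\<exists>c. v k = (\<Sum>j\<in>{1..r}. fscale (c j) (v (el K j)))"
    unfolding span_fam_iff[OF finite_atLeastAtMost] .
  then show ?thesis unfolding block_coeff_def by (rule someI_ex)
qed

lemma cf_nonzero:
  assumes "finite K" "r + 1 \<le> card K" "rk v K = r" "circuit v K r" "j \<in> {1..r}"
  shows "block_coeff v K r (el K (r + 1)) j \<noteq> 0"
  by (rule circuit_basis(3)[OF assms(1-4) _ assms(5)], rule cf_eq[OF assms(1-4)], rule el_in[OF assms(1)])
    (use assms(2) in auto)

lemma span_scaled_basis:
  assumes "finite K" "r + 1 \<le> card K" "rk v K = r" "circuit v K r"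
  shows "fv.span (scaled_basis v K r ` {1..r}) = fv.span (v ` K)"
proof -
  have "fv.span ((\<lambda>j. fscale (block_coeff v K r (el K (r + 1)) j) (v (el K j))) ` {1..r})
      = fv.span ((\<lambda>j. v (el K j)) ` {1..r})"
    by (rule span_scaled_fam) (rule cf_nonzero[OF assms])
  then show ?thesis unfolding circuit_basis(2)[OF assms] scaled_basis_def[abs_def] .
qed

text \<open>In the basis in which the first \<open>r + 1\<close> vectors of \<open>K\<close> become proportional to the standard
  projective frame, the remaining ones have coordinates \<open>frame_coords v (K, r)\<close>.\<close>

lemma lincomb_fw:
  assumes K: "finite K" "r + 1 \<le> card K" "rk v K = r" "circuit v K r" and i: "i \<in> K"
  shows "\<exists>c. c \<noteq> 0 \<and> lincomb r (scaled_basis v K r) (frame_vec r (frame_coords v (K, r)) K i) = fscale c (v i)"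
proof -
  have p: "pos K i \<in> {1..card K}" "el K (pos K i) = i" using pos_in[OF K(1) i] el_pos[OF K(1) i] by auto
  consider "pos K i \<le> r" | "pos K i = r + 1" | "pos K i > r + 1" by linarith
  then show ?thesis
  proof cases
    case 1
    then have "frame_vec r (frame_coords v (K, r)) K i = unit_vec (pos K i)" by (simp add: frame_vec_def frame_def)
    moreover have pr: "pos K i \<in> {1..r}" using 1 p(1) by simp
    ultimately have "lincomb r (scaled_basis v K r) (frame_vec r (frame_coords v (K, r)) K i)
        = fscale (block_coeff v K r (el K (r + 1)) (pos K i)) (v i)"
      using lincomb_unit_vec[OF pr, of "scaled_basis v K r"] p(2) by (simp add: scaled_basis_def)
    then show ?thesis using cf_nonzero[OF K pr] by blast
  next
    case 2
    then have "frame_vec r (frame_coords v (K, r)) K i = (\<lambda>i. if i \<in> {1..r} then 1 else 0)"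
      unfolding sum_unit[symmetric] by (simp add: frame_vec_def frame_def)
    then have "lincomb r (scaled_basis v K r) (frame_vec r (frame_coords v (K, r)) K i) = (\<Sum>j\<in>{1..r}. scaled_basis v K r j)"
      unfolding lincomb_def by (intro sum.cong) simp_all
    also have "\<dots> = v i"
      using cf_eq[OF K i] p(2) 2 unfolding scaled_basis_def by simp
    finally show ?thesis by (intro exI[of _ 1]) simp
  next
    case 3
    then have "frame_vec r (frame_coords v (K, r)) K i = frame_coords v (K, r) (pos K i)" by (simp add: frame_vec_def)
    then have "lincomb r (scaled_basis v K r) (frame_vec r (frame_coords v (K, r)) K i)
        = (\<Sum>j\<in>{1..r}. fscale (block_coeff v K r i j) (v (el K j)))"
      unfolding lincomb_def using cf_nonzero[OF K] p(2)
      by (intro sum.cong) (auto simp: frame_coords_def scaled_basis_def)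
    also have "\<dots> = v i" using cf_eq[OF K i] by simp
    finally show ?thesis by (intro exI[of _ 1]) simp
  qed
qed

fun block_basis :: "(nat \<Rightarrow> nat \<Rightarrow> 'k::field) \<Rightarrow> slot \<Rightarrow> nat \<Rightarrow> nat \<Rightarrow> 'k" where
  "block_basis v (EmptySlot k) = (\<lambda>_. 0)"
| "block_basis v (ISlot I) = (\<lambda>_. v (el I 1))"
| "block_basis v (JSlot J) = scaled_basis v J (card J - 1)"
| "block_basis v (KSlot K r) = scaled_basis v K r"

section \<open>Vector lifts of the representatives\<close>

context pdatum
begin

definition slot_of :: "nat \<Rightarrow> slot" where
  "slot_of i = (THE s. s \<in> core_slots p \<and> i \<in> slot_support s)"

lemma slot_of: "i \<in> {1..m} \<Longrightarrow> slot_of i \<in> core_slots p \<and> i \<in> slot_support (slot_of i)"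
  unfolding slot_of_def by (rule theI'[OF ex1_slot])

lemma support_core: "s \<in> slots n p \<Longrightarrow> i \<in> slot_support s \<Longrightarrow> s \<in> core_slots p \<and> i \<in> {1..m}"
  using empty_support support_subset by blast

lemma slot_of_eq: "s \<in> slots n p \<Longrightarrow> i \<in> slot_support s \<Longrightarrow> slot_of i = s"
  using the1_equality[OF ex1_slot, of i s] support_core unfolding slot_of_def by blast

lemma KSlot_in: "(K, r) \<in> Ks \<Longrightarrow> KSlot K r \<in> core_slots p"
  unfolding core_eq by force

lemma K_facts: "(K, r) \<in> Ks \<Longrightarrow> finite K \<and> r \<ge> 2 \<and> r + 2 \<le> card K"
  using card_K[of K r] card_ge_0_finite[of K] by auto

text \<open>Admissible spanning vectors for points of the parameter space; \<open>params_of\<close>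
  passes to the lines.\<close>

definition good :: "(nat set \<times> nat \<Rightarrow> nat \<Rightarrow> nat \<Rightarrow> 'k::field) \<Rightarrow> bool" where
  "good y \<longleftrightarrow> (\<forall>c\<in>Ks. \<forall>h\<in>{snd c + 2..card (fst c)}. y c h \<in> Kvec (snd c) - {0})"

definition params_of :: "(nat set \<times> nat \<Rightarrow> nat \<Rightarrow> nat \<Rightarrow> 'k::field) \<Rightarrow> 'k params" where
  "params_of y = (\<lambda>c\<in>Ks. \<lambda>h\<in>{snd c + 2..card (fst c)}. fv.span {y c h})"

text \<open>A lift of the flag \<open>Fpq\<close> to vectors in K^n.\<close>

definition model_vec :: "(nat set \<times> nat \<Rightarrow> nat \<Rightarrow> nat \<Rightarrow> 'k::field) \<Rightarrow> nat \<Rightarrow> nat \<Rightarrow> 'k" where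
  "model_vec y i = slot_emb (slot_of i) (slot_vec y (slot_of i) i)"

lemma wv_facts:
  fixes y :: "nat set \<times> nat \<Rightarrow> nat \<Rightarrow> nat \<Rightarrow> 'k::field"
  assumes y: "good y" and s: "s \<in> core_slots p"
  shows wv_in: "i \<in> slot_support s \<Longrightarrow> slot_vec y s i \<in> Kvec (slot_rank s)"
    and wv_nonzero: "i \<in> slot_support s \<Longrightarrow> slot_vec y s i \<noteq> 0"
    and wv_rk: "rk (slot_vec y s) (slot_support s) = slot_rank s"
    and wv_connected: "connected_fam (slot_vec y s) (slot_support s)"
    and wv_unit: "j \<in> {1..slot_rank s} \<Longrightarrow> \<exists>i\<in>slot_support s. slot_vec y s i = unit_vec j"
proof -
  have "(i \<in> slot_support s \<longrightarrow> slot_vec y s i \<in> Kvec (slot_rank s)) \<and> (i \<in> slot_support s \<longrightarrow> slot_vec y s i \<noteq> 0) \<and>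
    rk (slot_vec y s) (slot_support s) = slot_rank s \<and> connected_fam (slot_vec y s) (slot_support s) \<and>
    (j \<in> {1..slot_rank s} \<longrightarrow> (\<exists>i\<in>slot_support s. slot_vec y s i = unit_vec j))" for i j
    using s
  proof (cases rule: core_slot_cases)
    case (I A)
    have w: "slot_vec y s = (\<lambda>_. unit_vec 1)" unfolding I by (rule ext) simp
    have rk1: "rk (\<lambda>_. unit_vec 1 :: nat \<Rightarrow> 'k) B = 1" if "B \<noteq> {}" for B
      using that dim_singleton[OF unit_vec_nonzero, of 1] by (simp add: rk_def image_constant_conv)
    have ne: "A \<noteq> {}" using I(3) by auto
    have "connected_fam (\<lambda>_. unit_vec 1 :: nat \<Rightarrow> 'k) A"
      unfolding connected_fam_def
    proof (intro allI impI)
      fix B assume "B \<noteq> {}" "B \<subset> A"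
      then have "B \<noteq> {}" "A - B \<noteq> {}" by blast+
      from rk1[OF this(1)] rk1[OF this(2)] rk1[OF ne]
      show "rk (\<lambda>_. unit_vec 1 :: nat \<Rightarrow> 'k) B + rk (\<lambda>_. unit_vec 1 :: nat \<Rightarrow> 'k) (A - B) \<noteq> rk (\<lambda>_. unit_vec 1 :: nat \<Rightarrow> 'k) A"
        by linarith
    qed
    moreover have "unit_vec 1 \<in> (Kvec 1 :: (nat \<Rightarrow> 'k) set)" by (rule unit_vec_in_Kvec) simp
    moreover have "\<exists>i. i \<in> A" using ne by blast
    ultimately show ?thesis unfolding w unfolding I(1) using rk1[OF ne] by auto
  next
    case (J A)
    have f: "finite A" "card A - 1 \<ge> 1" "card A - 1 + 1 \<le> card A"
      using J(3) card_ge_0_finite[of A] by auto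
    \<comment> \<open>The range of \<open>h\<close> is empty, since \<open>card A - 1 + 2\<close>
      exceeds \<open>card A\<close>.\<close>
    have z: "\<forall>h\<in>{card A - 1 + 2..card A}. (0 :: nat \<Rightarrow> 'k) \<in> Kvec (card A - 1) - {0}"
      by simp
    have w: "slot_vec y s = frame_vec (card A - 1) (\<lambda>_. 0) A" unfolding J by (rule ext) simp
    show ?thesis unfolding w unfolding J(1) slot_support.simps slot_rank.simps
      using fw_all[OF f, of "\<lambda>_. 0", OF z] by blast
  next
    case (K A r)
    have f: "finite A" "r \<ge> 1" "r + 1 \<le> card A" using K_facts[OF K(2)] by auto
    have z: "\<forall>h\<in>{r + 2..card A}. y (A, r) h \<in> Kvec r - {0}"
      using bspec[OF y[unfolded good_def] K(2)] by simp
    have w: "slot_vec y s = frame_vec r (y (A, r)) A" unfolding K by (rule ext) simp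
    show ?thesis unfolding w unfolding K(1) slot_support.simps slot_rank.simps
      using fw_all[OF f, of "y (A, r)", OF z] by blast
  qed
  then show "i \<in> slot_support s \<Longrightarrow> slot_vec y s i \<in> Kvec (slot_rank s)" "i \<in> slot_support s \<Longrightarrow> slot_vec y s i \<noteq> 0"
    "rk (slot_vec y s) (slot_support s) = slot_rank s" "connected_fam (slot_vec y s) (slot_support s)"
    "j \<in> {1..slot_rank s} \<Longrightarrow> \<exists>i\<in>slot_support s. slot_vec y s i = unit_vec j" by blast+
qed

lemma slot_rep_facts:
  fixes y :: "nat set \<times> nat \<Rightarrow> nat \<Rightarrow> nat \<Rightarrow> 'k::field"
  assumes y: "good y" and s: "s \<in> slots n p"
  shows "fst (slot_rep (params_of y) s) = Kvec (slot_rank s)"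
    "i \<in> slot_support s \<Longrightarrow> snd (slot_rep (params_of y) s) i = fv.span {slot_vec y s i}"
    "i \<notin> slot_support s \<Longrightarrow> snd (slot_rep (params_of y) s) i = {0}"
proof -
  show "fst (slot_rep (params_of y) s) = Kvec (slot_rank s)"
    by (cases s) (simp_all add: F_rep_def D_rep_def E_rep_def Let_def)
  show "i \<notin> slot_support s \<Longrightarrow> snd (slot_rep (params_of y) s) i = {0}"
    by (cases s) (simp_all add: F_rep_def D_rep_def E_rep_def Let_def)
  assume i: "i \<in> slot_support s"
  then have "s \<in> core_slots p" using support_core s by blast
  then show "snd (slot_rep (params_of y) s) i = fv.span {slot_vec y s i}"
  proof (cases rule: core_slot_cases)
    case (I A)
    have "fv.span {unit_vec 1} = (Kvec 1 :: (nat \<Rightarrow> 'k) set)" using span_unit_vec[of 1, where 'k = 'k] by simp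
    then show ?thesis using i unfolding I(1) by (simp add: F_rep_def)
  next
    case (J A)
    then have "finite A" using card_ge_0_finite[of A] by simp
    then have "pos A i \<le> card A - 1 + 1" using pos_in[of A i] i J by simp
    then show ?thesis using i unfolding J(1) by (simp add: D_rep_def Let_def frame_vec_def frame_def)
  next
    case (K A r)
    have "pos A i \<in> {1..card A}" using pos_in[of A i] i K_facts[OF K(2)] unfolding K(1) by simp
    then show ?thesis using i K(2) unfolding K(1)
      by (auto simp: E_rep_def frame_vec_def frame_def params_of_def)
  qed
qed

text \<open>Computes \<open>iota\<close> from any \<open>H\<close> and any spanning vectors
  \<open>v\<close> of the transported lines. With the identity it yields the orbit of
  \<open>model_vec y\<close>; with an \<open>H\<close> adapted to a generic \<open>v\<close> it
  recovers the orbit of that \<open>v\<close>.\<close>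

lemma iota_par:
  assumes y: "good y" and H: "H \<in> GL n"
    and v: "\<And>s i. s \<in> core_slots p \<Longrightarrow> i \<in> slot_support s \<Longrightarrow> fv.span {v i} = fv.span {H (slot_emb s (slot_vec y s i))}"
  shows "iota n m p (params_of y) = vec_orbit n m v"
proof -
  let ?D = "slot_rep (params_of y)"
  note D = slot_rep_facts[OF y]
  have D2: "snd (?D s) i = fv.span {slot_vec y (slot_of i) i}" if "s \<in> slots n p" "i \<in> slot_support s" for s i
    using D(2)[OF that] slot_of_eq[OF that] by simp
  have D3: "snd (?D s) i = {0}" if "s \<in> slots n p" "i \<in> {1..m} - slot_support s" for s i
    using D(3)[OF that(1)] that(2) by blast
  have L: "fv.span {v i} = fv.span {H (slot_emb s (slot_vec y (slot_of i) i))}" if "s \<in> core_slots p" "i \<in> slot_support s" for s i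
    using v[OF that] slot_of_eq[of s i] that core_subset by auto
  note g = glue_flag_iso[of ?D "\<lambda>i. slot_vec y (slot_of i) i" H "\<lambda>i. fv.span {v i}", OF D(1) D2 D3 H L]
  have "flag_orbit n m (dsum (slots n p) ?D) = diag_orbit n m (\<lambda>i\<in>{1..m}. fv.span {v i})"
  proof (rule flag_orbit_eq[where f = "H \<circ> glue"])
    show "lin_iso (H \<circ> glue) (fst (dsum (slots n p) ?D)) (Kvec n)" by (rule g(1))
    show "(H \<circ> glue) ` snd (dsum (slots n p) ?D) i = fv.span {v i}" if "i \<in> {1..m}" for i
      by (rule g(2)) (use that in auto)
    show "fv.subspace (fst (dsum (slots n p) ?D))"
      unfolding fv.subspace_def dsum_def vsum_def fst_conv using D(1)
      by (auto simp: Kvec_def fscale_def)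
    show "snd (dsum (slots n p) ?D) i \<subseteq> fst (dsum (slots n p) ?D)" if i: "i \<in> {1..m}" for i
    proof -
      have "snd (?D s) i \<subseteq> fst (?D s)" if s: "s \<in> slots n p" for s
      proof (cases "i \<in> slot_support s")
        case True
        have "slot_vec y s i \<in> Kvec (slot_rank s)" by (rule wv_in[OF y]) (use support_core[OF s True] True in auto)
        then show ?thesis unfolding D(1)[OF s] D(2)[OF s True] by (intro fv.span_minimal) auto
      next
        case False
        then show ?thesis unfolding D(1)[OF s] D(3)[OF s False] using fv.subspace_0[OF subspace_Kvec] by blast
      qed
      then show ?thesis unfolding dsum_def vsum_def by auto
    qed
  qed
  then show ?thesis unfolding iota_def Fpq_def vec_orbit_def lines_def .
qed

text \<open>The opposite inequality for the total rank is subadditivity over the blocks.\<close>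

lemma realizesI:
  assumes "\<And>s. s \<in> core_slots p \<Longrightarrow> rk v (slot_support s) = slot_rank s"
    "\<And>s. s \<in> core_slots p \<Longrightarrow> connected_fam v (slot_support s)" "rank_p p \<le> rk v {1..m}"
  shows "realizes m p v"
proof -
  have "rk v {1..m} \<le> (\<Sum>s\<in>core_slots p. rk v (slot_support s))"
    unfolding Union_support[symmetric] using finite_core finite_support core_subset by (intro rk_Union_le) auto
  also have "\<dots> = (\<Sum>s\<in>core_slots p. slot_rank s)" using assms(1) by (intro sum.cong) auto
  finally have "rk v {1..m} = rank_p p" using sum_core assms(3) by simp
  then show ?thesis unfolding realizes_def using assms by blast
qed

lemma lin_iso_emb:
  assumes s: "s \<in> slots n p"
  shows "lin_iso (slot_emb s) (Kvec (slot_rank s)) (slot_emb s ` Kvec (slot_rank s))"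
  unfolding lin_iso_def bij_betw_def inj_on_def using emb_inj[OF s] emb_add emb_scale by blast

lemma mv_eq: "s \<in> slots n p \<Longrightarrow> i \<in> slot_support s \<Longrightarrow> model_vec y i = slot_emb s (slot_vec y s i)"
  using slot_of_eq by (simp add: model_vec_def)

lemma rk_mv:
  assumes y: "good y" and s: "s \<in> core_slots p" and A: "A \<subseteq> slot_support s"
  shows "rk (model_vec y) A = rk (slot_vec y s) A"
proof -
  have sl: "s \<in> slots n p" using s core_subset by blast
  have "rk (slot_emb s \<circ> slot_vec y s) A = rk (slot_vec y s) A"
    by (rule rk_lin_iso[OF lin_iso_emb[OF sl]]) (use wv_in[OF y s] A in auto)
  moreover have "rk (slot_emb s \<circ> slot_vec y s) A = rk (model_vec y) A"
    by (rule rk_cong) (use mv_eq[OF sl, of _ y] A in auto)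
  ultimately show ?thesis by simp
qed

lemma mv_vecs: "good y \<Longrightarrow> model_vec y \<in> vec_configs n m"
  unfolding vec_configs_def mem_Collect_eq
proof
  fix i assume y: "good y" and i: "i \<in> {1..m}"
  let ?s = "slot_of i"
  have s: "?s \<in> core_slots p" "i \<in> slot_support ?s" "?s \<in> slots n p" using slot_of[OF i] core_subset by auto
  have "slot_emb ?s (slot_vec y ?s i) \<noteq> slot_emb ?s 0"
    using emb_inj[OF s(3) wv_in[OF y s(1,2)] fv.subspace_0[OF subspace_Kvec]] wv_nonzero[OF y s(1,2)] by blast
  then have "slot_emb ?s (slot_vec y ?s i) \<noteq> 0" unfolding emb_zero .
  then show "model_vec y i \<in> Kvec n - {0}" unfolding model_vec_def using emb_in_Kvec by simp
qed

lemma mv_realizes: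
  fixes y :: "nat set \<times> nat \<Rightarrow> nat \<Rightarrow> nat \<Rightarrow> 'k::field"
  assumes y: "good y"
  shows "realizes m p (model_vec y)"
proof (rule realizesI)
  show "rk (model_vec y) (slot_support s) = slot_rank s" if "s \<in> core_slots p" for s
    using rk_mv[OF y that order_refl] wv_rk[OF y that] by simp
  show "connected_fam (model_vec y) (slot_support s)" if "s \<in> core_slots p" for s
    by (rule connected_fam_cong_rk[OF _ wv_connected[OF y that]]) (simp add: rk_mv[OF y that])
  \<comment> \<open>Every unit vector belonging to a core slot occurs among the model vectors, and
    there are \<open>rank_p p\<close> of them.\<close>
  let ?C = "coord ` (SIGMA s:core_slots p. {1..slot_rank s})"
  have sub: "(SIGMA s:core_slots p. {1..slot_rank s}) \<subseteq> (SIGMA s:slots n p. {1..slot_rank s})"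
    using core_subset by blast
  have "?C \<subseteq> coord ` (SIGMA s:slots n p. {1..slot_rank s})" using sub by (rule image_mono)
  then have Cn: "?C \<subseteq> {1..n}" unfolding bij_betw_imp_surj_on[OF coord_bij] .
  have "card ?C = rank_p p"
    using card_image[OF inj_on_subset[OF bij_betw_imp_inj_on[OF coord_bij] sub]] finite_core sum_core by simp
  moreover have "indep_fam (unit_vec :: nat \<Rightarrow> nat \<Rightarrow> 'k) ?C"
    by (rule indep_fam_subset[OF _ indep_fam_unit_vec Cn]) simp
  ultimately have "fv.dim ((unit_vec :: nat \<Rightarrow> nat \<Rightarrow> 'k) ` ?C) = rank_p p"
    using indep_fam_iff_dim[OF finite_subset[OF Cn finite_atLeastAtMost]] by metis
  moreover have "(unit_vec :: nat \<Rightarrow> nat \<Rightarrow> 'k) ` ?C \<subseteq> model_vec y ` {1..m}"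
  proof safe
    fix s j assume s: "s \<in> core_slots p" and j: "j \<in> {1..slot_rank s}"
    have sl: "s \<in> slots n p" using s core_subset by blast
    obtain i where i: "i \<in> slot_support s" "slot_vec y s i = unit_vec j" using wv_unit[OF y s j] by blast
    have "unit_vec (coord (s, j)) = model_vec y i"
      unfolding mv_eq[OF sl i(1)] i(2) emb_unit_vec[OF sl j] ..
    moreover have "i \<in> {1..m}" using support_core[OF sl i(1)] by blast
    ultimately show "(unit_vec (coord (s, j)) :: nat \<Rightarrow> 'k) \<in> model_vec y ` {1..m}" by blast
  qed
  ultimately show "rank_p p \<le> rk (model_vec y) {1..m}"
    unfolding rk_def using dim_mono_span[of "model_vec y ` {1..m}" "unit_vec ` ?C"] fv.span_superset[of "model_vec y ` {1..m}"] by auto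
qed

section \<open>The generic part of a stratum\<close>

definition stratum :: "(nat \<Rightarrow> nat \<Rightarrow> 'k::field) set" where
  "stratum = {v \<in> vec_configs n m. realizes m p v}"

text \<open>Circuits are demanded in the blocks \<open>(K, r)\<close>; in the blocks
  \<open>J\<close> they are automatic, by \<open>J_circuit\<close>. The orbits of these vectors are
  exactly the image of \<open>iota\<close>.\<close>

definition generic :: "(nat \<Rightarrow> nat \<Rightarrow> 'k::field) set" where
  "generic = {v \<in> stratum. \<forall>c\<in>Ks. circuit v (fst c) (snd c)}"

lemma genericD:
  assumes "v \<in> generic"
  shows "v \<in> vec_configs n m" "realizes m p v" "(K, r) \<in> Ks \<Longrightarrow> circuit v K r" "(K, r) \<in> Ks \<Longrightarrow> rk v K = r"
  using assms KSlot_in[of K r] unfolding generic_def stratum_def realizes_def by fastforce+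

lemma mv_generic:
  assumes y: "good y"
  shows "model_vec y \<in> generic"
  unfolding generic_def stratum_def
proof (intro CollectI conjI ballI)
  fix c assume c: "c \<in> Ks"
  obtain K r where Kr: "c = (K, r)" by (cases c)
  have f: "finite K" "r \<ge> 1" "r + 1 \<le> card K" using K_facts[of K r] c Kr by auto
  have z: "y (K, r) h \<in> Kvec r - {0}" if "h \<in> {r + 2..card K}" for h
    using bspec[OF bspec[OF y[unfolded good_def] c], of h] that Kr by simp
  have w: "slot_vec y (KSlot K r) = frame_vec r (y (K, r)) K" by (rule ext) simp
  have "circuit (slot_vec y (KSlot K r)) K r" unfolding w by (rule fw_circuit[OF f z])
  moreover have "rk (model_vec y) (head K r - {i}) = rk (slot_vec y (KSlot K r)) (head K r - {i})" for i
    by (rule rk_mv[OF y]) (use KSlot_in[of K r] c Kr head_subset[of K r] in auto)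
  ultimately show "circuit (model_vec y) (fst c) (snd c)" unfolding circuit_def Kr fst_conv snd_conv by simp
qed (use y mv_vecs mv_realizes in auto)

text \<open>The size of the block is its rank plus one, so the block is its own head, and
  connectedness makes it a circuit. This is why a block \<open>J\<close> has no parameters.\<close>

lemma J_circuit:
  assumes v: "realizes m p v" and J: "J \<in> Js"
  shows "finite J" "card J - 1 + 1 \<le> card J" "rk v J = card J - 1" "circuit v J (card J - 1)"
proof -
  have c: "card J \<ge> 3" by (rule card_J[OF J])
  show fin: "finite J" using c card_ge_0_finite[of J] by simp
  show "card J - 1 + 1 \<le> card J" using c by simp
  have "JSlot J \<in> core_slots p" using J unfolding core_eq by blast
  then have r: "rk v J = card J - 1" "connected_fam v J" using v unfolding realizes_def by force+
  then show "rk v J = card J - 1" by blast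
  have h: "head J (card J - 1) = J" using pos_in[OF fin] c by (auto simp: head_def)
  show "circuit v J (card J - 1)"
    unfolding circuit_def h using connected_circuit[OF fin _ _ r] c by simp
qed

text \<open>A zero coordinate vector would be sent to 0 by \<open>lincomb\<close>, but its image is
  a nonzero multiple of a vector of \<open>v\<close>.\<close>

lemma yv_good:
  fixes v :: "nat \<Rightarrow> nat \<Rightarrow> 'k::field"
  assumes v: "v \<in> generic"
  shows "good (frame_coords v)"
  unfolding good_def
proof (intro ballI)
  fix c h assume c: "c \<in> Ks" and h: "h \<in> {snd c + 2..card (fst c)}"
  obtain K r where Kr: "c = (K, r)" by (cases c)
  have K: "(K, r) \<in> Ks" "h \<in> {r + 2..card K}" using c h Kr by auto
  have f: "finite K" "r + 1 \<le> card K" using K_facts[OF K(1)] by auto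
  have hc: "h \<in> {1..card K}" using K(2) by simp
  let ?i = "el K h"
  have i: "?i \<in> K" "pos K ?i = h" using el_in[OF f(1) hc] pos_el[OF f(1) hc] by auto
  obtain a where a: "a \<noteq> 0" "lincomb r (scaled_basis v K r) (frame_vec r (frame_coords v (K, r)) K ?i) = fscale a (v ?i)"
    using lincomb_fw[OF f genericD(4,3)[OF v K(1)] i(1)] by blast
  have "frame_vec r (frame_coords v (K, r)) K ?i = frame_coords v (K, r) h" using i(2) K(2) by (simp add: frame_vec_def)
  moreover have "?i \<in> {1..m}" using i(1) support_core[of "KSlot K r" ?i] KSlot_in[OF K(1)] core_subset by auto
  then have "v ?i \<noteq> 0" using vecsD(2)[OF genericD(1)[OF v]] by blast
  moreover have "lincomb r (scaled_basis v K r) 0 = 0" by (simp add: lincomb_def)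
  ultimately have "frame_coords v (K, r) h \<noteq> 0" using a by auto
  moreover have "frame_coords v (K, r) h \<in> Kvec r" by (simp add: frame_coords_def Kvec_def)
  ultimately show "frame_coords v c h \<in> Kvec (snd c) - {0}" using Kr by simp
qed

text \<open>In bases of the blocks that are scaled to the projective frames, \<open>v\<close>
  becomes the model with its own frame coordinates, up to factors. This makes
  \<open>params_of (frame_coords v)\<close> an inverse of \<open>iota\<close> on generic
  orbits.\<close>

lemma iota_yv:
  fixes v :: "nat \<Rightarrow> nat \<Rightarrow> 'k::field"
  assumes v: "v \<in> generic"
  shows "iota n m p (params_of (frame_coords v)) = vec_orbit n m v"
proof -
  note vv = genericD(1)[OF v] and re = genericD(2)[OF v]
  \<comment> \<open>All lines of a block of rank 1 coincide.\<close>
  have I: "fv.span {v i} = fv.span (v ` A)" if "A \<in> Is" "i \<in> A" for A i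
  proof -
    have s: "ISlot A \<in> core_slots p" using that(1) unfolding core_eq by blast
    then have "rk v A = 1" using re unfolding realizes_def by force
    moreover have "i \<in> {1..m}" using support_core[of "ISlot A" i] s that(2) core_subset by auto
    then have "v i \<noteq> 0" using vecsD(2)[OF vv] by blast
    moreover have "finite A" using finite_support[of "ISlot A"] s core_subset by auto
    ultimately show ?thesis
      using that(2) by (intro span_eq_of_dim) (auto simp: rk_def dim_singleton intro: fv.span_base)
  qed
  have elI: "el A 1 \<in> A" if "A \<in> Is" for A
    using card_I[OF that] card_ge_0_finite[of A] by (intro el_in) auto
  have b: "fv.span (block_basis v s ` {1..slot_rank s}) = fv.span (v ` slot_support s)" if "s \<in> core_slots p" for s
    using that
  proof (cases rule: core_slot_cases)
    case (I A)
    then show ?thesis using \<open>\<And>A i. A \<in> Is \<Longrightarrow> i \<in> A \<Longrightarrow> fv.span {v i} = fv.span (v ` A)\<close>[OF I(2) elI[OF I(2)]] by simp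
  next
    case (J A)
    show ?thesis using span_scaled_basis[OF J_circuit[OF re J(2)]] unfolding J(1) by simp
  next
    case (K A r)
    show ?thesis using span_scaled_basis[OF _ _ genericD(4,3)[OF v K(2)]] K_facts[OF K(2)] unfolding K(1) by simp
  qed
  obtain H where H: "H \<in> GL n"
    "\<And>s x. s \<in> core_slots p \<Longrightarrow> x \<in> Kvec (slot_rank s) \<Longrightarrow> H (slot_emb s x) = lincomb (slot_rank s) (block_basis v s) x"
    using adapted_iso[OF re vecsD(1)[OF vv] b] by blast
  show ?thesis
  proof (rule iota_par[OF yv_good[OF v] H(1)])
    fix s i assume s: "s \<in> core_slots p" and i: "i \<in> slot_support s"
    have im: "i \<in> {1..m}" using support_core[of s i] s i core_subset by blast
    have nz: "v i \<noteq> 0" using vecsD(2)[OF vv im] .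
    have e: "H (slot_emb s (slot_vec (frame_coords v) s i)) = lincomb (slot_rank s) (block_basis v s) (slot_vec (frame_coords v) s i)"
      by (rule H(2)[OF s wv_in[OF yv_good[OF v] s i]])
    have "fv.span {lincomb (slot_rank s) (block_basis v s) (slot_vec (frame_coords v) s i)} = fv.span {v i}"
      using s
    proof (cases rule: core_slot_cases)
      case (I A)
      have "lincomb 1 (\<lambda>_. v (el A 1)) (unit_vec 1) = v (el A 1)" by (rule lincomb_unit_vec) simp
      moreover have "fv.span {v i} = fv.span {v (el A 1)}"
        using \<open>\<And>A i. A \<in> Is \<Longrightarrow> i \<in> A \<Longrightarrow> fv.span {v i} = fv.span (v ` A)\<close>[OF I(2)] elI[OF I(2)] i unfolding I(1) by simp
      ultimately show ?thesis unfolding I(1) by simp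
    next
      case (J A)
      have iA: "i \<in> A" using i unfolding J(1) by simp
      have "pos A i \<le> card A - 1 + 1" using pos_in[OF J_circuit(1)[OF re J(2)] iA] by simp
      \<comment> \<open>The pair \<open>(A, card A - 1)\<close> brings the vector into the form of
        \<open>lincomb_fw\<close>; positions beyond \<open>card A\<close> do not occur.\<close>
      then have "frame_vec (card A - 1) (\<lambda>_. 0) A i = frame_vec (card A - 1) (frame_coords v (A, card A - 1)) A i" by (intro fw_cong) simp
      then show ?thesis
        using lincomb_fw[OF J_circuit[OF re J(2)] iA] span_singleton_eq_iff[OF nz] unfolding J(1) by auto
    next
      case (K A r)
      have iA: "i \<in> A" using i unfolding K(1) by simp
      show ?thesis
        using lincomb_fw[OF _ _ genericD(4,3)[OF v K(2)] iA] K_facts[OF K(2)] span_singleton_eq_iff[OF nz]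
        unfolding K(1) by auto
    qed
    then show "fv.span {v i} = fv.span {H (slot_emb s (slot_vec (frame_coords v) s i))}" unfolding e by (rule sym)
  qed
qed

end


section \<open>Topology of the maps into the fibres\<close>

context pdatum
begin

lemma orb_in_fibre_iff:
  fixes v :: "nat \<Rightarrow> nat \<Rightarrow> 'k::real_normed_field"
  assumes m: "1 \<le> m" and v: "v \<in> vec_configs n m"
  shows "vec_orbit n m v \<in> fibre n m p \<longleftrightarrow> v \<in> stratum"
proof -
  have "pi_map n m (vec_orbit n m v) = p \<longleftrightarrow> realizes m p v"
    unfolding vec_orbit_def lines_def by (rule pi_map_eq_iff[OF m vecsD(1)[OF v] vecsD(2)[OF v] p])
  then show ?thesis using v unfolding fibre_def topspace_orbit_space stratum_def by blast
qed

lemma fibre_eq: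
  assumes m: "1 \<le> m"
  shows "fibre n m p = vec_orbit n m ` (stratum :: (nat \<Rightarrow> nat \<Rightarrow> 'k::real_normed_field) set)"
proof -
  have "(fibre n m p :: 'k config set set) \<subseteq> vec_orbit n m ` vec_configs n m"
    unfolding fibre_def topspace_orbit_space by blast
  moreover have "stratum \<subseteq> (vec_configs n m :: (nat \<Rightarrow> nat \<Rightarrow> 'k) set)" unfolding stratum_def by blast
  ultimately show ?thesis using orb_in_fibre_iff[OF m] by blast
qed

lemma topspace_fibre_space: "topspace (fibre_space n m p :: 'k::real_normed_field config set topology) = fibre n m p"
  unfolding fibre_space_def fibre_def topspace_subtopology by blast

text \<open>The stratum is saturated, so the image of \<open>stratum \<inter> T\<close> is cut out
  by the fibre from the image of \<open>vec_configs n m \<inter> T\<close>, which is open.\<close>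

lemma openin_fibre_orb:
  fixes A :: "(nat \<Rightarrow> nat \<Rightarrow> 'k::real_normed_field) set"
  assumes m: "1 \<le> m" and A: "openin (top_of_set stratum) A"
  shows "openin (fibre_space n m p) (vec_orbit n m ` A)"
proof -
  obtain T where T: "open T" "A = stratum \<inter> T" using A by (auto simp: openin_open)
  have "openin (top_of_set (vec_configs n m)) (vec_configs n m \<inter> T)" using T(1) by (rule openin_open_Int)
  then have "openin (orbit_space n m) (vec_orbit n m ` (vec_configs n m \<inter> T))"
    using open_map_orb unfolding open_map_def by blast
  moreover have "vec_orbit n m ` A = vec_orbit n m ` (vec_configs n m \<inter> T) \<inter> fibre n m p"
  proof
    show "vec_orbit n m ` A \<subseteq> vec_orbit n m ` (vec_configs n m \<inter> T) \<inter> fibre n m p"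
      unfolding T(2) fibre_eq[OF m] by (auto simp: stratum_def)
    show "vec_orbit n m ` (vec_configs n m \<inter> T) \<inter> fibre n m p \<subseteq> vec_orbit n m ` A"
      unfolding T(2) using orb_in_fibre_iff[OF m] by blast
  qed
  ultimately show ?thesis unfolding fibre_space_def openin_subtopology by blast
qed

lemma param_space_eq: "param_space p = product_topology
    (\<lambda>c. product_topology (\<lambda>_. proj_space (snd c)) {snd c + 2..card (fst c)}) Ks"
  by (cases p) (simp add: case_prod_unfold)

lemma topspace_param_space: "topspace (param_space p) = params_of ` {y :: nat set \<times> nat \<Rightarrow> nat \<Rightarrow> nat \<Rightarrow> 'k::real_normed_field. good y}"
proof
  show "params_of ` {y :: nat set \<times> nat \<Rightarrow> nat \<Rightarrow> nat \<Rightarrow> 'k. good y} \<subseteq> topspace (param_space p)"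
  proof safe
    fix y :: "nat set \<times> nat \<Rightarrow> nat \<Rightarrow> nat \<Rightarrow> 'k" assume y: "good y"
    have "fv.span {y c h} \<in> topspace (proj_space (snd c))" if "c \<in> Ks" "h \<in> {snd c + 2..card (fst c)}" for c h
      unfolding topspace_proj_space using y that unfolding good_def by blast
    then show "params_of y \<in> topspace (param_space p)"
      unfolding param_space_eq topspace_product_topology params_of_def
      by (intro restrict_PiE_iff[THEN iffD2] ballI) blast
  qed
  show "topspace (param_space p) \<subseteq> params_of ` {y :: nat set \<times> nat \<Rightarrow> nat \<Rightarrow> nat \<Rightarrow> 'k. good y}"
  proof
    fix q :: "'k params" assume "q \<in> topspace (param_space p)"
    then have q: "q \<in> PiE Ks (\<lambda>c. PiE {snd c + 2..card (fst c)} (\<lambda>_. (\<lambda>v. fv.span {v}) ` (Kvec (snd c) - {0})))"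
      unfolding param_space_eq topspace_product_topology topspace_proj_space .
    have "\<exists>x. x \<in> Kvec (snd c) - {0} \<and> q c h = fv.span {x}" if "c \<in> Ks" "h \<in> {snd c + 2..card (fst c)}" for c h
      using PiE_mem[OF PiE_mem[OF q that(1)] that(2)] by blast
    then obtain y where y: "\<And>c h. c \<in> Ks \<Longrightarrow> h \<in> {snd c + 2..card (fst c)} \<Longrightarrow> y c h \<in> Kvec (snd c) - {0} \<and> q c h = fv.span {y c h}"
      by metis
    have "q = params_of y"
    proof (rule extensionalityI)
      show "q \<in> extensional Ks" using q by (simp add: PiE_def)
      show "params_of y \<in> extensional Ks" by (simp add: params_of_def)
      fix c assume c: "c \<in> Ks"
      have "params_of y c = (\<lambda>h\<in>{snd c + 2..card (fst c)}. fv.span {y c h})" using c by (simp add: params_of_def)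
      moreover have "q c = (\<lambda>h\<in>{snd c + 2..card (fst c)}. fv.span {y c h})"
      proof (rule extensionalityI)
        show "q c \<in> extensional {snd c + 2..card (fst c)}" using PiE_mem[OF q c] by (simp add: PiE_def)
      qed (use y[OF c] in simp_all)
      ultimately show "q c = params_of y c" by simp
    qed
    moreover have "good y" unfolding good_def using y by blast
    ultimately show "q \<in> params_of ` {y. good y}" by blast
  qed
qed

lemma el_in_m:
  assumes "(K, r) \<in> Ks" "j \<in> {1..card K}" shows "el K j \<in> {1..m}"
  using support_core[of "KSlot K r" "el K j"] KSlot_in[OF assms(1)] core_subset el_in[OF _ assms(2)] K_facts[OF assms(1)] by auto

text \<open>The block coefficients are continuous by \<open>continuous_on_coeffs\<close>, and the
  denominators do not vanish by \<open>cf_nonzero\<close>.\<close>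

lemma continuous_map_par_yv:
  "continuous_map (top_of_set generic) (param_space p) (\<lambda>v :: nat \<Rightarrow> nat \<Rightarrow> 'k::real_normed_field. params_of (frame_coords v))"
  unfolding param_space_eq continuous_map_componentwise
proof (intro conjI ballI)
  show "(\<lambda>v :: nat \<Rightarrow> nat \<Rightarrow> 'k. params_of (frame_coords v)) ` topspace (top_of_set generic) \<subseteq> extensional Ks"
    by (auto simp: params_of_def)
  fix c assume c: "c \<in> Ks"
  obtain K r where Kr: "c = (K, r)" by (cases c)
  have K: "(K, r) \<in> Ks" using c Kr by simp
  have f: "finite K" "r + 1 \<le> card K" using K_facts[OF K] by auto
  have parc: "params_of (frame_coords v) c = (\<lambda>h\<in>{r + 2..card K}. fv.span {frame_coords v (K, r) h})" for v :: "nat \<Rightarrow> nat \<Rightarrow> 'k"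
    using c Kr by (simp add: params_of_def)
  show "(\<lambda>v :: nat \<Rightarrow> nat \<Rightarrow> 'k. params_of (frame_coords v) c) ` topspace (top_of_set generic) \<subseteq> extensional {snd c + 2..card (fst c)}"
    unfolding parc unfolding Kr by auto
  fix h assume "h \<in> {snd c + 2..card (fst c)}"
  then have h: "h \<in> {r + 2..card K}" using Kr by simp
  have cfc: "continuous_on generic (\<lambda>v :: nat \<Rightarrow> nat \<Rightarrow> 'k. block_coeff v K r k j)" if k: "k \<in> K" and j: "j \<in> {1..r}" for k j
  proof (rule continuous_on_coeffs[where A = "{1..r}" and V = "\<lambda>v j. v (el K j)" and W = "\<lambda>v. v k" and n = n])
    show "v (el K l) \<in> Kvec n" if "v \<in> generic" "l \<in> {1..r}" for v :: "nat \<Rightarrow> nat \<Rightarrow> 'k" and l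
      using vecsD(1)[OF genericD(1)[OF that(1)] el_in_m[OF K, of l]] that(2) f(2) by auto
    show "indep_fam (\<lambda>j. v (el K j)) {1..r}" if "v \<in> generic" for v :: "nat \<Rightarrow> nat \<Rightarrow> 'k"
      by (rule circuit_basis(1)[OF f genericD(4,3)[OF that K]])
    show "v k = (\<Sum>j\<in>{1..r}. fscale (block_coeff v K r k j) (v (el K j)))" if "v \<in> generic" for v :: "nat \<Rightarrow> nat \<Rightarrow> 'k"
      by (rule cf_eq[OF f genericD(4,3)[OF that K] k])
  qed (use continuous_on_component j in auto)
  have hK: "el K h \<in> K" "el K (r + 1) \<in> K" using h f by (auto intro: el_in)
  have "continuous_on generic (\<lambda>v :: nat \<Rightarrow> nat \<Rightarrow> 'k. frame_coords v (K, r) h)"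
  proof (rule continuous_on_coordinatewise_then_product)
    fix j show "continuous_on generic (\<lambda>v :: nat \<Rightarrow> nat \<Rightarrow> 'k. frame_coords v (K, r) h j)"
    proof (cases "j \<in> {1..r}")
      case True
      have "continuous_on generic (\<lambda>v :: nat \<Rightarrow> nat \<Rightarrow> 'k. block_coeff v K r (el K h) j / block_coeff v K r (el K (r + 1)) j)"
        by (intro continuous_on_divide cfc hK True ballI) (rule cf_nonzero[OF f genericD(4,3)[OF _ K] True])
      then show ?thesis using True by (simp only: frame_coords_def prod.case if_True)
    next
      case False then show ?thesis by (simp only: frame_coords_def prod.case if_False continuous_on_const)
    qed
  qed
  moreover have "frame_coords v (K, r) h \<in> Kvec r - {0}" if "v \<in> generic" for v :: "nat \<Rightarrow> nat \<Rightarrow> 'k"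
    using bspec[OF bspec[OF yv_good[OF that, unfolded good_def] K], of h] h by simp
  ultimately have "continuous_map (top_of_set generic) (top_of_set (Kvec r - {0})) (\<lambda>v :: nat \<Rightarrow> nat \<Rightarrow> 'k. frame_coords v (K, r) h)"
    by auto
  then have "continuous_map (top_of_set generic) (proj_space r) ((\<lambda>x. fv.span {x}) \<circ> (\<lambda>v :: nat \<Rightarrow> nat \<Rightarrow> 'k. frame_coords v (K, r) h))"
    by (rule continuous_map_compose) (rule quotient_imp_continuous_map[OF quotient_map_proj])
  then show "continuous_map (top_of_set generic) (proj_space (snd c)) (\<lambda>v :: nat \<Rightarrow> nat \<Rightarrow> 'k. params_of (frame_coords v) c h)"
    unfolding parc using h Kr by (simp add: o_def)
qed

lemma iota_mv:
  assumes y: "good y" shows "iota n m p (params_of y) = vec_orbit n m (model_vec y)"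
proof (rule iota_par[OF y id_in_GL])
  fix s i assume "s \<in> core_slots p" "i \<in> slot_support s"
  then show "fv.span {model_vec y i} = fv.span {slot_emb s (slot_vec y s i)}" using mv_eq[of s i y] core_subset by auto
qed

text \<open>Model vectors give one inclusion, frame coordinates the other.\<close>

lemma iota_image: "iota n m p ` topspace (param_space p) = vec_orbit n m ` (generic :: (nat \<Rightarrow> nat \<Rightarrow> 'k::real_normed_field) set)"
proof
  show "iota n m p ` topspace (param_space p) \<subseteq> vec_orbit n m ` (generic :: (nat \<Rightarrow> nat \<Rightarrow> 'k) set)"
    unfolding topspace_param_space using iota_mv mv_generic by blast
  show "vec_orbit n m ` (generic :: (nat \<Rightarrow> nat \<Rightarrow> 'k) set) \<subseteq> iota n m p ` topspace (param_space p)"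
  proof safe
    fix v :: "nat \<Rightarrow> nat \<Rightarrow> 'k" assume v: "v \<in> generic"
    show "vec_orbit n m v \<in> iota n m p ` topspace (param_space p)"
      unfolding topspace_param_space iota_yv[OF v, symmetric] using yv_good[OF v] by blast
  qed
qed

lemma continuous_map_image_line:
  assumes s: "s \<in> slots n p"
  shows "continuous_map (proj_space (slot_rank s)) (proj_space n :: 'k::real_normed_field line topology) ((`) (slot_emb s))"
proof (rule continuous_compose_quotient_map[OF quotient_map_proj])
  have "continuous_on (Kvec (slot_rank s)) (slot_emb s :: (nat \<Rightarrow> 'k) \<Rightarrow> _)"
    by (rule continuous_on_lin_iso[OF lin_iso_emb[OF s]])
  then have "continuous_on (Kvec (slot_rank s) - {0}) (slot_emb s :: (nat \<Rightarrow> 'k) \<Rightarrow> _)"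
    by (rule continuous_on_subset) blast
  moreover have "slot_emb s x \<in> Kvec n - {0}" if "x \<in> Kvec (slot_rank s) - {0}" for x :: "nat \<Rightarrow> 'k"
    using emb_inj[OF s, of x 0] that fv.subspace_0[OF subspace_Kvec] emb_in_Kvec unfolding emb_zero by blast
  ultimately have "continuous_map (top_of_set (Kvec (slot_rank s) - {0})) (top_of_set (Kvec n - {0})) (slot_emb s :: (nat \<Rightarrow> 'k) \<Rightarrow> _)"
    by auto
  then have "continuous_map (top_of_set (Kvec (slot_rank s) - {0})) (proj_space n) ((\<lambda>x. fv.span {x}) \<circ> (slot_emb s :: (nat \<Rightarrow> 'k) \<Rightarrow> _))"
    by (rule continuous_map_compose) (rule quotient_imp_continuous_map[OF quotient_map_proj])
  then show "continuous_map (top_of_set (Kvec (slot_rank s) - {0})) (proj_space n :: 'k line topology) ((`) (slot_emb s) \<circ> (\<lambda>v. fv.span {v}))"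
  proof (rule continuous_map_eq)
    fix x :: "nat \<Rightarrow> 'k" assume "x \<in> topspace (top_of_set (Kvec (slot_rank s) - {0}))"
    then show "((\<lambda>x. fv.span {x}) \<circ> slot_emb s) x = ((`) (slot_emb s) \<circ> (\<lambda>v. fv.span {v})) x"
      using lin_iso_span_image[OF lin_iso_emb[OF s] subspace_Kvec, of "{x}"] by simp
  qed
qed

text \<open>\<open>F\<close> lifts \<open>iota\<close> to configurations of lines: every line is
  either fixed or the image of a single parameter line under \<open>slot_emb\<close>. Working with
  lines avoids a continuous choice of spanning vectors, which does not exist on a projective space
  of positive dimension.\<close>

lemma continuous_map_iota:
  assumes m: "1 \<le> m"
  shows "continuous_map (param_space p) (fibre_space n m p :: 'k::real_normed_field config set topology) (iota n m p)"
proof -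
  \<comment> \<open>Any admissible vectors would do: \<open>base\<close> is consulted only for lines
    that do not depend on the parameters.\<close>
  let ?y0 = "\<lambda>_ _. unit_vec 1 :: nat \<Rightarrow> 'k"
  have y0: "good ?y0"
    unfolding good_def using K_facts by fastforce
  define base where "base i = fv.span {model_vec ?y0 i}" for i
  define F where "F q = (\<lambda>i\<in>{1..m}. case slot_of i of
      KSlot K r \<Rightarrow> if pos K i > r + 1 then slot_emb (KSlot K r) ` (q (K, r) (pos K i)) else base i | _ \<Rightarrow> base i)"
    for q :: "'k params"
  have sl: "slot_of i \<in> slots n p" if "i \<in> {1..m}" for i using slot_of[OF that] core_subset by blast
  have KS: "(K, r) \<in> Ks \<and> i \<in> K" if "i \<in> {1..m}" "slot_of i = KSlot K r" for i K r
    using slot_of[OF that(1)] unfolding that(2) core_eq by auto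
  have "continuous_map (param_space p) (config_space n m) F"
    unfolding config_space_def continuous_map_componentwise
  proof (intro conjI ballI)
    show "F ` topspace (param_space p) \<subseteq> extensional {1..m}" by (auto simp: F_def)
    fix i assume i: "i \<in> {1..m}"
    have "base i \<in> topspace (proj_space n)"
      unfolding topspace_proj_space base_def using vecsD[OF mv_vecs[OF y0] i] by blast
    then have const: "continuous_map (param_space p) (proj_space n) (\<lambda>q :: 'k params. base i)" by simp
    show "continuous_map (param_space p) (proj_space n) (\<lambda>q. F q i)"
    proof (cases "\<exists>K r. slot_of i = KSlot K r \<and> pos K i > r + 1")
      case True
      then obtain K r where K: "slot_of i = KSlot K r" "pos K i > r + 1" by blast
      note Ki = KS[OF i K(1)]
      have h: "pos K i \<in> {r + 2..card K}"
        using K(2) pos_in[of K i] Ki K_facts[of K r] by auto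
      have s: "KSlot K r \<in> slots n p" using sl[OF i] K(1) by simp
      have "continuous_map (param_space p) (product_topology (\<lambda>_. proj_space r) {r + 2..card K}) (\<lambda>q :: 'k params. q (K, r))"
        unfolding param_space_eq
        using continuous_map_product_projection[of "(K, r)" Ks
            "\<lambda>c. product_topology (\<lambda>_. proj_space (snd c) :: 'k line topology) {snd c + 2..card (fst c)}"] Ki
        by (simp only: fst_conv snd_conv)
      moreover have "continuous_map (product_topology (\<lambda>_. proj_space r) {r + 2..card K}) (proj_space r) (\<lambda>q :: nat \<Rightarrow> 'k line. q (pos K i))"
        by (rule continuous_map_product_projection[OF h])
      ultimately have "continuous_map (param_space p) (proj_space r) ((\<lambda>q. q (pos K i)) \<circ> (\<lambda>q :: 'k params. q (K, r)))"
        by (rule continuous_map_compose)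
      moreover have "continuous_map (proj_space r) (proj_space n :: 'k line topology) ((`) (slot_emb (KSlot K r)))"
        using continuous_map_image_line[OF s] by simp
      ultimately have "continuous_map (param_space p) (proj_space n) ((`) (slot_emb (KSlot K r)) \<circ> ((\<lambda>q. q (pos K i)) \<circ> (\<lambda>q :: 'k params. q (K, r))))"
        by (rule continuous_map_compose)
      moreover have "(\<lambda>q. F q i) = (`) (slot_emb (KSlot K r)) \<circ> ((\<lambda>q. q (pos K i)) \<circ> (\<lambda>q :: 'k params. q (K, r)))"
        using K i by (auto simp: F_def)
      ultimately show ?thesis by simp
    next
      case False
      have "F q i = base i" for q using False i by (auto simp: F_def split: slot.split)
      then show ?thesis using const by simp
    qed
  qed
  then have "continuous_map (param_space p) (orbit_space n m) (diag_orbit n m \<circ> F)"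
    by (rule continuous_map_compose[OF _ continuous_map_diag_orbit])
  moreover have "(diag_orbit n m \<circ> F) q = iota n m p q" if q: "q \<in> topspace (param_space p)" for q
  proof -
    obtain y where y: "good y" "q = params_of y" using q unfolding topspace_param_space by blast
    have "F (params_of y) = lines m (model_vec y)"
      unfolding F_def lines_def
    proof (rule restrict_ext)
      fix i assume i: "i \<in> {1..m}"
      have si: "slot_of i \<in> core_slots p" "i \<in> slot_support (slot_of i)" using slot_of[OF i] by auto
      show "(case slot_of i of KSlot K r \<Rightarrow> if pos K i > r + 1 then slot_emb (KSlot K r) ` (params_of y (K, r) (pos K i)) else base i | _ \<Rightarrow> base i)
          = fv.span {model_vec y i}"
        using si(1)
      proof (cases rule: core_slot_cases)
        case (K A r)
        have Ki: "(A, r) \<in> Ks" "i \<in> A" using KS[OF i K(1)] by auto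
        show ?thesis
        proof (cases "pos A i > r + 1")
          case True
          have h: "pos A i \<in> {r + 2..card A}" using True pos_in[of A i] Ki K_facts[OF Ki(1)] by auto
          have s: "KSlot A r \<in> slots n p" using sl[OF i] K(1) by simp
          have w: "slot_vec y (KSlot A r) i = y (A, r) (pos A i)" using True by (simp add: frame_vec_def)
          have yK: "y (A, r) (pos A i) \<in> Kvec (slot_rank (KSlot A r))"
            using bspec[OF bspec[OF y(1)[unfolded good_def] Ki(1)], of "pos A i"] h by simp
          have "slot_emb (KSlot A r) ` fv.span {y (A, r) (pos A i)} = fv.span {slot_emb (KSlot A r) (y (A, r) (pos A i))}"
            using lin_iso_span_image[OF lin_iso_emb[OF s] subspace_Kvec, of "{y (A, r) (pos A i)}"] yK by simp
          then show ?thesis using True h Ki(1) unfolding model_vec_def K(1) w by (simp add: params_of_def)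
        next
          case False
          then show ?thesis unfolding model_vec_def base_def K(1) by (simp add: frame_vec_def)
        qed
      qed (simp_all add: model_vec_def base_def)
    qed
    then show ?thesis using iota_mv[OF y(1)] y(2) by (simp add: vec_orbit_def)
  qed
  ultimately have "continuous_map (param_space p) (orbit_space n m :: 'k config set topology) (iota n m p)" by (rule continuous_map_eq)
  moreover have "iota n m p ` topspace (param_space p) \<subseteq> (fibre n m p :: 'k config set set)"
    unfolding iota_image fibre_eq[OF m] generic_def by blast
  ultimately show ?thesis unfolding fibre_space_def continuous_map_in_subtopology by blast
qed

text \<open>An element of \<open>GL n\<close> preserving the lines of a projective frame acts as a scalar on the
  subspace spanned by it.\<close>

lemma inj_iota: "inj_on (iota n m p) (topspace (param_space p :: 'k::real_normed_field params topology))"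
proof (rule inj_onI)
  fix q q' :: "'k params"
  assume "q \<in> topspace (param_space p)" "q' \<in> topspace (param_space p)" and e: "iota n m p q = iota n m p q'"
  then obtain y y' where y: "good y" "q = params_of y" and y': "good y'" "q' = params_of y'"
    unfolding topspace_param_space by blast
  have "vec_orbit n m (model_vec y') = vec_orbit n m (model_vec y)" using e iota_mv[OF y(1)] iota_mv[OF y'(1)] y(2) y'(2) by simp
  then obtain g c where g: "g \<in> GL n" and gc: "\<And>i. i \<in> {1..m} \<Longrightarrow> c i \<noteq> 0 \<and> model_vec y' i = fscale (c i) (g (model_vec y i))"
    unfolding orb_eq_iff[OF mv_vecs[OF y'(1)] mv_vecs[OF y(1)]] by blast
  have gi: "lin_iso g (Kvec n) (Kvec n)" using g by (simp add: GL_def)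
  have "fv.span {y d h} = fv.span {y' d h}" if d: "d \<in> Ks" and "h \<in> {snd d + 2..card (fst d)}" for d h
  proof -
    obtain K r where Kr: "d = (K, r)" by (cases d)
    have K: "(K, r) \<in> Ks" and h: "h \<in> {r + 2..card K}" using that Kr by auto
    have f: "finite K" "r \<ge> 2" "r + 2 \<le> card K" using K_facts[OF K] by auto
    let ?s = "KSlot K r"
    have s: "?s \<in> slots n p" using KSlot_in[OF K] core_subset by blast
    define E where "E l = (unit_vec (coord (?s, l)) :: nat \<Rightarrow> 'k)" for l
    have EK: "E l \<in> Kvec n" if "l \<in> {1..r}" for l
      unfolding E_def by (rule unit_vec_in_Kvec, rule coord_in[OF s]) (use that in simp)
    have mvl: "model_vec z (el K l) = slot_emb ?s (frame_vec r (z (K, r)) K (el K l))" if "l \<in> {1..card K}" for z :: "nat set \<times> nat \<Rightarrow> nat \<Rightarrow> nat \<Rightarrow> 'k" and l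
      using mv_eq[OF s, of "el K l" z] el_in[OF f(1) that] by simp
    have fwl: "frame_vec r z K (el K l) = (if l \<le> r + 1 then frame r l else z l)" if "l \<in> {1..card K}" for z :: "nat \<Rightarrow> nat \<Rightarrow> 'k" and l
      using pos_el[OF f(1) that] by (simp add: frame_vec_def)
    \<comment> \<open>The frame lines are the same in both models, so \<open>g\<close> maps each of
      them to itself.\<close>
    have gl: "\<exists>a. a \<noteq> 0 \<and> g (slot_emb ?s (frame r l)) = fscale a (slot_emb ?s (frame r l))" if "l \<in> {1..r + 1}" for l
    proof -
      have lc: "l \<in> {1..card K}" "l \<le> r + 1" using that f(3) by auto
      have "c (el K l) \<noteq> 0" "slot_emb ?s (frame r l) = fscale (c (el K l)) (g (slot_emb ?s (frame r l)))"
        using gc[OF el_in_m[OF K lc(1)]] unfolding mvl[OF lc(1)] fwl[OF lc(1)] using lc(2) by auto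
      then have "fscale (inverse (c (el K l))) (slot_emb ?s (frame r l)) = g (slot_emb ?s (frame r l))"
        by (metis fv.scale_scale left_inverse fv.scale_one)
      then show ?thesis using \<open>c (el K l) \<noteq> 0\<close> by (intro exI[of _ "inverse (c (el K l))"]) simp
    qed
    have gE: "\<exists>a. g (E l) = fscale a (E l)" if "l \<in> {1..r}" for l
    proof -
      have "slot_emb ?s (frame r l) = E l" using emb_unit_vec[OF s, of l] that by (simp add: frame_def E_def)
      then show ?thesis using gl[of l] that by auto
    qed
    then obtain a where a: "\<And>l. l \<in> {1..r} \<Longrightarrow> g (E l) = fscale (a l) (E l)" by metis
    obtain b where b: "b \<noteq> 0" "g (slot_emb ?s (frame r (r + 1))) = fscale b (slot_emb ?s (frame r (r + 1)))" using gl[of "r + 1"] by auto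
    have gemb: "g (slot_emb ?s x) = (\<Sum>l\<in>{1..r}. fscale (x l) (fscale (a l) (E l)))" if "x \<in> Kvec r" for x
    proof -
      have "slot_emb ?s x = (\<Sum>l\<in>{1..r}. fscale (x l) (E l))" using emb_expand[OF s, of x] that by (simp add: E_def)
      then have "g (slot_emb ?s x) = (\<Sum>l\<in>{1..r}. fscale (x l) (g (E l)))"
        using lin_iso_lincomb[OF gi subspace_Kvec, of "{1..r}" E x] EK by simp
      also have "\<dots> = (\<Sum>l\<in>{1..r}. fscale (x l) (fscale (a l) (E l)))" using a by (intro sum.cong) auto
      finally show ?thesis .
    qed
    have gemb_coord: "g (slot_emb ?s x) (coord (?s, l)) = x l * a l" if "x \<in> Kvec r" "l \<in> {1..r}" for x l
    proof -
      have "E k (coord (?s, l)) = (if k = l then 1 else 0)" if "k \<in> {1..r}" for k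
        using coord_inj[OF s, of l ?s k] s that \<open>l \<in> {1..r}\<close> by (auto simp: E_def unit_vec_def)
      then have "g (slot_emb ?s x) (coord (?s, l)) = (\<Sum>k\<in>{1..r}. if k = l then x k * a k else 0)"
        unfolding gemb[OF that(1)] sum_fun_apply fscale_def by (intro sum.cong) auto
      then show ?thesis using that(2) by simp
    qed
    have fr: "frame r (r + 1) l = (1 :: 'k)" if "l \<in> {1..r}" for l
      using that unfolding frame_def sum_unit by simp
    \<comment> \<open>All coordinates of the sum vector are 1, and \<open>g\<close> multiplies it by
      \<open>b\<close>; comparison of coordinates makes every eigenvalue \<open>a l\<close> equal to
      \<open>b\<close>.\<close>
    have ab: "a l = b" if l: "l \<in> {1..r}" for l
    proof -
      have fK: "frame r (r + 1) \<in> (Kvec r :: (nat \<Rightarrow> 'k) set)" by (rule frame_in) simp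
      have "a l = fscale b (slot_emb ?s (frame r (r + 1))) (coord (?s, l))"
        using gemb_coord[OF fK l] fr[OF l] b(2) by simp
      also have "\<dots> = b" using emb_coord[OF s _ s, of l "frame r (r + 1) :: nat \<Rightarrow> 'k"] l fr[OF l] by (simp add: fscale_def)
      finally show ?thesis .
    qed
    have scalar: "g (slot_emb ?s x) = fscale b (slot_emb ?s x)" if "x \<in> Kvec r" for x
    proof -
      have "g (slot_emb ?s x) = (\<Sum>l\<in>{1..r}. fscale b (fscale (x l) (E l)))"
        unfolding gemb[OF that] using ab by (intro sum.cong) (auto simp: mult.commute)
      also have "\<dots> = fscale b (slot_emb ?s x)"
        using emb_expand[OF s, of x] that by (simp add: E_def fv.scale_sum_right)
      finally show ?thesis .
    qed
    have hc: "h \<in> {1..card K}" "\<not> h \<le> r + 1" using h by auto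
    have yh: "y (K, r) h \<in> Kvec r - {0}" "y' (K, r) h \<in> Kvec r - {0}"
      using bspec[OF bspec[OF y(1)[unfolded good_def] K], of h] bspec[OF bspec[OF y'(1)[unfolded good_def] K], of h] h by auto
    let ?c = "c (el K h)"
    have c: "?c \<noteq> 0" "slot_emb ?s (y' (K, r) h) = fscale ?c (g (slot_emb ?s (y (K, r) h)))"
      using gc[OF el_in_m[OF K hc(1)]] unfolding mvl[OF hc(1)] fwl[OF hc(1)] using hc(2) by auto
    have eqn: "slot_emb ?s (y' (K, r) h) = slot_emb ?s (fscale (?c * b) (y (K, r) h))"
      unfolding c(2) using scalar[of "y (K, r) h"] yh by (simp add: emb_scale)
    have k1: "y' (K, r) h \<in> Kvec (slot_rank ?s)" using yh(2) by simp
    have "y (K, r) h \<in> Kvec (slot_rank ?s)" using yh(1) by simp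
    then have k2: "fscale (?c * b) (y (K, r) h) \<in> Kvec (slot_rank ?s)" by (rule fv.subspace_scale[OF subspace_Kvec])
    have "y' (K, r) h = fscale (?c * b) (y (K, r) h)" by (rule emb_inj[OF s k1 k2 eqn])
    moreover have "?c * b \<noteq> 0" using c(1) b(1) by simp
    ultimately have "fv.span {y' (K, r) h} = fv.span {y (K, r) h}"
      using span_singleton_eq_iff[of "y (K, r) h" "y' (K, r) h"] yh by blast
    then show ?thesis using Kr by simp
  qed
  then show "q = q'" unfolding y(2) y'(2) params_of_def by (intro restrict_ext) blast
qed

end


section \<open>Openness and density of the generic part\<close>

lemma indep_fam_iff_full_rank:
  "finite A \<Longrightarrow> card A = r \<Longrightarrow> rk v A = r \<longleftrightarrow> indep_fam v A"
  by (simp add: indep_fam_iff_rk)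

context pdatum
begin

lemma K_facts2:
  assumes K: "(K, r) \<in> Ks"
  shows "finite K" "r + 1 \<le> card K" "K \<subseteq> {1..m}" "finite (head K r)" "i \<in> head K r \<Longrightarrow> card (head K r - {i}) = r"
proof -
  show f: "finite K" "r + 1 \<le> card K" using K_facts[OF K] by auto
  show "K \<subseteq> {1..m}" using support_subset[of "KSlot K r"] KSlot_in[OF K] core_subset by auto
  show h: "finite (head K r)" by (rule finite_head[OF f(1)])
  show "i \<in> head K r \<Longrightarrow> card (head K r - {i}) = r" using card_head[OF f] h by simp
qed

lemma circuit_iff_indep:
  assumes K: "(K, r) \<in> Ks"
  shows "circuit v K r \<longleftrightarrow> (\<forall>i\<in>head K r. indep_fam v (head K r - {i}))"
  unfolding circuit_def using indep_fam_iff_full_rank[OF finite_Diff[OF K_facts2(4)[OF K]] K_facts2(5)[OF K]] by blast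

text \<open>Finitely many independence conditions, each of them open by
  \<open>indep_fam_open\<close>.\<close>

lemma openin_generic: "openin (top_of_set stratum) (generic :: (nat \<Rightarrow> nat \<Rightarrow> 'k::real_normed_field) set)"
proof (subst openin_subopen, rule ballI)
  fix v :: "nat \<Rightarrow> nat \<Rightarrow> 'k" assume v: "v \<in> generic"
  have vK: "v i \<in> Kvec n" if "(K, r) \<in> Ks" "i \<in> head K r" for K r i
    using vecsD(1)[OF genericD(1)[OF v]] K_facts2(3)[OF that(1)] that(2) head_subset by blast
  have "\<exists>T. open T \<and> v \<in> T \<and> (\<forall>u\<in>T. indep_fam u (head K r - {i}))" if K: "(K, r) \<in> Ks" and i: "i \<in> head K r" for K r i
  proof (rule indep_fam_open)
    show "finite (head K r - {i})" using K_facts2(4)[OF K] by simp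
    show "indep_fam v (head K r - {i})" using genericD(3)[OF v K] i circuit_iff_indep[OF K] by blast
    show "v k \<in> Kvec n" if "k \<in> head K r - {i}" for k using vK[OF K] that by blast
  qed
  then have "\<forall>K r i. \<exists>T. (K, r) \<in> Ks \<and> i \<in> head K r \<longrightarrow> open T \<and> v \<in> T \<and> (\<forall>u\<in>T. indep_fam u (head K r - {i}))" by blast
  then obtain T where T: "\<And>K r i. (K, r) \<in> Ks \<Longrightarrow> i \<in> head K r \<Longrightarrow>
      open (T K r i) \<and> v \<in> T K r i \<and> (\<forall>u\<in>T K r i. indep_fam u (head K r - {i}))" by metis
  define W where "W = (\<Inter>c\<in>Ks. \<Inter>i\<in>head (fst c) (snd c). T (fst c) (snd c) i)"
  have "open W" unfolding W_def using finite_Ks K_facts2(4) T by (intro open_INT) auto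
  then have "openin (top_of_set stratum) (stratum \<inter> W)" by (rule openin_open_Int)
  moreover have "v \<in> stratum \<inter> W" using v T unfolding W_def generic_def by auto
  moreover have "stratum \<inter> W \<subseteq> generic"
  proof
    fix u assume u: "u \<in> stratum \<inter> W"
    have "circuit u K r" if K: "(K, r) \<in> Ks" for K r
      unfolding circuit_iff_indep[OF K]
    proof
      fix i assume i: "i \<in> head K r"
      have "u \<in> T K r i" using u K i unfolding W_def by fastforce
      then show "indep_fam u (head K r - {i})" using T[OF K i] by blast
    qed
    then show "u \<in> generic" using u unfolding generic_def by auto
  qed
  ultimately show "\<exists>T. openin (top_of_set stratum) T \<and> v \<in> T \<and> T \<subseteq> generic" by blast
qed

text \<open>The perturbation takes place inside the span of each block and for the chosen
  \<open>t\<close> does not change that span, so the ranks prescribed by \<open>p\<close> persist.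
  Connectedness of the perturbed blocks is then a consequence of the circuits, by
  \<open>circuit_connected\<close>.\<close>

lemma generic_dense:
  fixes v :: "nat \<Rightarrow> nat \<Rightarrow> 'k::real_normed_field"
  assumes v: "v \<in> stratum" and T: "open T" "v \<in> T"
  shows "\<exists>u\<in>generic. u \<in> T"
proof -
  have vv: "v \<in> vec_configs n m" and re: "realizes m p v" using v by (auto simp: stratum_def)
  have rkK: "rk v K = r" if "(K, r) \<in> Ks" for K r
    using KSlot_in[OF that] re unfolding realizes_def by force
  have "\<exists>b :: nat \<Rightarrow> nat \<Rightarrow> 'k. indep_fam b {1..r} \<and> fv.span (b ` {1..r}) = fv.span (v ` K)" if K: "(K, r) \<in> Ks" for K r
  proof -
    have "finite (v ` K)" "fv.dim (v ` K) = r" using K_facts2(1)[OF K] rkK[OF K] by (auto simp: rk_def)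
    then show ?thesis using ex_basis_fam by metis
  qed
  then obtain b :: "nat set \<Rightarrow> nat \<Rightarrow> nat \<Rightarrow> nat \<Rightarrow> 'k" where
    b: "\<And>K r. (K, r) \<in> Ks \<Longrightarrow> indep_fam (b K r) {1..r} \<and> fv.span (b K r ` {1..r}) = fv.span (v ` K)" by metis
  \<comment> \<open>On the head of a block \<open>u\<close> is the standard frame, transported into
    the span of the block; elsewhere it is 0, so that vectors outside the heads do not move.\<close>
  define u where "u i = (if i \<in> {1..m} then (case slot_of i of
      KSlot K r \<Rightarrow> if pos K i \<le> r + 1 then lincomb r (b K r) (frame r (pos K i)) else 0 | _ \<Rightarrow> 0) else 0)" for i
  have slotK: "slot_of i = KSlot K r" if "(K, r) \<in> Ks" "i \<in> K" for K r i
    using slot_of_eq[of "KSlot K r" i] KSlot_in[OF that(1)] that(2) core_subset by auto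
  have u_head: "u i = lincomb r (b K r) (frame r (pos K i))" if K: "(K, r) \<in> Ks" and i: "i \<in> head K r" for K r i
  proof -
    have "i \<in> K" "pos K i \<le> r + 1" using i by (auto simp: head_def)
    then show ?thesis using slotK[OF K] K_facts2(3)[OF K] unfolding u_def by auto
  qed
  have u_other: "u i = 0" if "\<And>K r. (K, r) \<in> Ks \<Longrightarrow> i \<notin> head K r" for i
  proof (cases "i \<in> {1..m}")
    case True
    show ?thesis
      using conjunct1[OF slot_of[OF True]]
    proof (cases rule: core_slot_cases)
      case (K A r)
      have "i \<in> A" using slot_of[OF True] K(1) by simp
      then have "\<not> pos A i \<le> r + 1" using that[OF K(2)] by (auto simp: head_def)
      then show ?thesis unfolding u_def K(1) by simp
    qed (simp_all add: u_def)
  next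
    case False then show ?thesis unfolding u_def by (simp only: if_False)
  qed
  have L: "lin_iso (lincomb r (b K r)) (Kvec r) (fv.span (v ` K))" if K: "(K, r) \<in> Ks" for K r
    using lin_iso_lincomb_span[of "b K r" r] b[OF K] by simp
  have fK: "frame r (pos K i) \<in> (Kvec r :: (nat \<Rightarrow> 'k) set)" if "(K, r) \<in> Ks" "i \<in> K" for K r i
    using pos_in[OF K_facts2(1)[OF that(1)] that(2)] by (intro frame_in) simp
  have u_span: "u i \<in> fv.span (v ` K)" if K: "(K, r) \<in> Ks" and i: "i \<in> K" for K r i
  proof (cases "i \<in> head K r")
    case True
    show ?thesis unfolding u_head[OF K True] using lin_iso_image[OF L[OF K]] fK[OF K i] by blast
  next
    case False
    have "i \<notin> head A q" if A: "(A, q) \<in> Ks" for A q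
    proof
      assume h: "i \<in> head A q"
      then have "KSlot A q = KSlot K r" using slotK[OF A, of i] slotK[OF K i] head_subset by auto
      then show False using h False by simp
    qed
    then have "u i = 0" by (rule u_other)
    then show ?thesis using fv.span_zero by simp
  qed
  have u_indep: "indep_fam u (head K r - {i})" and v_span: "\<And>k. k \<in> head K r - {i} \<Longrightarrow> v k \<in> fv.span (u ` (head K r - {i}))"
    if K: "(K, r) \<in> Ks" and i: "i \<in> head K r" for K r i
  proof -
    let ?A = "head K r - {i}"
    have AK: "?A \<subseteq> K" using head_subset by blast
    have iK: "i \<in> K" "pos K i \<in> {1..r + 1}" using i pos_in[OF K_facts2(1)[OF K]] by (auto simp: head_def)
    have "rk (lincomb r (b K r) \<circ> (\<lambda>k. frame r (pos K k))) ?A = rk (\<lambda>k. frame r (pos K k) :: nat \<Rightarrow> 'k) ?A"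
      by (rule rk_lin_iso[OF L[OF K]]) (use fK[OF K] AK in auto)
    moreover have "rk (lincomb r (b K r) \<circ> (\<lambda>k. frame r (pos K k))) ?A = rk u ?A"
      by (rule rk_cong) (use u_head[OF K] in auto)
    moreover have "rk (\<lambda>k. frame r (pos K k) :: nat \<Rightarrow> 'k) ?A = r"
      using rk_frame[OF iK(2), where 'k = 'k] pos_head_minus[OF K_facts2(1,2)[OF K] iK(1)]
      by (simp add: rk_def image_image[symmetric, of _ "pos K"])
    ultimately have rkA: "rk u ?A = r" by simp
    have finA: "finite ?A" using K_facts2(4)[OF K] by simp
    show "indep_fam u ?A" using rkA indep_fam_iff_full_rank[OF finA K_facts2(5)[OF K i]] by blast
    have "fv.span (u ` ?A) = fv.span (v ` K)"
    proof (rule span_eq_of_dim)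
      show "u ` ?A \<subseteq> fv.span (v ` K)" using u_span[OF K] AK by blast
      show "fv.dim (v ` K) \<le> fv.dim (u ` ?A)" using rkA rkK[OF K] by (simp add: rk_def)
    qed (use K_facts2(1)[OF K] in simp)
    then show "\<And>k. k \<in> ?A \<Longrightarrow> v k \<in> fv.span (u ` ?A)" using AK fv.span_superset[of "v ` K"] by blast
  qed
  define w where "w t = (\<lambda>i. v i + fscale t (u i))" for t
  define Bad where "Bad = (\<Union>c\<in>Ks. \<Union>i\<in>head (fst c) (snd c). {t. \<not> indep_fam (w t) (head (fst c) (snd c) - {i})})"
  have finBad: "finite Bad"
    unfolding Bad_def
  proof (intro finite_UN_I finite_Ks)
    fix c i assume c: "c \<in> Ks" and i: "i \<in> head (fst c) (snd c)"
    have c': "(fst c, snd c) \<in> Ks" using c by simp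
    show "finite {t. \<not> indep_fam (w t) (head (fst c) (snd c) - {i})}"
      unfolding w_def
      by (rule finite_dependent_shifts[OF _ u_indep[OF c' i] v_span[OF c' i]]) (use K_facts2(4)[OF c'] in simp)
  next
    fix c assume "c \<in> Ks"
    then have "(fst c, snd c) \<in> Ks" by simp
    then show "finite (head (fst c) (snd c))" by (rule K_facts2(4))
  qed
  have "continuous_on UNIV w"
  proof (rule continuous_on_coordinatewise_then_product)
    fix i
    show "continuous_on UNIV (\<lambda>t. w t i)"
      unfolding w_def
    proof (rule continuous_on_coordinatewise_then_product)
      fix j show "continuous_on UNIV (\<lambda>t. (v i + fscale t (u i)) j)"
        unfolding plus_fun_apply fscale_def by (intro continuous_intros)
    qed
  qed
  then have "(w \<longlongrightarrow> w 0) (at 0)" unfolding continuous_on_def by blast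
  moreover have "w 0 = v" by (rule ext) (simp add: w_def)
  ultimately have "(w \<longlongrightarrow> v) (at 0)" by simp
  then have "eventually (\<lambda>t. w t \<in> T) (at 0)" by (rule topological_tendstoD) (rule T)+
  \<comment> \<open>\<open>v\<close> itself may fail the circuit condition, so \<open>Bad\<close>
    may contain 0; the punctured filter \<open>at 0\<close> avoids this value.\<close>
  moreover have "eventually (\<lambda>t. \<forall>s\<in>Bad. t \<noteq> s) (at (0::'k))"
    by (rule eventually_ball_finite[OF finBad]) (simp add: eventually_neq_at_within)
  ultimately have "eventually (\<lambda>t. w t \<in> T \<and> (\<forall>s\<in>Bad. t \<noteq> s)) (at 0)" by (rule eventually_conj)
  then obtain t where t: "w t \<in> T" "t \<notin> Bad" using eventually_happens'[OF at_neq_bot] by blast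
  have ind: "indep_fam (w t) (head K r - {i})" if "(K, r) \<in> Ks" "i \<in> head K r" for K r i
    using t(2) that unfolding Bad_def by fastforce
  have circ: "circuit (w t) K r" if "(K, r) \<in> Ks" for K r
    using circuit_iff_indep[OF that] ind[OF that] by blast
  have w_span: "w t i \<in> fv.span (v ` K)" if K: "(K, r) \<in> Ks" and i: "i \<in> K" for K r i
    unfolding w_def by (intro fv.span_add fv.span_scale u_span[OF K i] fv.span_base imageI i)
  have rkw: "rk (w t) K = r" if K: "(K, r) \<in> Ks" for K r
  proof (rule antisym)
    have "fv.dim (w t ` K) \<le> fv.dim (v ` K)"
      using w_span[OF K] K_facts2(1)[OF K] by (intro dim_mono_span) auto
    then show "rk (w t) K \<le> r" using rkK[OF K] by (simp add: rk_def)
    have "card (head K r) = r + 1" by (rule card_head[OF K_facts2(1,2)[OF K]])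
    then have "head K r \<noteq> {}" by auto
    then obtain i where i: "i \<in> head K r" by blast
    show "r \<le> rk (w t) K"
      using circ[OF K] i rk_mono[OF K_facts2(1)[OF K], of "head K r - {i}" "w t"] head_subset[of K r]
      unfolding circuit_def by auto
  qed
  have spanw: "fv.span (w t ` K) = fv.span (v ` K)" if K: "(K, r) \<in> Ks" for K r
    using w_span[OF K] K_facts2(1)[OF K] rkw[OF K] rkK[OF K]
    by (intro span_eq_of_dim) (auto simp: rk_def)
  have w_nohead: "w t i = v i" if "\<And>K r. (K, r) \<in> Ks \<Longrightarrow> i \<notin> head K r" for i
    using u_other[OF that] by (simp add: w_def)
  have wvecs: "w t \<in> vec_configs n m"
    unfolding vec_configs_def mem_Collect_eq
  proof
    fix i assume i: "i \<in> {1..m}"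
    show "w t i \<in> Kvec n - {0}"
    proof (cases "\<exists>K r. (K, r) \<in> Ks \<and> i \<in> head K r")
      case False
      then have "w t i = v i" by (intro w_nohead) blast
      then show ?thesis using vecsD[OF vv i] by simp
    next
      case True
      then obtain K r where K: "(K, r) \<in> Ks" "i \<in> head K r" by blast
      \<comment> \<open>As \<open>r\<close> is at least 2, the head has an element \<open>k\<close>
        other than \<open>i\<close>; the head without \<open>k\<close> is an independent family that
        contains \<open>i\<close>, so \<open>w t i\<close> is nonzero.\<close>
      have "card (head K r - {i}) \<noteq> 0" using K_facts[OF K(1)] unfolding K_facts2(5)[OF K] by simp
      then have "head K r - {i} \<noteq> {}" by (metis card.empty)
      then obtain k where k: "k \<in> head K r" "k \<noteq> i" by blast
      have "w t i \<noteq> 0"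
        by (rule indep_fam_nonzero[OF _ ind[OF K(1) k(1)]]) (use K_facts2(4)[OF K(1)] K(2) k(2) in auto)
      moreover have "w t i \<in> fv.span (v ` K)" using w_span[OF K(1)] K(2) head_subset by blast
      moreover have "fv.span (v ` K) \<subseteq> Kvec n"
        using vecsD(1)[OF vv] K_facts2(3)[OF K(1)] by (intro fv.span_minimal) auto
      ultimately show ?thesis by blast
    qed
  qed
  have same: "w t i = v i" if s: "s \<in> core_slots p" "i \<in> slot_support s" "\<And>K r. s \<noteq> KSlot K r" for s i
  proof (rule w_nohead, rule notI)
    fix K r assume K: "(K, r) \<in> Ks" and h: "i \<in> head K r"
    have "slot_of i = s" using slot_of_eq[of s i] s core_subset by auto
    moreover have "slot_of i = KSlot K r" using slotK[OF K] h head_subset by blast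
    ultimately show False using s(3)[of K r] by simp
  qed
  have "realizes m p (w t)"
  proof (rule realizesI)
    fix s assume s: "s \<in> core_slots p"
    have "rk (w t) (slot_support s) = slot_rank s \<and> connected_fam (w t) (slot_support s)"
    proof (cases "\<exists>K r. s = KSlot K r")
      case True
      then obtain K r where K: "s = KSlot K r" "(K, r) \<in> Ks" using s unfolding core_eq by auto
      have "connected_fam (w t) K"
      proof (rule circuit_connected[OF K_facts2(1)[OF K(2)] head_subset card_head[OF K_facts2(1,2)[OF K(2)]] _ rkw[OF K(2)]])
        show "rk (w t) (head K r - {i}) = r" if "i \<in> head K r" for i using circ[OF K(2)] that unfolding circuit_def by blast
        show "w t i \<noteq> 0" if "i \<in> K" for i using vecsD(2)[OF wvecs] K_facts2(3)[OF K(2)] that by blast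
      qed
      then show ?thesis using rkw[OF K(2)] K(1) by simp
    next
      case False
      have eq: "rk v A = rk (w t) A" if "A \<subseteq> slot_support s" for A
        using same[OF s] False that by (intro rk_cong) auto
      have "rk v (slot_support s) = slot_rank s" "connected_fam v (slot_support s)"
        using re s unfolding realizes_def by blast+
      then show ?thesis using eq[OF order_refl] connected_fam_cong_rk[OF eq] by simp
    qed
    then show "rk (w t) (slot_support s) = slot_rank s" "connected_fam (w t) (slot_support s)" by blast+
  next
    \<comment> \<open>The span of every block is unchanged, so the vectors of \<open>w t\<close>
      still span all of \<open>v\<close> and the total rank does not drop.\<close>
    have "v i \<in> fv.span (w t ` {1..m})" if i: "i \<in> {1..m}" for i
    proof (cases "\<exists>K r. slot_of i = KSlot K r")
      case True
      then obtain K r where K: "slot_of i = KSlot K r" by blast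
      have K2: "(K, r) \<in> Ks" "i \<in> K" using slot_of[OF i] unfolding K core_eq by auto
      have "v i \<in> fv.span (w t ` K)" unfolding spanw[OF K2(1)] by (rule fv.span_base) (use K2(2) in blast)
      then show ?thesis using fv.span_mono[of "w t ` K" "w t ` {1..m}"] K_facts2(3)[OF K2(1)] by blast
    next
      case False
      then have "w t i = v i" using same[of "slot_of i" i] slot_of[OF i] by blast
      moreover have "w t i \<in> fv.span (w t ` {1..m})" by (rule fv.span_base) (rule imageI[OF i])
      ultimately show ?thesis by simp
    qed
    then have "fv.dim (v ` {1..m}) \<le> fv.dim (w t ` {1..m})" by (intro dim_mono_span) auto
    then show "rank_p p \<le> rk (w t) {1..m}" using re by (simp add: realizes_def rk_def)
  qed
  then have "w t \<in> generic" using wvecs circ unfolding generic_def stratum_def by auto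
  then show ?thesis using t(1) by blast
qed

text \<open>An injective continuous open map is an embedding. Openness and density are both pulled
  back along \<open>vec_orbit\<close> to statements about \<open>generic\<close> inside
  \<open>stratum\<close>.\<close>

lemma iota_open_dense_embedding:
  assumes m: "1 \<le> m"
  shows "open_dense_embedding (param_space p) (fibre_space n m p :: 'k::real_normed_field config set topology) (iota n m p)"
proof -
  let ?Q = "param_space p :: 'k params topology" and ?Y = "fibre_space n m p :: 'k config set topology"
  have sub: "generic \<subseteq> (stratum :: (nat \<Rightarrow> nat \<Rightarrow> 'k) set)" unfolding generic_def by blast
  have "open_map ?Q ?Y (iota n m p)"
    unfolding open_map_def
  proof (intro allI impI)
    fix W assume W: "openin ?Q W"
    \<comment> \<open>By \<open>iota_yv\<close> and injectivity, the image of \<open>W\<close>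
      consists of the orbits of those generic \<open>v\<close> whose frame coordinates lie in
      \<open>W\<close>.\<close>
    let ?V = "{v \<in> generic. params_of (frame_coords v) \<in> W}"
    have "openin (top_of_set generic) ?V"
      using openin_continuous_map_preimage[OF continuous_map_par_yv W] by simp
    then have V: "openin (top_of_set stratum) ?V" using openin_generic by (rule openin_trans)
    have "iota n m p ` W = vec_orbit n m ` ?V"
    proof (intro subset_antisym subsetI)
      fix z assume "z \<in> iota n m p ` W"
      then obtain q where q: "q \<in> W" "z = iota n m p q" by blast
      have qQ: "q \<in> topspace ?Q" using q(1) openin_subset[OF W] by blast
      then have "z \<in> vec_orbit n m ` generic" using iota_image q(2) by blast
      then obtain v where v: "v \<in> generic" "z = vec_orbit n m v" by blast
      have "iota n m p (params_of (frame_coords v)) = iota n m p q" using iota_yv[OF v(1)] v(2) q(2) by simp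
      moreover have "params_of (frame_coords v) \<in> topspace ?Q" unfolding topspace_param_space using yv_good[OF v(1)] by blast
      ultimately have "params_of (frame_coords v) = q" using inj_onD[OF inj_iota] qQ by blast
      then show "z \<in> vec_orbit n m ` ?V" using v q(1) by blast
    next
      fix z assume "z \<in> vec_orbit n m ` ?V"
      then obtain v where v: "v \<in> generic" "params_of (frame_coords v) \<in> W" "z = vec_orbit n m v" by blast
      then show "z \<in> iota n m p ` W" using iota_yv[OF v(1)] by (metis imageI)
    qed
    then show "openin ?Y (iota n m p ` W)" using openin_fibre_orb[OF m V] by simp
  qed
  then have "embedding_map ?Q ?Y (iota n m p)"
    by (intro injective_open_imp_embedding_map continuous_map_iota[OF m] inj_iota)
  moreover have "openin ?Y (iota n m p ` topspace ?Q)"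
    unfolding iota_image by (rule openin_fibre_orb[OF m openin_generic])
  moreover have "?Y closure_of (iota n m p ` topspace ?Q) = topspace ?Y"
    unfolding dense_intersects_open
  proof (intro allI impI)
    fix W assume W: "openin ?Y W \<and> W \<noteq> {}"
    have "continuous_map (top_of_set stratum) (orbit_space n m) (vec_orbit n m :: _ \<Rightarrow> 'k config set)"
      by (rule continuous_map_from_subtopology_mono[OF continuous_map_orb]) (auto simp: stratum_def)
    then have "continuous_map (top_of_set stratum) ?Y (vec_orbit n m)"
      unfolding fibre_space_def continuous_map_in_subtopology using fibre_eq[OF m] by auto
    then have "openin (top_of_set stratum) {v \<in> stratum. vec_orbit n m v \<in> W}"
      using openin_continuous_map_preimage[of "top_of_set stratum" ?Y "vec_orbit n m" W] W by simp
    then obtain T where T: "open T" "{v \<in> stratum. vec_orbit n m v \<in> W} = stratum \<inter> T" by (auto simp: openin_open)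
    obtain z where z: "z \<in> W" using W by blast
    then have "z \<in> vec_orbit n m ` stratum" using openin_subset[of ?Y W] W topspace_fibre_space fibre_eq[OF m] by blast
    then obtain v where v: "v \<in> stratum" "v \<in> T" using T(2) z by blast
    obtain u where u: "u \<in> generic" "u \<in> T" using generic_dense[OF v(1) T(1) v(2)] by blast
    then have "vec_orbit n m u \<in> W" using T(2) sub by blast
    then show "iota n m p ` topspace ?Q \<inter> W \<noteq> {}" unfolding iota_image using u(1) by blast
  qed
  ultimately show ?thesis unfolding open_dense_embedding_def by blast
qed

lemma iota_theorem:
  assumes m: "1 \<le> m"
  shows "iota n m p \<in> topspace (param_space p) \<rightarrow> (fibre n m p :: 'k::real_normed_field config set set) \<and>
     open_dense_embedding (param_space p) (fibre_space n m p :: 'k config set topology) (iota n m p) \<and>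
     (Ks = {} \<longrightarrow>
        is_singleton (fibre n m p :: 'k config set set) \<and>
        is_singleton (topspace (param_space p :: 'k params topology)) \<and>
        bij_betw (iota n m p) (topspace (param_space p)) (fibre n m p :: 'k config set set))"
proof (intro conjI impI)
  have sub: "generic \<subseteq> (stratum :: (nat \<Rightarrow> nat \<Rightarrow> 'k) set)" unfolding generic_def by blast
  have "iota n m p ` topspace (param_space p) \<subseteq> (fibre n m p :: 'k config set set)"
    unfolding iota_image fibre_eq[OF m] using sub by (rule image_mono)
  then show "iota n m p \<in> topspace (param_space p) \<rightarrow> (fibre n m p :: 'k config set set)"
    unfolding image_subset_iff_funcset .
  show "open_dense_embedding (param_space p) (fibre_space n m p :: 'k config set topology) (iota n m p)"
    by (rule iota_open_dense_embedding[OF m])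
  assume K: "Ks = {}"
  \<comment> \<open>Without blocks \<open>(K, r)\<close> the circuit condition is void, so every
    orbit of the fibre lies in the image.\<close>
  then have "generic = (stratum :: (nat \<Rightarrow> nat \<Rightarrow> 'k) set)" unfolding generic_def by simp
  then have im: "iota n m p ` topspace (param_space p) = (fibre n m p :: 'k config set set)"
    unfolding iota_image fibre_eq[OF m] by simp
  then show b: "bij_betw (iota n m p) (topspace (param_space p)) (fibre n m p :: 'k config set set)"
    unfolding bij_betw_def using inj_iota by blast
  \<comment> \<open>The empty product has one point, the function with value
    \<open>undefined\<close> everywhere.\<close>
  have "topspace (param_space p :: 'k params topology) = {\<lambda>_. undefined}"
    unfolding param_space_eq topspace_product_topology K by simp
  then have top: "topspace (param_space p :: 'k params topology) = {\<lambda>_. undefined}" .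
  show "is_singleton (topspace (param_space p :: 'k params topology))" unfolding top is_singleton_def by blast
  show "is_singleton (fibre n m p :: 'k config set set)"
    unfolding im[symmetric] top is_singleton_def by blast
qed

end


theorem theorem2p6:
  fixes n m :: nat
    and Is Js :: "nat set set"
    and Ks :: "(nat set \<times> nat) set"
  assumes "2 \<le> n" and "1 \<le> m"
    and "(Is, Js, Ks) \<in> Pset n m"
  shows
    "(let p = (Is, Js, Ks);
          Q = (param_space p :: real params topology);
          Y = (fibre_space n m p :: real config set topology)
      in iota n m p \<in> topspace Q \<rightarrow> fibre n m p \<and>
         open_dense_embedding Q Y (iota n m p) \<and>
         (Ks = {} \<longrightarrow>
            is_singleton (fibre n m p :: real config set set) \<and>
            is_singleton (topspace Q) \<and>
            bij_betw (iota n m p) (topspace Q) (fibre n m p))) \<and>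
     (let p = (Is, Js, Ks);
          Q = (param_space p :: complex params topology);
          Y = (fibre_space n m p :: complex config set topology)
      in iota n m p \<in> topspace Q \<rightarrow> fibre n m p \<and>
         open_dense_embedding Q Y (iota n m p) \<and>
         (Ks = {} \<longrightarrow>
            is_singleton (fibre n m p :: complex config set set) \<and>
            is_singleton (topspace Q) \<and>
            bij_betw (iota n m p) (topspace Q) (fibre n m p)))"
proof -
  interpret pdatum n m "(Is, Js, Ks)" by standard fact
  from iota_theorem[OF assms(2), where 'k = real, unfolded snd_conv]
    iota_theorem[OF assms(2), where 'k = complex, unfolded snd_conv]
  show ?thesis unfolding Let_def by (rule conjI)
qed

end
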